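(* Let $a_i,b_i,c_i>0$ for $1\le i\le d$, let $(Z_t)$ be iid $\mathcal N(0,1)$, and consider the CCC-GARCH(1,1) model with totally correlated innovations $$\boldsymbol R_t=\boldsymbol\Sigma_tN_t,\qquad \boldsymbol\Sigma_t=\mathrm{Diag}(\sigma_{t,1},\dots,\sigma_{t,d}),\qquad \sigma_{t,i}^2=a_i+b_i\sigma_{t-1,i}^2+c_iR_{t-1,i}^2,\qquad t\in\mathbb Z,$$ where $N_t=(1,\dots,1)^\top Z_t$. Assume $\mathbb E[\log(b_i+c_iZ_0^2)]<0$ for $1\le i\le d$, and that $c_j/c_i\ge b_j/b_i$ whenever $\alpha_i>\alpha_j$, with $\alpha_i$ and the blocks $I_1,\dots,I_r$ as in the context. Then the volatility $\boldsymbol X_t=(\sigma_{t,1}^2,\dots,\sigma_{t,d}^2)^\top$ of the stationary solution is a VSRV process (of order $\boldsymbol\alpha=(\alpha_1,\dots,\alpha_d)$) satisfying $$\mathrm{supp}(\widetilde{\boldsymbol\Theta}_0)=\bigcup_{1\le\ell\le r}\{\boldsymbol q_\ell\},$$ where $\boldsymbol q_\ell\in\mathbb R^d$ is given by $$(\boldsymbol q_\ell)_i=\begin{cases}0,& i\notin I_\ell,\\ a_i/q_\ell^*,& i\in I_\ell,\end{cases}\qquad q_\ell^*:=\max_{j\in I_\ell}a_j.$$ Moreover $$\widetilde{\boldsymbol\Theta}_t=\mathrm{Diag}(b_1+c_1Z_t^2,\dots,b_d+c_dZ_t^2)\,\widetilde{\boldsymbol\Theta}_{t-1},\qquad t\g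e1.$$
   Context: The volatility satisfies (in law, as a process) the diagonal SRE $\boldsymbol X_t=\mathrm{Diag}(b_1+c_1Z_t^2,\dots,b_d+c_dZ_t^2)\boldsymbol X_{t-1}+\boldsymbol q$ with deterministic $\boldsymbol q=(a_1,\dots,a_d)^\top$. For each $i$, $\alpha_i>0$ is the unique positive solution of $\mathbb E[(b_i+c_iZ_0^2)^{\alpha_i}]=1$. Coordinates are ordered so that $\alpha_i$ decreases (weakly) with $i$, and $\{1,\dots,d\}=I_1\cup\dots\cup I_r$ is a partition such that $b_i=b_j$, $c_i=c_j$, and then $\alpha_i=\alpha_j$, if and only if $i,j\in I_\ell$ for some $\ell$ (in particular coordinates in different blocks have different $\alpha$'s). Notation: vector operations are coordinatewise; $\|\boldsymbol x\|_{\boldsymbol\alpha}=\max_i|x_i|^{\alpha_i}$, and for $\lambda>0$, $\lambda^{-1/\boldsymbol\alpha}\boldsymbol x=(\lambda^{-1/\alpha_i}x_i)_i$ (applied to each vector of a sequence). VSRV (vector scaling regular variation): a stationary time series $(\boldsymbol X_t)$ is VSRV of order $\boldsymbol\alpha$ if, for $1\le i\le d$, $\mathbb P(|X_{0,i}|>x)\sim \kappa_ix^{-\alpha_i}$ as $x\to\infty$ for some constant $\kappa_i>0$, $\|\boldsymbol X_0\|_{\boldsymbol\alpha}$ is regularly varying, and for every $t\ge0$ the weak limit $$\lim_{x\to\infty}\mathbb P\big(\|\boldsymbol X_0\|_{\boldsymbol\alpha}^{-1/\boldsymbol\alpha}(\boldsymbol X_0,\dots,\boldsymbol X_t)\in\cdot\,\big|\,\|\boldsymbol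 X_0\|_{\boldsymbol\alpha}>x\big)=\mathbb P\big((\widetilde{\boldsymbol\Theta}_0,\dots,\widetilde{\boldsymbol\Theta}_t)\in\cdot\big)$$ exists; $(\widetilde{\boldsymbol\Theta}_t)_{t\ge0}$ is the spectral tail process. The recursion for $\widetilde{\boldsymbol\Theta}_t$ is an identity for the law of the spectral tail process, with $(Z_t)_{t\ge1}$ iid $\mathcal N(0,1)$ independent of $\widetilde{\boldsymbol\Theta}_0$. $\mathrm{supp}(\widetilde{\boldsymbol\Theta}_0)$ is the support of the law of $\widetilde{\boldsymbol\Theta}_0$. *)

theory Defs
  imports "HOL-Probability.Probability" "HOL-Library.Landau_Symbols"
begin

definition Diag :: "real^'d \<Rightarrow> real^'d^'d" where
  "Diag v = (\<chi> i j. if i = j then v $ i else 0)"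

definition alpha_norm :: "real^'d::finite \<Rightarrow> real^'d \<Rightarrow> real" where
  "alpha_norm \<alpha> x = Max (range (\<lambda>i. \<bar>x $ i\<bar> powr (\<alpha> $ i)))"

text \<open>\<open>vscale \<alpha> \<lambda> x\<close> is \<open>\<lambda>\<close> to the power \<open>-1/\<alpha>\<close> times \<open>x\<close>, coordinatewise.\<close>

definition vscale :: "real^'d \<Rightarrow> real \<Rightarrow> real^'d \<Rightarrow> real^'d" where
  "vscale \<alpha> l x = (\<chi> i. l powr (- 1 / \<alpha> $ i) * x $ i)"

definition strictly_stationary :: "'w measure \<Rightarrow> (int \<Rightarrow> 'w \<Rightarrow> 'a::topological_space) \<Rightarrow> bool" where
  "strictly_stationary M X \<longleftrightarrow>
     (\<forall>t. X t \<in> borel_measurable M) \<and>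
     (\<forall>h. distr M (\<Pi>\<^sub>M t\<in>UNIV. borel) (\<lambda>\<omega> t. X (t + h) \<omega>) = distr M (\<Pi>\<^sub>M t\<in>UNIV. borel) (\<lambda>\<omega> t. X t \<omega>))"

definition regularly_varying_rv :: "'w measure \<Rightarrow> ('w \<Rightarrow> real) \<Rightarrow> bool" where
  "regularly_varying_rv M Y \<longleftrightarrow>
     Y \<in> borel_measurable M \<and>
     (\<exists>\<beta>>0. \<forall>u>0. ((\<lambda>x. measure M {\<omega>\<in>space M. Y \<omega> > u * x} / measure M {\<omega>\<in>space M. Y \<omega> > x})
        \<longlongrightarrow> u powr (- \<beta>)) at_top)"

text \<open>Weak convergence along a filter, for measures carried by the topological subspace
  \<^term>\<open>space \<nu>\<close> of the ambient type.  On the product of \<open>borel\<close> over \<open>{..t}\<close> this subspace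
  consists of the functions that are extensional on \<open>{..t}\<close>, and its topology is the product
  topology of the tuples \<open>(y 0, \<dots>, y t)\<close>.\<close>

definition converges_weakly ::
  "('b \<Rightarrow> 'a::topological_space measure) \<Rightarrow> 'a measure \<Rightarrow> 'b filter \<Rightarrow> bool" where
  "converges_weakly \<mu> \<nu> F \<longleftrightarrow>
     (\<forall>f :: 'a \<Rightarrow> real. continuous_on (space \<nu>) f \<longrightarrow> bounded (f ` space \<nu>) \<longrightarrow>
        ((\<lambda>x. \<integral>y. f y \<partial>\<mu> x) \<longlongrightarrow> (\<integral>y. f y \<partial>\<nu>)) F)"

text \<open>The spectral tail process enters only through its law \<open>\<nu>\<close> on path space, which is
  determined by the weak limits below.\<close>

definition spectral_tail_law ::
  "'w measure \<Rightarrow> (int \<Rightarrow> 'w \<Rightarrow> real^'d::finite) \<Rightarrow> real^'d \<Rightarrow> (nat \<Rightarrow> real^'d) measure \<Rightarrow> bool" where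
  "spectral_tail_law M X \<alpha> \<nu> \<longleftrightarrow>
     prob_space \<nu> \<and> sets \<nu> = sets (\<Pi>\<^sub>M t\<in>UNIV. borel) \<and>
     (\<forall>t. converges_weakly
        (\<lambda>x. distr (uniform_measure M {\<omega>\<in>space M. alpha_norm \<alpha> (X 0 \<omega>) > x}) (\<Pi>\<^sub>M s\<in>{..t}. borel)
               (\<lambda>\<omega>. \<lambda>s\<in>{..t}. vscale \<alpha> (alpha_norm \<alpha> (X 0 \<omega>)) (X (int s) \<omega>)))
        (distr \<nu> (\<Pi>\<^sub>M s\<in>{..t}. borel) (\<lambda>\<theta>. restrict \<theta> {..t})) at_top)"

definition VSRV :: "'w measure \<Rightarrow> (int \<Rightarrow> 'w \<Rightarrow> real^'d::finite) \<Rightarrow> real^'d \<Rightarrow> bool" where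
  "VSRV M X \<alpha> \<longleftrightarrow>
     strictly_stationary M X \<and>
     (\<forall>i. \<exists>\<kappa>>0. (\<lambda>x. measure M {\<omega>\<in>space M. \<bar>X 0 \<omega> $ i\<bar> > x}) \<sim>[at_top] (\<lambda>x. \<kappa> * x powr (- \<alpha> $ i))) \<and>
     regularly_varying_rv M (\<lambda>\<omega>. alpha_norm \<alpha> (X 0 \<omega>)) \<and>
     (\<exists>\<nu>. spectral_tail_law M X \<alpha> \<nu>)"

definition measure_support :: "'a::topological_space measure \<Rightarrow> 'a set" where
  "measure_support \<mu> = {x. \<forall>U. open U \<longrightarrow> x \<in> U \<longrightarrow> emeasure \<mu> U > 0}"

definition std_normal :: "real measure" where
  "std_normal = density lborel (\<lambda>x. ennreal (std_normal_density x))"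

text \<open>CCC-GARCH(1,1) with totally correlated innovations: the innovation vector at time \<open>t\<close> has
  all coordinates equal to \<open>Z t\<close>.\<close>

definition ccc_garch ::
  "'w measure \<Rightarrow> (int \<Rightarrow> 'w \<Rightarrow> real) \<Rightarrow> real^'d::finite \<Rightarrow> real^'d \<Rightarrow> real^'d \<Rightarrow>
   (int \<Rightarrow> 'w \<Rightarrow> real^'d) \<Rightarrow> (int \<Rightarrow> 'w \<Rightarrow> real^'d) \<Rightarrow> bool" where
  "ccc_garch M Z a b c R \<sigma> \<longleftrightarrow>
     (\<forall>t. AE \<omega> in M. R t \<omega> = Diag (\<sigma> t \<omega>) *v (\<chi> i. Z t \<omega>)) \<and>
     (\<forall>t i. AE \<omega> in M. (\<sigma> t \<omega> $ i)\<^sup>2 = a $ i + b $ i * (\<sigma> (t - 1) \<omega> $ i)\<^sup>2 + c $ i * (R (t - 1) \<omega> $ i)\<^sup>2)"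

definition stationary_ccc_garch ::
  "'w measure \<Rightarrow> (int \<Rightarrow> 'w \<Rightarrow> real) \<Rightarrow> real^'d::finite \<Rightarrow> real^'d \<Rightarrow> real^'d \<Rightarrow>
   (int \<Rightarrow> 'w \<Rightarrow> real^'d) \<Rightarrow> (int \<Rightarrow> 'w \<Rightarrow> real^'d) \<Rightarrow> bool" where
  "stationary_ccc_garch M Z a b c R \<sigma> \<longleftrightarrow>
     ccc_garch M Z a b c R \<sigma> \<and> strictly_stationary M (\<lambda>t \<omega>. (R t \<omega>, \<sigma> t \<omega>))"

primrec tail_recursion ::
  "real^'d::finite \<Rightarrow> real^'d \<Rightarrow> real^'d \<Rightarrow> (nat \<Rightarrow> real) \<Rightarrow> nat \<Rightarrow> real^'d" where
  "tail_recursion b c \<theta> z 0 = \<theta>"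
| "tail_recursion b c \<theta> z (Suc t) = Diag (\<chi> i. b $ i + c $ i * (z (Suc t))\<^sup>2) *v tail_recursion b c \<theta> z t"

text \<open>Law of the process driven by \<open>tail_recursion\<close>, started from \<open>\<mu>\<close>, with iid standard normal
  \<open>z\<close> independent of the initial value (\<open>z 0\<close> is not used).\<close>

definition tail_recursion_law ::
  "real^'d::finite \<Rightarrow> real^'d \<Rightarrow> (real^'d) measure \<Rightarrow> (nat \<Rightarrow> real^'d) measure" where
  "tail_recursion_law b c \<mu> =
     distr (\<mu> \<Otimes>\<^sub>M (\<Pi>\<^sub>M t\<in>UNIV. std_normal)) (\<Pi>\<^sub>M t\<in>UNIV. borel) (\<lambda>(\<theta>, z). tail_recursion b c \<theta> z)"

definition block_partition :: "nat \<Rightarrow> (nat \<Rightarrow> 'd set) \<Rightarrow> bool" where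
  "block_partition r I \<longleftrightarrow>
     (\<forall>l\<in>{1..r}. I l \<noteq> {}) \<and> disjoint_family_on I {1..r} \<and> (\<Union>l\<in>{1..r}. I l) = UNIV"

definition q_vec :: "real^'d::finite \<Rightarrow> 'd set \<Rightarrow> real^'d" where
  "q_vec a J = (\<chi> i. if i \<in> J then a $ i / Max ((\<lambda>j. a $ j) ` J) else 0)"

end

theory Submission
  imports Defs "HOL-Real_Asymp.Real_Asymp"
begin

text \<open>
  Each coordinate satisfies \<open>X = a + A X'\<close> with \<open>A\<close> independent of \<open>X'\<close> and \<open>X'\<close> distributed like
  \<open>X\<close>. Put \<open>W = A\<close> to the power \<open>\<alpha>\<close>, \<open>V = X'\<close> to the power \<open>\<alpha>\<close> and \<open>J t = E min(V, exp t)\<close>.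
  Since \<open>E W = 1\<close>, the difference \<open>J t - E[W J(t - ln W)]\<close> increases to a finite \<open>D > 0\<close>. Hence
  \<open>f t = J(t + h) - J t\<close> is asymptotically harmonic for the random walk with step \<open>- ln W\<close> under the
  law weighted by \<open>W\<close>: along a sequence where \<open>f\<close> approaches its limsup, all shifts of \<open>f\<close> approach
  it too, and on such a flat window the identity above forces the value to be \<open>D h / E[W ln W]\<close> up
  to an error of order \<open>h\<close> squared. The liminf is treated alike, and \<open>h \<rightarrow> 0\<close> gives
  \<open>P(V > x) \<sim> \<kappa> / x\<close> with \<open>\<kappa> > 0\<close>. This replaces the renewal theorem in the theorem of Kesten and
  Goldie.

  For different blocks the strict inequality between arithmetic and geometric mean gives
  \<open>E[A\<^sub>i powr (\<alpha>\<^sub>i/2) * A\<^sub>j powr (\<alpha>\<^sub>j/2)] < 1\<close>, so the corresponding product of the coordinates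
  of \<open>X\<close> is integrable and two blocks are large together with probability \<open>o(1/x)\<close>. Inside a block
  the coordinates are exactly proportional to \<open>a\<close>. Given that the norm is large, a single block
  therefore dominates and the scaled initial vector is close to the corresponding \<open>q\<close>; the innovations
  that drive the later path are independent of it, because the stationary solution is causal.
\<close>

section \<open>Tails of a perturbed random multiplication\<close>

text \<open>With a tail of order 1/x, \<open>V\<close> has infinite mean; truncation at
  \<open>exp t\<close> makes expectations available. The increment of \<open>J\<close> over a window
  of length \<open>h\<close> lies between \<open>exp t * (exp h - 1)\<close> times the tail of
  \<open>V\<close> at the right end and at the left end of the window. This is why \<open>h\<close>
  has to go to 0: only then do limits of increments determine the tail itself. Two obstacles shape
  the renewal part. The limsup argument needs a bounded and equicontinuous \<open>f\<close>, so the
  crude bound \<open>C / x\<close> on the tail has to come beforehand; its source is the same defect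
  \<open>D\<close>, combined with the chance that \<open>W\<close> is below 1. Moreover every shift
  must be reachable, which is the non-lattice condition in this setting: \<open>W\<close> charges
  all intervals above \<open>w0\<close>, and \<open>w0 < 1\<close> puts a whole neighbourhood of 0
  within one step. In the application \<open>w0\<close> is the least value of \<open>W\<close>, and
  it is below 1 because the logarithmic moment is negative. For paths, the later noise is averaged
  out first. What remains is a continuous function of the scaled initial vector and of the factors
  that scale \<open>a\<close>, and those factors vanish at large norm.\<close>

lemma (in prob_space) integrable_bounded:
  fixes f :: "'a \<Rightarrow> real"
  assumes "f \<in> borel_measurable M" and "\<And>w. \<bar>f w\<bar> \<le> B"
  shows "integrable M f"
  by (rule integrable_const_bound[of _ B]) (use assms in auto)

lemma (in prob_space) abs_expectation_le:
  fixes f :: "'a \<Rightarrow> real"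
  assumes B: "\<And>w. \<bar>f w\<bar> \<le> B" shows "\<bar>expectation f\<bar> \<le> B"
proof (cases "f \<in> borel_measurable M")
  case True
  then have "integrable M f" by (rule integrable_bounded) (rule B)
  moreover have "\<bar>expectation f\<bar> \<le> expectation (\<lambda>w. \<bar>f w\<bar>)" by (rule integral_abs_bound)
  moreover have "expectation (\<lambda>w. \<bar>f w\<bar>) \<le> expectation (\<lambda>_. B)"
    using \<open>integrable M f\<close> by (intro integral_mono) (auto intro: B)
  ultimately have "\<bar>expectation f\<bar> \<le> expectation (\<lambda>_. B)" by linarith
  then show ?thesis by (simp add: prob_space)
next
  case False
  then have "\<not> integrable M f" by auto
  then show ?thesis using order_trans[OF abs_ge_zero B] by (simp add: not_integrable_integral_eq)
qed

text \<open>Fubini on the common space \<open>M\<close>. Independence enters as an equality of laws,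
  so that \<open>X\<close> and \<open>Y\<close> may take values in different types.\<close>

lemma (in prob_space) expectation_iterated:
  fixes g :: "'b \<times> 'c \<Rightarrow> real"
  assumes X[measurable]: "X \<in> measurable M S" and Y[measurable]: "Y \<in> measurable M T"
    and eq: "distr M S X \<Otimes>\<^sub>M distr M T Y = distr M (S \<Otimes>\<^sub>M T) (\<lambda>w. (X w, Y w))"
    and g[measurable]: "g \<in> borel_measurable (S \<Otimes>\<^sub>M T)"
    and bd: "\<And>x y. \<bar>g (x, y)\<bar> \<le> B"
  shows "expectation (\<lambda>w. g (X w, Y w)) = expectation (\<lambda>w. expectation (\<lambda>w'. g (X w, Y w')))"
proof -
  interpret X: prob_space "distr M S X" by (rule prob_space_distr[OF X])
  interpret Y: prob_space "distr M T Y" by (rule prob_space_distr[OF Y])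
  interpret P: pair_prob_space "distr M S X" "distr M T Y" ..
  have "expectation (\<lambda>w. g (X w, Y w)) = (\<integral>z. g z \<partial>(distr M S X \<Otimes>\<^sub>M distr M T Y))"
    unfolding eq by (subst integral_distr) auto
  also have "\<dots> = (\<integral>x. (\<integral>y. g (x, y) \<partial>distr M T Y) \<partial>distr M S X)"
    by (subst P.integral_fst'[symmetric]) (auto intro!: P.integrable_bounded[of _ B] bd)
  also have "\<dots> = expectation (\<lambda>w. \<integral>y. g (X w, y) \<partial>distr M T Y)"
    by (subst integral_distr) (auto intro!: Y.borel_measurable_lebesgue_integral)
  also have "\<dots> = expectation (\<lambda>w. expectation (\<lambda>w'. g (X w, Y w')))"
    by (rule Bochner_Integration.integral_cong[OF refl], subst integral_distr) auto
  finally show ?thesis .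
qed

lemma (in prob_space) expectation_cong_distr:
  fixes g :: "'b \<Rightarrow> real"
  assumes "distr M S X = distr M S Y" "X \<in> measurable M S" "Y \<in> measurable M S" "g \<in> borel_measurable S"
  shows "expectation (\<lambda>w. g (X w)) = expectation (\<lambda>w. g (Y w))"
  using integral_distr[OF assms(2,4)] integral_distr[OF assms(3,4)] assms(1) by simp

text \<open>\<open>V'\<close> is a copy of \<open>V\<close> one step later, coupled so that it dominates \<open>W * V\<close>.\<close>

locale implicit_renewal = prob_space M for M :: "'a measure" +
  fixes W V V' :: "'a \<Rightarrow> real" and w0 :: real
  assumes indep: "indep_var borel W borel V"
    and V'_measurable[measurable]: "V' \<in> borel_measurable M"
    and law: "distr M borel V' = distr M borel V"
    and W_pos: "W w > 0" and V_nonneg: "V w \<ge> 0" and V'_ge: "W w * V w \<le> V' w"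
    and gap_integrable: "integrable M (\<lambda>w. V' w - W w * V w)"
    and gap_pos: "expectation (\<lambda>w. V' w - W w * V w) > 0"
    and W_integrable: "integrable M W" and W_mean: "expectation W = 1"
    and WlnW_integrable: "integrable M (\<lambda>w. W w * ln (W w))"
    and w0: "0 < w0" "w0 < 1"
    and W_supp: "y > w0 \<Longrightarrow> \<eta> > 0 \<Longrightarrow> \<P>(w in M. \<bar>W w - y\<bar> < \<eta>) > 0"
begin

lemma W_measurable[measurable]: "W \<in> borel_measurable M"
  and V_measurable[measurable]: "V \<in> borel_measurable M"
  using indep_var_rv1[OF indep] indep_var_rv2[OF indep] by simp_all

section \<open>The truncated mean and the defect of its renewal equation\<close>

definition J where "J t = expectation (\<lambda>w. min (V w) (exp t))"

definition D where "D = expectation (\<lambda>w. V' w - W w * V w)"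

lemma D_pos: "D > 0" using gap_pos by (simp add: D_def)

lemma WV_nonneg: "0 \<le> W w * V w" and V'_nonneg: "0 \<le> V' w"
  using W_pos[of w] V_nonneg[of w] V'_ge[of w] by (simp_all add: order_trans[OF _ V'_ge])

lemma integrable_min_V: "K \<ge> 0 \<Longrightarrow> integrable M (\<lambda>w. min (V w) K)"
  and integrable_min_WV: "K \<ge> 0 \<Longrightarrow> integrable M (\<lambda>w. min (W w * V w) K)"
  and integrable_min_V': "K \<ge> 0 \<Longrightarrow> integrable M (\<lambda>w. min (V' w) K)"
  by (rule integrable_bounded[of _ K]; simp add: V_nonneg WV_nonneg V'_nonneg)+

lemma J_eq': "J t = expectation (\<lambda>w. min (V' w) (exp t))"
  unfolding J_def by (rule expectation_cong_distr[OF law[symmetric], of "\<lambda>v. min v (exp t)"]) auto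

lemma J_mono: "s \<le> t \<Longrightarrow> J s \<le> J t"
  unfolding J_def by (intro integral_mono integrable_min_V min.mono) auto

lemma J_nonneg: "J t \<ge> 0"
  unfolding J_def by (intro Bochner_Integration.integral_nonneg) (auto simp: V_nonneg)

lemma J_le: "J t \<le> exp t"
proof -
  have "J t \<le> expectation (\<lambda>_. exp t)"
    unfolding J_def by (intro integral_mono integrable_min_V) auto
  then show ?thesis by (simp add: prob_space)
qed

lemma J_measurable[measurable]: "J \<in> borel_measurable borel"
  by (rule borel_measurable_mono) (auto simp: mono_def J_mono)

lemma J_shift_integrable: "integrable M (\<lambda>w. W w * J (t - ln (W w)))"
proof (rule integrable_bounded[of _ "exp t"])
  fix w
  have "W w * J (t - ln (W w)) \<le> W w * exp (t - ln (W w))"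
    using W_pos[of w] by (intro mult_left_mono J_le) auto
  also have "\<dots> = exp t" using W_pos[of w] by (simp add: exp_diff)
  finally show "\<bar>W w * J (t - ln (W w))\<bar> \<le> exp t"
    using W_pos[of w] J_nonneg by (simp add: abs_mult)
qed measurable

text \<open>For a fixed value of \<open>W\<close>, truncating \<open>W * V\<close> at
  \<open>exp t\<close> is \<open>W\<close> times truncating \<open>V\<close> at
  \<open>exp (t - ln W)\<close>; averaging over \<open>V\<close> first produces \<open>J\<close> at
  the shifted argument.\<close>

lemma expectation_min_WV:
  "expectation (\<lambda>w. min (W w * V w) (exp t)) = expectation (\<lambda>w. W w * J (t - ln (W w)))"
proof -
  \<comment> \<open>The maximum with 0 changes nothing at nonnegative arguments, but it bounds the
    integrand for all real pairs, as \<open>expectation_iterated\<close> demands.\<close>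
  have "expectation (\<lambda>w. min (W w * V w) (exp t)) =
      expectation (\<lambda>w. (\<lambda>(y,v). max 0 (min (y * v) (exp t))) (W w, V w))"
    using V_nonneg W_pos by (intro Bochner_Integration.integral_cong) (auto simp: max_def mult_less_0_iff not_less less_imp_le not_le min_def)
  also have "\<dots> = expectation (\<lambda>w. expectation (\<lambda>w'. (\<lambda>(y,v). max 0 (min (y * v) (exp t))) (W w, V w')))"
    using indep by (intro expectation_iterated[of _ borel _ borel _ "exp t"]) (auto simp: indep_var_distribution_eq)
  also have "\<dots> = expectation (\<lambda>w. W w * J (t - ln (W w)))"
  proof (rule Bochner_Integration.integral_cong[OF refl])
    fix w
    have "max 0 (min (W w * V w') (exp t)) = W w * min (V w') (exp (t - ln (W w)))" for w'
      using W_pos[of w] V_nonneg[of w'] by (auto simp: min_def max_def exp_diff field_simps)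
    then show "expectation (\<lambda>w'. (\<lambda>(y,v). max 0 (min (y * v) (exp t))) (W w, V w')) = W w * J (t - ln (W w))"
      by (simp add: J_def)
  qed
  finally show ?thesis .
qed

definition gap where "gap t = J t - expectation (\<lambda>w. W w * J (t - ln (W w)))"

text \<open>Passing from \<open>V\<close> to its copy \<open>V'\<close> puts both truncations under
  one expectation, where the coupling makes the integrand nonnegative and at most
  \<open>V' - W * V\<close>. Bound and limit of \<open>gap\<close> follow from this form.\<close>

lemma gap_eq: "gap t = expectation (\<lambda>w. min (V' w) (exp t) - min (W w * V w) (exp t))"
  unfolding gap_def expectation_min_WV[symmetric] J_eq'[of t]
  by (subst Bochner_Integration.integral_diff) (auto intro: integrable_min_V' integrable_min_WV)

lemma min_gap_le: "min (V' w) K - min (W w * V w) K \<le> V' w - W w * V w"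
  and min_gap_nonneg: "0 \<le> min (V' w) K - min (W w * V w) K"
  using V'_ge[of w] by auto

lemma gap_le: "gap t \<le> D"
  unfolding gap_eq D_def
  by (rule integral_mono[OF Bochner_Integration.integrable_diff gap_integrable min_gap_le])
    (simp_all add: integrable_min_V' integrable_min_WV)

lemma gap_tendsto: "(gap \<longlongrightarrow> D) at_top"
  unfolding D_def
proof (rule tendsto_cong[THEN iffD1])
  show "\<forall>\<^sub>F t in at_top. expectation (\<lambda>w. min (V' w) (exp t) - min (W w * V w) (exp t)) = gap t"
    by (simp add: gap_eq)
  show "((\<lambda>t. expectation (\<lambda>w. min (V' w) (exp t) - min (W w * V w) (exp t))) \<longlongrightarrow>
     expectation (\<lambda>w. V' w - W w * V w)) at_top"
  proof (rule integral_dominated_convergence_at_top[where w="\<lambda>w. V' w - W w * V w"])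
    show "AE w in M. ((\<lambda>t. min (V' w) (exp t) - min (W w * V w) (exp t)) \<longlongrightarrow> V' w - W w * V w) at_top"
    proof (rule AE_I2)
      fix w
      have "\<forall>\<^sub>F t::real in at_top. exp t \<ge> V' w"
        using exp_at_top by (auto simp: filterlim_at_top)
      then have "\<forall>\<^sub>F t in at_top. V' w - W w * V w = min (V' w) (exp t) - min (W w * V w) (exp t)"
        by eventually_elim (use V'_ge[of w] in \<open>auto simp: min_def\<close>)
      then show "((\<lambda>t. min (V' w) (exp t) - min (W w * V w) (exp t)) \<longlongrightarrow> V' w - W w * V w) at_top"
        by (rule tendsto_eventually[OF eventually_mono]) simp
    qed
    show "\<forall>\<^sub>F t in at_top. AE w in M. norm (min (V' w) (exp t) - min (W w * V w) (exp t)) \<le> V' w - W w * V w"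
      using min_gap_le min_gap_nonneg by (auto intro!: always_eventually AE_I2)
  qed (auto intro: gap_integrable)
qed

text \<open>Raising the truncation level matters only where \<open>V > exp t\<close>, and there by
  at most \<open>exp (t + h) - exp t\<close>. The companion \<open>J_increment_ge\<close> keeps only
  the points where the full amount is gained.\<close>

lemma J_increment_le:
  assumes "h \<ge> 0" shows "J (t + h) - J t \<le> exp t * (exp h - 1) * \<P>(w in M. V w > exp t)"
proof -
  have "J (t + h) - J t = expectation (\<lambda>w. min (V w) (exp (t + h)) - min (V w) (exp t))"
    unfolding J_def by (subst Bochner_Integration.integral_diff) (auto intro: integrable_min_V)
  also have "\<dots> \<le> expectation (\<lambda>w. exp t * (exp h - 1) * indicator {w\<in>space M. V w > exp t} w)"
    using assms by (intro integral_mono Bochner_Integration.integrable_diff integrable_min_V integrable_mult_right integrable_real_indicator)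
      (auto simp: indicator_def min_def exp_add algebra_simps emeasure_eq_measure split: if_splits)
  finally show ?thesis by simp
qed

lemma J_increment_ge:
  assumes "h \<ge> 0" shows "J (t + h) - J t \<ge> exp t * (exp h - 1) * \<P>(w in M. V w > exp (t + h))"
proof -
  have "exp t * (exp h - 1) * \<P>(w in M. V w > exp (t + h))
     = expectation (\<lambda>w. exp t * (exp h - 1) * indicator {w\<in>space M. V w > exp (t + h)} w)" by simp
  also have "\<dots> \<le> expectation (\<lambda>w. min (V w) (exp (t + h)) - min (V w) (exp t))"
    using assms by (intro integral_mono Bochner_Integration.integrable_diff integrable_min_V integrable_mult_right integrable_real_indicator)
      (auto simp: indicator_def min_def exp_add algebra_simps emeasure_eq_measure split: if_splits)
  also have "\<dots> = J (t + h) - J t"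
    unfolding J_def by (subst Bochner_Integration.integral_diff) (auto intro: integrable_min_V)
  finally show ?thesis .
qed

section \<open>A priori bound of order 1/x for the tail\<close>

text \<open>Subtracting \<open>(1 - W) * V\<close> on the event \<open>V < K\<close>, which has mean zero by independence, makes
  the integrand of \<^const>\<open>gap\<close> nonnegative, so one piece of it can be bounded by \<^const>\<open>D\<close>.\<close>

lemma tail_block_bound:
  assumes "w1 > w0" "w1 < 1"
  shows "exp t * ((1 - w1) / 2 * \<P>(w in M. W w \<le> w1)) *
     \<P>(w in M. exp t \<le> V w \<and> V w < 2 / (1 + w1) * exp t) \<le> D"
proof -
  define K where "K = exp t"
  define \<rho> where "\<rho> = 2 / (1 + w1)"
  have K: "K > 0" by (simp add: K_def)
  have w1: "0 < w1" using w0 assms by simp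
  \<comment> \<open>In the form \<open>4 * w1 \<le> (1 + w1)^2\<close> this is the inequality of
    arithmetic and geometric mean. Hence \<open>W \<le> w1\<close> keeps \<open>W * V\<close> below
    \<open>K\<close> by the margin \<open>K * (1 - w1) / 2\<close> on the whole block from
    \<open>K\<close> to \<open>\<rho> * K\<close>.\<close>
  have \<rho>: "w1 * \<rho> \<le> 1 - (1 - w1) / 2"
  proof -
    have "2 * w1 * 2 \<le> (1 + w1) * (1 + w1)" using sum_squares_ge_zero[of "1 - w1" 0] by (simp add: algebra_simps)
    then show ?thesis using w1 by (simp add: \<rho>_def field_simps)
  qed
  define B where "B w = V w * indicator {w. V w < K} w" for w
  have [measurable]: "B \<in> borel_measurable M" unfolding B_def indicator_def by measurable
  have intB: "integrable M B"
    by (rule integrable_bounded[of _ K]) (use K V_nonneg in \<open>auto simp: B_def indicator_def\<close>)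
  have int1W: "integrable M (\<lambda>w. 1 - W w)" using W_integrable by simp
  have indB: "indep_var borel (\<lambda>w. 1 - W w) borel B"
    using indep_var_compose[OF indep, of "\<lambda>y. 1 - y" borel "\<lambda>v. v * indicator {v. v < K} v" borel]
    by (simp add: comp_def B_def[abs_def] indicator_def)
  have EB: "integrable M (\<lambda>w. (1 - W w) * B w)" "expectation (\<lambda>w. (1 - W w) * B w) = 0"
    using indep_var_integrable[OF indB int1W intB] indep_var_lebesgue_integral[OF indB int1W intB]
    by (simp_all add: W_integrable W_mean prob_space)
  define iW where "iW w = (indicator {y. y \<le> w1} (W w) :: real)" for w
  define iV where "iV w = (indicator {v. K \<le> v \<and> v < \<rho> * K} (V w) :: real)" for w
  have [measurable]: "iW \<in> borel_measurable M" "iV \<in> borel_measurable M" unfolding iW_def iV_def by measurable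
  have indi: "indep_var borel iW borel iV"
    using indep_var_compose[OF indep, of "indicator {y. y \<le> w1}" borel "indicator {v. K \<le> v \<and> v < \<rho> * K}" borel]
    by (simp add: comp_def iV_def[abs_def] iW_def[abs_def])
  have inti: "integrable M iW" "integrable M iV"
    by (rule integrable_bounded[of _ 1]; simp add: iW_def iV_def indicator_def)+
  have Ei: "integrable M (\<lambda>w. iW w * iV w)" "expectation (\<lambda>w. iW w * iV w) = expectation iW * expectation iV"
    using indep_var_integrable[OF indi inti] indep_var_lebesgue_integral[OF indi inti] by simp_all
  have EiW: "expectation iW = \<P>(w in M. W w \<le> w1)"
  proof -
    have "expectation iW = expectation (indicator {w\<in>space M. W w \<le> w1})"
      by (rule Bochner_Integration.integral_cong) (auto simp: iW_def indicator_def)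
    then show ?thesis by simp
  qed
  have EiV: "expectation iV = \<P>(w in M. K \<le> V w \<and> V w < \<rho> * K)"
  proof -
    have "expectation iV = expectation (indicator {w\<in>space M. K \<le> V w \<and> V w < \<rho> * K})"
      by (rule Bochner_Integration.integral_cong) (auto simp: iV_def indicator_def)
    then show ?thesis by simp
  qed
  have "K * ((1 - w1) / 2) * (expectation iW * expectation iV) = expectation (\<lambda>w. K * ((1 - w1) / 2) * (iW w * iV w))"
    by (simp add: Ei)
  also have "\<dots> \<le> expectation (\<lambda>w. (min (V w) K - min (W w * V w) K) - (1 - W w) * B w)"
  proof (rule integral_mono)
    show "integrable M (\<lambda>w. K * ((1 - w1) / 2) * (iW w * iV w))" using Ei by simp
    show "integrable M (\<lambda>w. (min (V w) K - min (W w * V w) K) - (1 - W w) * B w)"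
      using K by (intro Bochner_Integration.integrable_diff integrable_min_V integrable_min_WV EB) auto
    fix w
    show "K * ((1 - w1) / 2) * (iW w * iV w) \<le> (min (V w) K - min (W w * V w) K) - (1 - W w) * B w"
    proof (cases "V w < K")
      case True
      then show ?thesis by (simp add: iV_def B_def algebra_simps)
    next
      case False
      show ?thesis
      proof (cases "W w \<le> w1 \<and> V w < \<rho> * K")
        case True
        have "W w * V w \<le> w1 * (\<rho> * K)"
          using True W_pos[of w] V_nonneg[of w] w1 by (intro mult_mono) auto
        also have "\<dots> \<le> (1 - (1 - w1) / 2) * K" using \<rho> K by (simp add: mult.assoc[symmetric])
        finally have "W w * V w \<le> K - K * ((1 - w1) / 2)" by (simp add: algebra_simps)
        then show ?thesis using True False by (simp add: iV_def iW_def B_def)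
      next
        case False2: False
        then show ?thesis using False by (auto simp: iV_def iW_def B_def)
      qed
    qed
  qed
  also have "\<dots> = expectation (\<lambda>w. min (V w) K) - expectation (\<lambda>w. min (W w * V w) K)"
    using K by (subst Bochner_Integration.integral_diff) (auto simp: EB intro!: Bochner_Integration.integral_diff Bochner_Integration.integrable_diff integrable_min_V integrable_min_WV)
  also have "\<dots> = gap t" unfolding K_def expectation_min_WV gap_def J_def ..
  also have "\<dots> \<le> D" by (rule gap_le)
  finally show ?thesis unfolding EiV EiW by (simp add: K_def \<rho>_def mult_ac)
qed

text \<open>The half-line above \<open>exp t\<close> is cut into blocks of ratio
  \<open>\<rho> > 1\<close>. By \<open>tail_block_bound\<close> the block that starts at
  \<open>\<rho> ^ n * exp t\<close> has probability at most \<open>D / \<beta>\<close> divided by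
  its starting point, and these bounds form a geometric series.\<close>

lemma tail_bound: "\<exists>C>0. \<forall>t. exp t * \<P>(w in M. V w > exp t) \<le> C"
proof -
  define w1 where "w1 = (w0 + 1) / 2"
  have w1: "w1 > w0" "w1 < 1" "w1 > 0" using w0 by (auto simp: w1_def)
  define \<rho> where "\<rho> = 2 / (1 + w1)"
  have \<rho>: "\<rho> > 1" using w1 by (simp add: \<rho>_def)
  \<comment> \<open>This event says that \<open>W\<close> lies in the interval from
    \<open>w0\<close> to \<open>w1\<close>, whose midpoint is
    \<open>(3 * w0 + 1) / 4\<close>.\<close>
  have "0 < \<P>(w in M. \<bar>W w - (3 * w0 + 1) / 4\<bar> < (1 - w0) / 4)"
    by (rule W_supp) (use w0 in auto)
  also have "\<dots> \<le> \<P>(w in M. W w \<le> w1)"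
    by (rule finite_measure_mono) (auto simp: w1_def abs_less_iff field_simps)
  finally have p1: "0 < \<P>(w in M. W w \<le> w1)" .
  define \<beta> where "\<beta> = (1 - w1) / 2 * \<P>(w in M. W w \<le> w1)"
  have \<beta>: "\<beta> > 0" using p1 w1 by (simp add: \<beta>_def)
  have blk: "exp t * \<P>(w in M. exp t \<le> V w \<and> V w < \<rho> * exp t) \<le> D / \<beta>" for t
    using tail_block_bound[OF w1(1,2), of t, folded \<beta>_def \<rho>_def] \<beta> by (simp add: pos_le_divide_eq mult_ac)
  define S where "S n t = {w\<in>space M. exp t \<le> V w \<and> V w < \<rho> ^ n * exp t}" for n t
  have [measurable]: "S n t \<in> events" for n t unfolding S_def by measurable
  have step: "exp t * prob (S n t) \<le> D / \<beta> * (\<Sum>k<n. (1 / \<rho>) ^ k)" for n t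
  proof (induction n)
    case 0
    have "S 0 t = {}" by (auto simp: S_def)
    then show ?case by simp
  next
    case (Suc n)
    define s where "s = t + of_nat n * ln \<rho>"
    have es: "exp s = \<rho> ^ n * exp t"
      using \<rho> by (simp add: s_def exp_add exp_of_nat_mult)
    have "prob (S (Suc n) t) \<le>
      prob (S n t \<union> {w\<in>space M. exp s \<le> V w \<and> V w < \<rho> * exp s})"
      by (rule finite_measure_mono) (auto simp: S_def es)
    also have "\<dots> \<le> prob (S n t) + \<P>(w in M. exp s \<le> V w \<and> V w < \<rho> * exp s)"
      by (rule measure_Un_le) auto
    finally have "exp t * prob (S (Suc n) t) \<le>
       exp t * prob (S n t) + exp t * \<P>(w in M. exp s \<le> V w \<and> V w < \<rho> * exp s)"
      by (simp add: distrib_left[symmetric])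
    moreover have "exp t * \<P>(w in M. exp s \<le> V w \<and> V w < \<rho> * exp s) \<le> D / \<beta> * (1 / \<rho>) ^ n"
    proof -
      define P where "P = \<P>(w in M. exp s \<le> V w \<and> V w < \<rho> * exp s)"
      have "(exp t * P) * \<rho> ^ n \<le> D / \<beta>" using blk[of s, folded P_def] by (simp add: es mult_ac)
      then have "exp t * P \<le> D / \<beta> / \<rho> ^ n" using \<rho> by (subst pos_le_divide_eq) auto
      then show ?thesis by (simp add: P_def power_divide)
    qed
    ultimately show ?case using Suc by (simp add: distrib_left)
  qed
  have geo: "(\<Sum>k<n. (1 / \<rho>) ^ k) \<le> 1 / (1 - 1 / \<rho>)" for n
    using \<rho> sum_le_suminf[of "\<lambda>k. (1 / \<rho>) ^ k" "{..<n}"] suminf_geometric[of "1 / \<rho>"] summable_geometric[of "1 / \<rho>"] by simp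
  define C where "C = D / \<beta> * (1 / (1 - 1 / \<rho>))"
  have "exp t * \<P>(w in M. V w > exp t) \<le> C" for t
  proof -
    have "(\<lambda>n. prob (S n t)) \<longlonglongrightarrow>
        prob (\<Union>n. S n t)"
    proof (rule finite_Lim_measure_incseq)
      show "incseq (\<lambda>n. S n t)"
      proof (rule incseq_SucI)
        fix n
        have "\<rho> ^ n * exp t \<le> \<rho> ^ Suc n * exp t" using \<rho> by simp
        then show "S n t \<le> S (Suc n) t" unfolding S_def by fastforce
      qed
    qed auto
    then have "(\<lambda>n. exp t * prob (S n t)) \<longlonglongrightarrow>
        exp t * prob (\<Union>n. S n t)"
      by (rule tendsto_mult_left)
    then have "exp t * prob (\<Union>n. S n t) \<le> C"
    proof (rule LIMSEQ_le_const2, intro exI[of _ 0] allI impI)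
      fix n
      have "D / \<beta> * (\<Sum>k<n. (1 / \<rho>) ^ k) \<le> C"
        unfolding C_def using geo D_pos \<beta> by (intro mult_left_mono) auto
      then show "exp t * prob (S n t) \<le> C"
        using step[of t n] by simp
    qed
    moreover have "\<P>(w in M. V w > exp t) \<le> prob (\<Union>n. S n t)"
    proof (rule finite_measure_mono)
      show "{w\<in>space M. V w > exp t} \<subseteq> (\<Union>n. S n t)"
      proof safe
        fix w assume "w \<in> space M" "exp t < V w"
        moreover obtain n where "V w / exp t < \<rho> ^ n" using real_arch_pow[OF \<rho>] by blast
        ultimately show "w \<in> (\<Union>n. S n t)"
          by (auto simp: S_def field_simps intro!: exI[of _ n])
      qed
    qed auto
    ultimately show ?thesis by (meson exp_ge_zero mult_left_mono order_trans)
  qed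
  moreover have "C > 0" unfolding C_def using D_pos \<beta> \<rho> by simp
  ultimately show ?thesis by blast
qed

end

section \<open>Limit points at the limsup spread to all shifts\<close>

lemma tendsto_zero_by_exp:
  fixes x :: "nat \<Rightarrow> real"
  assumes "\<And>\<eta>. \<eta> > 0 \<Longrightarrow> \<forall>\<^sub>F n in sequentially. \<bar>x n\<bar> < C * (exp \<eta> - 1) + \<eta>"
  shows "x \<longlonglongrightarrow> 0"
proof (rule tendstoI)
  fix e :: real assume "e > 0"
  have "((\<lambda>\<eta>. C * (exp \<eta> - 1) + \<eta>) \<longlongrightarrow> C * (exp 0 - 1) + 0) (at_right 0)"
    by (intro tendsto_intros)
  then have "\<forall>\<^sub>F \<eta> in at_right 0. C * (exp \<eta> - 1) + \<eta> < e"
    using \<open>e > 0\<close> by (intro order_tendstoD) auto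
  then obtain b where b: "b > 0" and less: "\<And>\<eta>. 0 < \<eta> \<Longrightarrow> \<eta> < b \<Longrightarrow> C * (exp \<eta> - 1) + \<eta> < e"
    by (auto simp: eventually_at_right_field)
  have "\<forall>\<^sub>F n in sequentially. \<bar>x n\<bar> < C * (exp (b / 2) - 1) + b / 2"
    by (rule assms) (use b in auto)
  then show "\<forall>\<^sub>F n in sequentially. dist (x n) 0 < e"
    by eventually_elim (use less[of "b / 2"] b in auto)
qed

context implicit_renewal
begin

text \<open>A mean that almost attains the upper bound of its terms has almost all terms near that
  bound. By \<open>harm\<close>, \<open>f (s n)\<close> is nearly the \<open>W\<close>-weighted mean
  of \<open>f (s n - ln W)\<close>, whose terms are asymptotically at most \<open>L\<close>. So
  these terms tend to \<open>L\<close> in the weighted mean, and \<open>osc\<close> with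
  \<open>W_supp\<close> passes from the mean to the single shift \<open>u\<close>.\<close>

lemma limit_point_spreads_locally:
  fixes f :: "real \<Rightarrow> real" and s :: "nat \<Rightarrow> real"
  assumes f[measurable]: "f \<in> borel_measurable borel"
    and bd: "\<And>t. \<bar>f t\<bar> \<le> B"
    and osc: "\<And>s t. \<bar>f t - f s\<bar> \<le> C * (exp \<bar>t - s\<bar> - 1)"
    and harm: "((\<lambda>t. f t - expectation (\<lambda>w. W w * f (t - ln (W w)))) \<longlongrightarrow> 0) at_top"
    and upper: "\<And>e. e > 0 \<Longrightarrow> \<forall>\<^sub>F t in at_top. f t < L + e"
    and s: "filterlim s at_top sequentially" and lim: "(\<lambda>n. f (s n)) \<longlonglongrightarrow> L"
    and u: "u > ln w0"
  shows "(\<lambda>n. f (s n - u)) \<longlonglongrightarrow> L"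
proof -
  have B: "B \<ge> 0" using bd[of 0] by linarith
  have L: "\<bar>L\<bar> \<le> B"
    using tendsto_le[OF _ tendsto_const tendsto_rabs[OF lim], of B] bd by auto
  have C: "C \<ge> 0"
  proof -
    have "0 \<le> C * (exp \<bar>1 - 0\<bar> - 1)" using osc[of 1 0] by linarith
    moreover have "(exp 1::real) - 1 > 0" by simp
    ultimately show ?thesis by (simp add: zero_le_mult_iff)
  qed
  have intWf: "integrable M (\<lambda>w. W w * g (f (t - ln (W w))))"
    if g[measurable]: "g \<in> borel_measurable borel" and gb: "\<And>x. \<bar>x\<bar> \<le> B \<Longrightarrow> \<bar>g x\<bar> \<le> B'" for g :: "real \<Rightarrow> real" and t B'
  proof (rule Bochner_Integration.integrable_bound[of _ "\<lambda>w. B' * W w"])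
    show "AE w in M. norm (W w * g (f (t - ln (W w)))) \<le> norm (B' * W w)"
    proof (rule AE_I2)
      fix w
      have "\<bar>g (f (t - ln (W w)))\<bar> \<le> B'" by (rule gb) (rule bd)
      then show "norm (W w * g (f (t - ln (W w)))) \<le> norm (B' * W w)"
        using W_pos[of w] by (simp add: abs_mult)
    qed
  qed (use W_integrable in auto)
  let ?m = "\<lambda>n w. W w * max 0 (f (s n - ln (W w)) - L)"
  define E1 where "E1 n = expectation (\<lambda>w. W w * f (s n - ln (W w)))" for n
  define N where "N n = expectation (?m n)" for n
  define A where "A n = expectation (\<lambda>w. W w * \<bar>L - f (s n - ln (W w))\<bar>)" for n
  have i1: "integrable M (\<lambda>w. W w * f (s n - ln (W w)))" for n
    by (rule intWf[of "\<lambda>x. x" B]) auto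
  have i2: "integrable M (?m n)" for n
    by (rule intWf[of "\<lambda>x. max 0 (x - L)" "2 * B"]) (use L in auto)
  have i3: "integrable M (\<lambda>w. W w * \<bar>L - f (s n - ln (W w))\<bar>)" for n
    by (rule intWf[of "\<lambda>x. \<bar>L - x\<bar>" "2 * B"]) (use L in auto)
  \<comment> \<open>Pointwise, \<open>\<bar>L - x\<bar>\<close> is \<open>L - x\<close> plus twice
    the positive part of \<open>x - L\<close>. Harmonicity controls the first term, the upper bound
    \<open>L\<close> controls the second.\<close>
  have A_eq: "A n = L - E1 n + 2 * N n" for n
  proof -
    have "A n = expectation (\<lambda>w. (L * W w - W w * f (s n - ln (W w))) + 2 * (?m n w))"
      unfolding A_def by (rule Bochner_Integration.integral_cong) (auto simp: max_def abs_if algebra_simps)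
    also have "\<dots> = (L * expectation W - E1 n) + 2 * N n"
      unfolding E1_def N_def using i1 i2 W_integrable by simp
    finally show ?thesis by (simp add: W_mean)
  qed
  have "(\<lambda>n. f (s n) - E1 n) \<longlonglongrightarrow> 0"
    using filterlim_compose[OF harm s] by (simp add: E1_def)
  from tendsto_diff[OF lim this] have E1: "E1 \<longlonglongrightarrow> L" by simp
  have "N \<longlonglongrightarrow> expectation (\<lambda>w. 0)"
    unfolding N_def
  proof (rule integral_dominated_convergence[where w="\<lambda>w. 2 * B * W w"])
    show "AE w in M. (\<lambda>n. ?m n w) \<longlonglongrightarrow> 0"
    proof (rule AE_I2)
      fix w
      have sl: "filterlim (\<lambda>n. s n - ln (W w)) at_top sequentially"
        by (rule filterlim_tendsto_add_at_top[OF tendsto_const[of "- ln (W w)"] s, simplified])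
      have "(\<lambda>n. max 0 (f (s n - ln (W w)) - L)) \<longlonglongrightarrow> 0"
      proof (rule tendstoI)
        fix e :: real assume "e > 0"
        from eventually_compose_filterlim[OF upper[OF this] sl]
        show "\<forall>\<^sub>F n in sequentially. dist (max 0 (f (s n - ln (W w)) - L)) 0 < e"
          by eventually_elim (use \<open>e > 0\<close> in auto)
      qed
      from tendsto_mult_left[OF this, of "W w"]
      show "(\<lambda>n. ?m n w) \<longlonglongrightarrow> 0" by simp
    qed
    show "AE w in M. norm (?m n w) \<le> 2 * B * W w" for n
    proof (rule AE_I2)
      fix w
      have "max 0 (f (s n - ln (W w)) - L) \<le> 2 * B" using bd[of "s n - ln (W w)"] L by auto
      then show "norm (?m n w) \<le> 2 * B * W w"
        using W_pos[of w] by (simp add: abs_mult mult.commute)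
    qed
  qed (use W_integrable in auto)
  then have N: "N \<longlonglongrightarrow> 0" by simp
  have "(\<lambda>n. L - E1 n + 2 * N n) \<longlonglongrightarrow> L - L + 2 * 0"
    by (intro tendsto_intros E1 N)
  then have A: "A \<longlonglongrightarrow> 0" by (simp add: A_eq[symmetric])
  have "(\<lambda>n. L - f (s n - u)) \<longlonglongrightarrow> 0"
  proof (rule tendsto_zero_by_exp[of _ C])
    fix \<eta> :: real assume \<eta>: "\<eta> > 0"
    define y where "y = exp u"
    have y: "y > w0" "y > 0" using exp_less_mono[OF u] w0 by (simp_all add: y_def)
    have "isCont ln y" using y by (intro isCont_ln) auto
    then obtain \<delta>0 where \<delta>0: "\<delta>0 > 0" "\<And>x. dist x y < \<delta>0 \<Longrightarrow> dist (ln x) (ln y) < \<eta>"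
      using \<eta> unfolding continuous_at_eps_delta by metis
    define \<delta> where "\<delta> = min \<delta>0 (y / 2)"
    have \<delta>: "\<delta> > 0" using \<delta>0 y by (simp add: \<delta>_def)
    define p where "p = \<P>(w in M. \<bar>W w - y\<bar> < \<delta>)"
    have p: "p > 0" unfolding p_def by (rule W_supp) (use y \<delta> in auto)
    \<comment> \<open>A Markov-type bound: where \<open>\<bar>W - y\<bar> < \<delta>\<close>, the
      weight is at least \<open>y / 2\<close> and \<open>ln W\<close> is within
      \<open>\<eta>\<close> of \<open>u\<close>, so \<open>osc\<close> compares the two values of
      \<open>f\<close>.\<close>
    have key: "(y / 2) * (\<bar>L - f (s n - u)\<bar> - C * (exp \<eta> - 1)) * p \<le> A n" for n
    proof -
      let ?x = "\<bar>L - f (s n - u)\<bar> - C * (exp \<eta> - 1)"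
      have "(y / 2) * ?x * p = expectation (\<lambda>w. (y / 2) * ?x * indicator {w\<in>space M. \<bar>W w - y\<bar> < \<delta>} w)"
        by (simp add: p_def)
      also have "\<dots> \<le> A n" unfolding A_def
      proof (rule integral_mono[OF _ i3])
        fix w
        show "(y / 2) * ?x * indicator {w\<in>space M. \<bar>W w - y\<bar> < \<delta>} w \<le> W w * \<bar>L - f (s n - ln (W w))\<bar>"
        proof (cases "w \<in> space M \<and> \<bar>W w - y\<bar> < \<delta> \<and> ?x > 0")
          case True
          then have Wb: "W w \<ge> y / 2" "dist (W w) y < \<delta>0"
            using abs_less_iff[of "W w - y" "y / 2"] by (auto simp: \<delta>_def dist_real_def)
          then have "dist (ln (W w)) u < \<eta>" using \<delta>0(2) by (simp add: y_def)
          then have "\<bar>f (s n - ln (W w)) - f (s n - u)\<bar> \<le> C * (exp \<eta> - 1)"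
            using C by (intro order_trans[OF osc] mult_left_mono) (auto simp: dist_real_def)
          then have "?x \<le> \<bar>L - f (s n - ln (W w))\<bar>" by linarith
          then have "(y / 2) * ?x \<le> W w * \<bar>L - f (s n - ln (W w))\<bar>"
            using Wb True y by (intro mult_mono) auto
          then show ?thesis using True by simp
        next
          case False
          have "0 \<le> W w * \<bar>L - f (s n - ln (W w))\<bar>" using W_pos[of w] by simp
          moreover have "(y / 2) * ?x * indicator {w\<in>space M. \<bar>W w - y\<bar> < \<delta>} w \<le> 0"
            using False y by (auto simp: indicator_def mult_le_0_iff not_less)
          ultimately show ?thesis by linarith
        qed
      qed (auto simp: emeasure_eq_measure)
      finally show ?thesis .
    qed
    have "\<forall>\<^sub>F n in sequentially. A n < \<eta> * (y / 2 * p)"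
      using A \<eta> y p by (intro order_tendstoD) auto
    then show "\<forall>\<^sub>F n in sequentially. \<bar>L - f (s n - u)\<bar> < C * (exp \<eta> - 1) + \<eta>"
    proof eventually_elim
      fix n assume "A n < \<eta> * (y / 2 * p)"
      moreover have "(y / 2) * x * p = x * (y / 2 * p)" for x by simp
      ultimately have "(\<bar>L - f (s n - u)\<bar> - C * (exp \<eta> - 1)) * (y / 2 * p) < \<eta> * (y / 2 * p)"
        using key[of n] by (metis order_le_less_trans)
      then show "\<bar>L - f (s n - u)\<bar> < C * (exp \<eta> - 1) + \<eta>"
        using y p by (simp add: mult_less_cancel_right)
    qed
  qed
  from tendsto_diff[OF tendsto_const[of L] this] show ?thesis by simp
qed

text \<open>Since \<open>ln w0 < 0\<close>, a shift of either sign splits into \<open>N\<close>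
  equal steps that all exceed \<open>ln w0\<close>.\<close>

lemma limit_point_spreads:
  fixes f :: "real \<Rightarrow> real" and s :: "nat \<Rightarrow> real"
  assumes f: "f \<in> borel_measurable borel"
    and bd: "\<And>t. \<bar>f t\<bar> \<le> B"
    and osc: "\<And>s t. \<bar>f t - f s\<bar> \<le> C * (exp \<bar>t - s\<bar> - 1)"
    and harm: "((\<lambda>t. f t - expectation (\<lambda>w. W w * f (t - ln (W w)))) \<longlongrightarrow> 0) at_top"
    and upper: "\<And>e. e > 0 \<Longrightarrow> \<forall>\<^sub>F t in at_top. f t < L + e"
    and s: "filterlim s at_top sequentially" and lim: "(\<lambda>n. f (s n)) \<longlonglongrightarrow> L"
  shows "(\<lambda>n. f (s n - u)) \<longlonglongrightarrow> L"
proof -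
  have "ln w0 < 0" using w0 by simp
  obtain N :: nat where N: "of_nat N > \<bar>u\<bar> / (- ln w0)" using reals_Archimedean2 by blast
  moreover have "0 \<le> \<bar>u\<bar> / (- ln w0)" using \<open>ln w0 < 0\<close> by (intro divide_nonneg_pos) auto
  ultimately have N0: "N > 0" by (metis of_nat_0_less_iff order_le_less_trans)
  define v where "v = u / of_nat N"
  have v: "v > ln w0" using N N0 \<open>ln w0 < 0\<close> by (auto simp: v_def field_simps abs_if split: if_splits)
  have "(\<lambda>n. f (s n - of_nat k * v)) \<longlonglongrightarrow> L" for k
  proof (induction k)
    case (Suc k)
    have "filterlim (\<lambda>n. s n - of_nat k * v) at_top sequentially"
      using filterlim_tendsto_add_at_top[OF tendsto_const[of "- (of_nat k * v)"] s] by simp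
    from limit_point_spreads_locally[OF f bd osc harm upper this Suc v]
    show ?case by (simp add: algebra_simps)
  qed (use lim in simp)
  from this[of N] N0 show ?thesis by (simp add: v_def)
qed

end

text \<open>These are the upper and the lower bound that a window of length \<open>h\<close> leaves
  for \<open>exp t * \<P>(w in M. V w > exp t)\<close>. Both denominators are asymptotic to
  \<open>h\<close>, so the bounds close up on \<open>D / m\<close>.\<close>

lemma smoothed_tail_limits:
  fixes m D C :: real
  assumes "m > 0" "D > 0" "C > 0"
  shows "((\<lambda>h. (h * (D + 2 * C * (exp h - 1)) / m + h ^ 2) / (1 - exp (- h))) \<longlongrightarrow> D / m) (at_right 0)"
    and "((\<lambda>h. (h * (D - 2 * C * (exp h - 1)) / m - h ^ 2) / (exp h - 1)) \<longlongrightarrow> D / m) (at_right 0)"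
  using assms by (real_asymp simp: field_simps, real_asymp simp: field_simps)

text \<open>\<open>L\<close> is the infimum of the eventual upper bounds of \<open>f\<close>; as
  \<open>L - 1 / Suc n\<close> is not one of them, points of the sequence can be chosen arbitrarily
  far out.\<close>

lemma bounded_limsup_seq:
  fixes f :: "real \<Rightarrow> real"
  assumes bd: "\<And>t. \<bar>f t\<bar> \<le> B"
  obtains L s where "\<And>e. e > 0 \<Longrightarrow> \<forall>\<^sub>F t in at_top. f t < L + e"
    "filterlim s at_top sequentially" "(\<lambda>n. f (s n)) \<longlonglongrightarrow> L"
proof -
  define S where "S = {x. \<forall>\<^sub>F t in at_top. f t \<le> x}"
  have S_ne: "B \<in> S" unfolding S_def using bd by (auto intro!: always_eventually simp: abs_le_iff)
  have S_bd: "- B \<le> x" if "x \<in> S" for x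
  proof -
    from that obtain t where "f t \<le> x" unfolding S_def by (auto dest!: eventually_happens)
    with bd[of t] show ?thesis by auto
  qed
  have bb: "bdd_below S" using S_bd by (auto simp: bdd_below_def)
  define L where "L = Inf S"
  have upper: "\<forall>\<^sub>F t in at_top. f t < L + e" if "e > 0" for e
  proof -
    have "Inf S < L + e" using that by (simp add: L_def)
    then obtain x where "x \<in> S" "x < L + e" using S_ne cInf_lessD[of S] by auto
    then have "\<forall>\<^sub>F t in at_top. f t \<le> x" by (simp add: S_def)
    then show ?thesis by eventually_elim (use \<open>x < L + e\<close> in auto)
  qed
  have "\<exists>t\<ge>real n. f t > L - 1 / real (Suc n)" for n
  proof (rule ccontr)
    assume "\<not> ?thesis"
    then have "\<forall>\<^sub>F t in at_top. f t \<le> L - 1 / real (Suc n)"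
      by (intro eventually_at_top_linorderI[of "real n"]) (auto simp: not_less)
    then have "L \<le> L - 1 / real (Suc n)" unfolding L_def using bb by (intro cInf_lower) (auto simp: S_def L_def)
    then show False by simp
  qed
  then obtain s where s: "\<And>n. s n \<ge> real n" "\<And>n. f (s n) > L - 1 / real (Suc n)" by metis
  have stop: "filterlim s at_top sequentially"
    by (rule filterlim_at_top_mono[OF filterlim_real_sequentially]) (use s in auto)
  have "(\<lambda>n. f (s n)) \<longlonglongrightarrow> L"
  proof (rule order_tendstoI)
    fix a assume "a < L"
    have "(\<lambda>n. L - 1 / real (Suc n)) \<longlonglongrightarrow> L - 0" by (intro tendsto_intros LIMSEQ_inverse_real_of_nat[unfolded inverse_eq_divide])
    then have "\<forall>\<^sub>F n in sequentially. a < L - 1 / real (Suc n)" using \<open>a < L\<close> by (intro order_tendstoD) auto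
    then show "\<forall>\<^sub>F n in sequentially. a < f (s n)" by eventually_elim (use s(2) in \<open>auto intro: less_trans\<close>)
  next
    fix a assume "a > L"
    then have "\<forall>\<^sub>F t in at_top. f t < L + (a - L)" by (intro upper) auto
    from eventually_compose_filterlim[OF this stop]
    show "\<forall>\<^sub>F n in sequentially. f (s n) < a" by simp
  qed
  with upper stop show ?thesis by (rule that)
qed

section \<open>Identification of the tail constant\<close>

context implicit_renewal
begin

text \<open>Minus the mean step of the walk under the law weighted by \<open>W\<close>. Its
  positivity is derived in \<open>tail_asymptotics\<close>.\<close>

definition m where "m = expectation (\<lambda>w. W w * ln (W w))"

lemma J_increment_bound:
  assumes C: "\<And>t. exp t * \<P>(w in M. V w > exp t) \<le> C" and "d \<ge> 0"
  shows "J (t + d) - J t \<le> C * (exp d - 1)"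
proof -
  have "exp t * (exp d - 1) * \<P>(w in M. V w > exp t) \<le> C * (exp d - 1)"
    using mult_right_mono[OF C[of t], of "exp d - 1"] assms(2) by (simp add: mult_ac)
  with J_increment_le[OF assms(2), of t] show ?thesis by linarith
qed

text \<open>The shift by \<open>ln W\<close> is rounded down to a multiple of \<open>h\<close>, which costs the error term.\<close>

lemma flat_limit_identity:
  fixes s :: "nat \<Rightarrow> real"
  assumes C: "\<And>t. exp t * \<P>(w in M. V w > exp t) \<le> C" and h: "h > 0"
    and s: "filterlim s at_top sequentially"
    and lim: "\<And>u. (\<lambda>n. J (s n - u + h) - J (s n - u)) \<longlonglongrightarrow> L"
  shows "\<bar>D - L * m / h\<bar> \<le> 2 * C * (exp h - 1)"
proof -
  note inc = J_increment_bound[OF C]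
  define E where "E = C * (exp h - 1)"
  have C0: "C \<ge> 0" by (rule order_trans[OF _ C[of 0]]) simp
  have E0: "E \<ge> 0" using C0 h by (simp add: E_def)
  have inc': "\<bar>J t - J r\<bar> \<le> E" if "r \<le> t" "t \<le> r + h" for r t
  proof -
    have "J t - J r \<le> C * (exp (t - r) - 1)" using inc[of "t - r" r] that by simp
    also have "\<dots> \<le> E" unfolding E_def using that C0 by (intro mult_left_mono) auto
    finally show ?thesis using J_mono[OF that(1)] by simp
  qed
  have stepk: "(\<lambda>n. J (s n) - J (s n - of_int k * h)) \<longlonglongrightarrow> of_int k * L" for k
  proof (induction k rule: int_induct[of _ 0])
    case (step1 i)
    from tendsto_add[OF step1(2) lim[of "of_int (i + 1) * h"]]
    show ?case by (simp add: algebra_simps)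
  next
    case (step2 i)
    from tendsto_diff[OF step2(2) lim[of "of_int i * h"]]
    show ?case by (simp add: algebra_simps)
  qed simp
  have bdk: "\<bar>J t - J (t - of_int k * h)\<bar> \<le> \<bar>of_int k\<bar> * E" for t k
  proof (induction k rule: int_induct[of _ 0])
    case (step1 i)
    have "\<bar>J (t - of_int i * h) - J (t - of_int (i + 1) * h)\<bar> \<le> E"
      using h by (intro inc') (auto simp: algebra_simps)
    with step1 show ?case by (simp add: algebra_simps)
  next
    case (step2 i)
    have "\<bar>J (t - of_int (i - 1) * h) - J (t - of_int i * h)\<bar> \<le> E"
      using h by (intro inc') (auto simp: algebra_simps)
    with step2 show ?case by (simp add: algebra_simps)
  qed simp
  define k where "k w = \<lfloor>ln (W w) / h\<rfloor>" for w
  define kr where "kr w = real_of_int (k w)" for w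
  have [measurable]: "kr \<in> borel_measurable M" unfolding kr_def k_def by measurable
  have kr: "kr w * h \<le> ln (W w)" "ln (W w) < kr w * h + h" for w
  proof -
    have "kr w \<le> ln (W w) / h" "ln (W w) / h < kr w + 1" unfolding kr_def k_def by linarith+
    then show "kr w * h \<le> ln (W w)" "ln (W w) < kr w * h + h" using h by (auto simp: field_simps)
  qed
  have kr_le: "\<bar>kr w - ln (W w) / h\<bar> \<le> 1" for w
    using kr[of w] h by (auto simp: field_simps abs_le_iff)
  have int_diff: "integrable M (\<lambda>w. W w * (kr w - ln (W w) / h))"
    by (rule Bochner_Integration.integrable_bound[OF W_integrable])
      (use kr_le W_pos in \<open>auto simp: abs_mult mult_left_le\<close>)
  have int_k: "integrable M (\<lambda>w. W w * kr w)"
  proof -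
    have "integrable M (\<lambda>w. W w * (kr w - ln (W w) / h) + W w * ln (W w) / h)"
      using int_diff WlnW_integrable by simp
    then show ?thesis by (simp add: algebra_simps)
  qed
  define Ek where "Ek = expectation (\<lambda>w. W w * kr w)"
  have Ek: "\<bar>Ek - m / h\<bar> \<le> 1"
  proof -
    have "Ek - m / h = expectation (\<lambda>w. W w * (kr w - ln (W w) / h))"
      unfolding Ek_def m_def using int_k WlnW_integrable by (simp add: right_diff_distrib)
    moreover have "\<bar>\<dots>\<bar> \<le> expectation W"
    proof (rule integral_abs_bound[THEN order_trans], rule integral_mono)
      show "\<bar>W w * (kr w - ln (W w) / h)\<bar> \<le> W w" for w
        using kr_le[of w] W_pos[of w] by (simp add: abs_mult mult_left_le)
    qed (use int_diff W_integrable in auto)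
    ultimately show ?thesis by (simp add: W_mean)
  qed
  let ?g = "\<lambda>n w. W w * (J (s n) - J (s n - kr w * h))"
  define G where "G n = expectation (?g n)" for n
  have WJ: "\<bar>W w * (J t - J (t - kr w * h))\<bar> \<le> E * \<bar>W w * kr w\<bar>" for t w
    using mult_left_mono[OF bdk[of t "k w"], of "\<bar>W w\<bar>"] by (simp add: abs_mult kr_def mult_ac)
  have int_G: "integrable M (?g n)" for n
  proof (rule Bochner_Integration.integrable_bound[of _ "\<lambda>w. E * (W w * kr w)"])
    show "AE w in M. norm (?g n w) \<le> norm (E * (W w * kr w))"
      using WJ by (auto simp: abs_mult E0)
  qed (use int_k in auto)
  have "G \<longlonglongrightarrow> expectation (\<lambda>w. W w * (kr w * L))"
    unfolding G_def
  proof (rule integral_dominated_convergence[where w="\<lambda>w. E * \<bar>W w * kr w\<bar>"])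
    show "AE w in M. (\<lambda>n. ?g n w) \<longlonglongrightarrow> W w * (kr w * L)"
      using stepk by (auto simp: kr_def intro!: AE_I2 tendsto_mult_left)
    show "AE w in M. norm (?g n w) \<le> E * \<bar>W w * kr w\<bar>" for n
      using WJ by (auto simp: abs_mult)
  qed (use int_k in auto)
  moreover have "expectation (\<lambda>w. W w * (kr w * L)) = Ek * L"
    unfolding Ek_def by (simp add: mult.assoc[symmetric])
  ultimately have G: "G \<longlonglongrightarrow> Ek * L" by simp
  have dG: "\<bar>gap (s n) - G n\<bar> \<le> E" for n
  proof -
    have "gap (s n) - G n = expectation (\<lambda>w. (W w * J (s n) - W w * J (s n - ln (W w))) - ?g n w)"
      unfolding gap_def G_def
      using int_G J_shift_integrable W_integrable W_mean by (simp add: Bochner_Integration.integral_diff)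
    also have "\<dots> = expectation (\<lambda>w. W w * (J (s n - kr w * h) - J (s n - ln (W w))))"
      by (simp add: algebra_simps)
    also have "\<bar>\<dots>\<bar> \<le> expectation (\<lambda>w. E * W w)"
    proof (rule integral_abs_bound[THEN order_trans], rule integral_mono)
      have ii: "\<bar>J (s n - kr w * h) - J (s n - ln (W w))\<bar> \<le> E" for w
        using kr[of w] by (intro inc') auto
      then show le: "\<bar>W w * (J (s n - kr w * h) - J (s n - ln (W w)))\<bar> \<le> E * W w" for w
        using W_pos[of w] by (simp add: abs_mult mult.commute)
      show "integrable M (\<lambda>w. \<bar>W w * (J (s n - kr w * h) - J (s n - ln (W w)))\<bar>)"
        by (rule Bochner_Integration.integrable_bound[of _ "\<lambda>w. E * W w"])
          (use W_integrable le in \<open>auto intro!: AE_I2 order_trans[OF le]\<close>)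
    qed (use W_integrable in auto)
    finally show ?thesis by (simp add: W_mean)
  qed
  have "(\<lambda>n. \<bar>gap (s n) - G n\<bar>) \<longlonglongrightarrow> \<bar>D - Ek * L\<bar>"
    by (intro tendsto_intros G filterlim_compose[OF gap_tendsto s])
  then have 1: "\<bar>D - Ek * L\<bar> \<le> E"
    by (rule LIMSEQ_le_const2) (use dG in auto)
  have "(\<lambda>n. \<bar>J (s n - 0 + h) - J (s n - 0)\<bar>) \<longlonglongrightarrow> \<bar>L\<bar>"
    by (intro tendsto_rabs lim)
  then have L: "\<bar>L\<bar> \<le> E"
    by (rule LIMSEQ_le_const2) (use h in \<open>auto intro!: inc'\<close>)
  \<comment> \<open>The second error: \<open>Ek\<close> misses \<open>m / h\<close> by at most 1,
    and \<open>L\<close> is at most \<open>E\<close>. With the rounding error \<open>E\<close> of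
    \<open>dG\<close> this accounts for the factor 2.\<close>
  have "\<bar>Ek * L - m / h * L\<bar> \<le> E"
    using mult_mono[OF Ek L] by (simp add: abs_mult[symmetric] left_diff_distrib)
  then have "\<bar>D - m / h * L\<bar> \<le> 2 * E"
    using 1 abs_triangle_ineq[of "D - Ek * L" "Ek * L - m / h * L"] by simp
  then show ?thesis by (simp add: E_def mult_ac)
qed

text \<open>The sign \<open>\<sigma>\<close> handles both ends at once: negated increments are
  asymptotically harmonic as well, and for \<open>\<sigma> = - 1\<close> the number \<open>L\<close>
  is the lower limit of the increments.\<close>

lemma limsup_bound:
  assumes C: "\<And>t. exp t * \<P>(w in M. V w > exp t) \<le> C" and h: "h > 0"
    and \<sigma>: "\<sigma> = 1 \<or> \<sigma> = (- 1 :: real)"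
  obtains L where "\<bar>D - L * m / h\<bar> \<le> 2 * C * (exp h - 1)" "L \<ge> 0"
    "\<And>e. e > 0 \<Longrightarrow> \<forall>\<^sub>F t in at_top. \<sigma> * (J (t + h) - J t) < \<sigma> * L + e"
proof -
  define f where "f t = \<sigma> * (J (t + h) - J t)" for t
  have \<sigma>1: "\<bar>\<sigma>\<bar> = 1" "\<sigma> * \<sigma> = 1" using \<sigma> by auto
  have [measurable]: "f \<in> borel_measurable borel" unfolding f_def by measurable
  have bd: "\<bar>f t\<bar> \<le> C * (exp h - 1)" for t
    using J_increment_bound[OF C, of h t] J_mono[of t "t + h"] h \<sigma>1 by (simp add: f_def abs_mult)
  have J_osc: "\<bar>J t - J s\<bar> \<le> C * (exp \<bar>t - s\<bar> - 1)" for s t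
  proof (cases "s \<le> t")
    case True
    with J_increment_bound[OF C, of "t - s" s] J_mono[of s t] show ?thesis by simp
  next
    case False
    with J_increment_bound[OF C, of "s - t" t] J_mono[of t s] show ?thesis by simp
  qed
  have osc: "\<bar>f t - f s\<bar> \<le> (2 * C) * (exp \<bar>t - s\<bar> - 1)" for s t
  proof -
    have "f t - f s = \<sigma> * ((J (t + h) - J (s + h)) - (J t - J s))" by (simp add: f_def algebra_simps)
    then have "\<bar>f t - f s\<bar> \<le> \<bar>J (t + h) - J (s + h)\<bar> + \<bar>J t - J s\<bar>"
      using \<sigma>1 by (simp add: abs_mult)
    also have "\<dots> \<le> C * (exp \<bar>t - s\<bar> - 1) + C * (exp \<bar>t - s\<bar> - 1)"
      using J_osc[of "t + h" "s + h"] J_osc[of t s] by simp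
    finally show ?thesis by (simp add: algebra_simps)
  qed
  \<comment> \<open>The failure of \<open>f\<close> to be harmonic is a difference of two values of
    \<open>gap\<close>, which has a finite limit.\<close>
  have harm_eq: "f t - expectation (\<lambda>w. W w * f (t - ln (W w))) = \<sigma> * (gap (t + h) - gap t)" for t
  proof -
    have "expectation (\<lambda>w. W w * f (t - ln (W w))) = expectation (\<lambda>w. \<sigma> * (W w * J ((t + h) - ln (W w)) - W w * J (t - ln (W w))))"
      by (rule Bochner_Integration.integral_cong) (simp_all add: f_def algebra_simps)
    also have "\<dots> = \<sigma> * (expectation (\<lambda>w. W w * J ((t + h) - ln (W w))) - expectation (\<lambda>w. W w * J (t - ln (W w))))"
      using J_shift_integrable by simp
    finally show ?thesis by (simp add: f_def gap_def algebra_simps)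
  qed
  have "((\<lambda>t. \<sigma> * (gap (t + h) - gap t)) \<longlongrightarrow> \<sigma> * (D - D)) at_top"
    by (intro tendsto_intros gap_tendsto filterlim_compose[OF gap_tendsto, of "\<lambda>t. t + h"]) real_asymp
  then have harm: "((\<lambda>t. f t - expectation (\<lambda>w. W w * f (t - ln (W w)))) \<longlongrightarrow> 0) at_top"
    by (simp add: harm_eq)
  obtain L s where upper: "\<And>e. e > 0 \<Longrightarrow> \<forall>\<^sub>F t in at_top. f t < L + e"
    and s: "filterlim s at_top sequentially" and lim: "(\<lambda>n. f (s n)) \<longlonglongrightarrow> L"
    using bounded_limsup_seq[of f, OF bd] by blast
  have "(\<lambda>n. f (s n - u)) \<longlonglongrightarrow> L" for u
    by (rule limit_point_spreads[OF _ bd osc harm upper s lim]) simp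
  from tendsto_mult_left[OF this, of \<sigma>]
  have lim': "(\<lambda>n. J (s n - u + h) - J (s n - u)) \<longlonglongrightarrow> \<sigma> * L" for u
    by (simp add: f_def mult.assoc[symmetric] \<sigma>1)
  show ?thesis
  proof (rule that[of "\<sigma> * L"])
    show "\<bar>D - \<sigma> * L * m / h\<bar> \<le> 2 * C * (exp h - 1)"
      by (rule flat_limit_identity[OF C h s lim'])
    show "\<sigma> * L \<ge> 0"
      by (rule LIMSEQ_le_const[OF lim'[of 0]]) (use h in \<open>auto intro!: J_mono\<close>)
    show "\<forall>\<^sub>F t in at_top. \<sigma> * (J (t + h) - J t) < \<sigma> * (\<sigma> * L) + e" if "e > 0" for e
      using upper[OF that] by (simp add: f_def mult.assoc[symmetric] \<sigma>1)
  qed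
qed

theorem tail_asymptotics:
  "\<exists>\<kappa>>0. ((\<lambda>x. x * \<P>(w in M. V w > x)) \<longlongrightarrow> \<kappa>) at_top"
proof -
  obtain C where C0: "C > 0" and C: "\<And>t. exp t * \<P>(w in M. V w > exp t) \<le> C"
    using tail_bound by blast
  \<comment> \<open>Otherwise \<open>L * m / h \<le> 0\<close>, and the identity for flat windows
    gives \<open>D \<le> 2 * C * (exp h - 1)\<close> for all small \<open>h\<close>, against
    \<open>D > 0\<close>.\<close>
  have m: "m > 0"
  proof (rule ccontr)
    assume "\<not> m > 0"
    have "((\<lambda>h. 2 * C * (exp h - 1)) \<longlongrightarrow> 2 * C * (exp 0 - 1)) (at_right 0)"
      by (intro tendsto_intros)
    moreover have "\<forall>\<^sub>F h in at_right 0. D \<le> 2 * C * (exp h - 1)"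
      unfolding eventually_at_right_field
    proof (intro exI[of _ 1] conjI allI impI)
      fix h :: real assume "0 < h" "h < 1"
      obtain L where "\<bar>D - L * m / h\<bar> \<le> 2 * C * (exp h - 1)" "L \<ge> 0"
        using limsup_bound[OF C \<open>0 < h\<close>, of 1] by blast
      moreover have "L * m / h \<le> 0" using \<open>L \<ge> 0\<close> \<open>\<not> m > 0\<close> \<open>0 < h\<close> by (auto simp: divide_le_0_iff mult_le_0_iff)
      ultimately show "D \<le> 2 * C * (exp h - 1)" by linarith
    qed simp
    ultimately have "D \<le> 2 * C * (exp 0 - 1)" by (intro tendsto_lowerbound) auto
    then show False using D_pos by simp
  qed
  define T where "T t = exp t * \<P>(w in M. V w > exp t)" for t
  define U where "U h = (h * (D + 2 * C * (exp h - 1)) / m + h ^ 2) / (1 - exp (- h))" for h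
  define U' where "U' h = (h * (D - 2 * C * (exp h - 1)) / m - h ^ 2) / (exp h - 1)" for h
  have U: "(U \<longlongrightarrow> D / m) (at_right 0)"
    unfolding U_def by (rule smoothed_tail_limits[OF m D_pos C0])
  have U': "(U' \<longlongrightarrow> D / m) (at_right 0)"
    unfolding U'_def by (rule smoothed_tail_limits[OF m D_pos C0])
  have upper: "\<forall>\<^sub>F t in at_top. T t < U h" if h: "h > 0" for h
  proof -
    obtain L where L: "\<bar>D - L * m / h\<bar> \<le> 2 * C * (exp h - 1)"
      and ev: "\<And>e. e > 0 \<Longrightarrow> \<forall>\<^sub>F t in at_top. (J (t + h) - J t) < L + e"
      using limsup_bound[OF C h, of 1] by auto
    have "L * m / h \<le> D + 2 * C * (exp h - 1)" using L by linarith
    then have LU: "L \<le> h * (D + 2 * C * (exp h - 1)) / m"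
      using m h by (simp add: field_simps)
    \<comment> \<open>The slack \<open>h ^ 2\<close> is of smaller order than \<open>h\<close> and
      disappears in the limit of \<open>U\<close>. The window is then moved back so that it ends at
      \<open>t\<close>, because \<open>J_increment_ge\<close> sees the tail at the right
      end.\<close>
    have "\<forall>\<^sub>F t in at_top. (J (t + h) - J t) < L + h ^ 2" by (rule ev) (use h in simp)
    moreover have "filterlim (\<lambda>t. t - h) at_top at_top" by real_asymp
    ultimately have "\<forall>\<^sub>F t in at_top. (J ((t - h) + h) - J (t - h)) < L + h ^ 2"
      by (rule eventually_compose_filterlim)
    then show ?thesis
    proof eventually_elim
      fix t assume *: "(J ((t - h) + h) - J (t - h)) < L + h ^ 2"
      have "exp (t - h) * (exp h - 1) * \<P>(w in M. V w > exp ((t - h) + h)) \<le> J ((t - h) + h) - J (t - h)"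
        by (rule J_increment_ge) (use h in simp)
      moreover have "exp (t - h) * (exp h - 1) = exp t * (1 - exp (- h))"
        by (simp add: exp_diff exp_minus field_simps)
      ultimately have "T t * (1 - exp (- h)) \<le> J ((t - h) + h) - J (t - h)"
        unfolding T_def by (simp add: mult.commute mult.left_commute)
      then have "T t * (1 - exp (- h)) < h * (D + 2 * C * (exp h - 1)) / m + h ^ 2"
        using * LU by linarith
      then show "T t < U h" using h by (simp add: U_def pos_less_divide_eq)
    qed
  qed
  have lower: "\<forall>\<^sub>F t in at_top. U' h < T t" if h: "h > 0" for h
  proof -
    obtain L where L: "\<bar>D - L * m / h\<bar> \<le> 2 * C * (exp h - 1)"
      and ev: "\<And>e. e > 0 \<Longrightarrow> \<forall>\<^sub>F t in at_top. (-1) * (J (t + h) - J t) < (-1) * L + e"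
      using limsup_bound[OF C h, of "-1"] by blast
    have "L * m / h \<ge> D - 2 * C * (exp h - 1)" using L by linarith
    then have LU: "L \<ge> h * (D - 2 * C * (exp h - 1)) / m"
      using m h by (simp add: field_simps)
    have "\<forall>\<^sub>F t in at_top. (-1) * (J (t + h) - J t) < (-1) * L + h ^ 2" by (rule ev) (use h in simp)
    then show ?thesis
    proof eventually_elim
      fix t assume *: "(-1) * (J (t + h) - J t) < (-1) * L + h ^ 2"
      have "J (t + h) - J t \<le> exp t * (exp h - 1) * \<P>(w in M. V w > exp t)"
        by (rule J_increment_le) (use h in simp)
      then have "J (t + h) - J t \<le> T t * (exp h - 1)"
        unfolding T_def by (simp add: mult.commute mult.left_commute)
      moreover have "x - q < y" if "j \<le> y" "-1 * j < -1 * L + q" "x \<le> L" for x y q j :: real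
        using that by linarith
      ultimately have "h * (D - 2 * C * (exp h - 1)) / m - h ^ 2 < T t * (exp h - 1)"
        using * LU by blast
      then show "U' h < T t" using h by (simp add: U'_def pos_divide_less_eq)
    qed
  qed
  have "(T \<longlongrightarrow> D / m) at_top"
  proof (rule order_tendstoI)
    fix x assume "x < D / m"
    then have "\<forall>\<^sub>F h in at_right 0. x < U' h \<and> 0 < h"
      using order_tendstoD(1)[OF U'] by (auto simp: eventually_at_right_less intro: eventually_conj)
    then obtain h where "x < U' h" "0 < h" by (auto dest!: eventually_happens)
    then show "\<forall>\<^sub>F t in at_top. x < T t" using lower[of h] by (auto elim!: eventually_mono)
  next
    fix x assume "D / m < x"
    then have "\<forall>\<^sub>F h in at_right 0. U h < x \<and> 0 < h"
      using order_tendstoD(2)[OF U] by (auto simp: eventually_at_right_less intro: eventually_conj)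
    then obtain h where "U h < x" "0 < h" by (auto dest!: eventually_happens)
    then show "\<forall>\<^sub>F t in at_top. T t < x" using upper[of h] by (auto elim!: eventually_mono)
  qed
  from filterlim_compose[OF this ln_at_top]
  have "((\<lambda>x. T (ln x)) \<longlongrightarrow> D / m) at_top" .
  moreover have "\<forall>\<^sub>F x in at_top. T (ln x) = x * \<P>(w in M. V w > x)"
    using eventually_gt_at_top[of 0] by eventually_elim (simp add: T_def)
  ultimately have "((\<lambda>x. x * \<P>(w in M. V w > x)) \<longlongrightarrow> D / m) at_top"
    by (rule Lim_transform_eventually)
  then show ?thesis using D_pos m by (intro exI[of _ "D / m"]) simp
qed

end

section \<open>Moments\<close>

text \<open>Truncate \<open>V\<close> and \<open>V'\<close> at the same level \<open>n\<close>: as their laws agree, the contributions of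
  \<open>V \<ge> n\<close> cancel.\<close>

lemma (in prob_space) integrable_of_contraction:
  fixes W V V' N :: "'a \<Rightarrow> real"
  assumes ind: "indep_var borel W borel V"
    and V'[measurable]: "V' \<in> borel_measurable M"
    and law: "distr M borel V' = distr M borel V"
    and W0: "\<And>w. W w \<ge> 0" and V0: "\<And>w. V w \<ge> 0" and V'0: "\<And>w. V' w \<ge> 0"
    and le: "\<And>w. V' w \<le> W w * V w + N w"
    and N0: "\<And>w. N w \<ge> 0" and N: "integrable M N"
    and W: "integrable M W" and lt: "expectation W < 1"
  shows "integrable M V"
proof -
  note [measurable] = indep_var_rv1[OF ind] indep_var_rv2[OF ind]
  define B where "B n w = V w * indicator {v. v < real n} (V w)" for n w
  have B[measurable]: "B n \<in> borel_measurable M" for n unfolding B_def by measurable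
  have intB: "integrable M (B n)" for n
    by (rule integrable_bounded[of _ "real n"]) (use V0 in \<open>auto simp: B_def indicator_def\<close>)
  have indB: "indep_var borel W borel (B n)" for n
    using indep_var_compose[OF ind, of "\<lambda>y. y" borel "\<lambda>v. v * indicator {v. v < real n} v" borel]
    by (simp add: comp_def B_def[abs_def])
  have EWB: "integrable M (\<lambda>w. W w * B n w)" "expectation (\<lambda>w. W w * B n w) = expectation W * expectation (B n)" for n
    using indep_var_integrable[OF indB W intB] indep_var_lebesgue_integral[OF indB W intB] by simp_all
  have bound: "expectation (B n) \<le> expectation N / (1 - expectation W)" for n
  proof -
    define I where "I w = real n * indicator {v. v \<ge> real n} (V w)" for w
    have [measurable]: "I \<in> borel_measurable M" unfolding I_def by measurable
    have intI: "integrable M I"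
      by (rule integrable_bounded[of _ "real n"]) (auto simp: I_def indicator_def)
    have "expectation (B n) + expectation I = expectation (\<lambda>w. B n w + I w)"
      using intB intI by simp
    also have "\<dots> = expectation (\<lambda>w. min (V w) (real n))"
      by (rule Bochner_Integration.integral_cong) (auto simp: B_def I_def indicator_def)
    also have "\<dots> = expectation (\<lambda>w. min (V' w) (real n))"
      by (rule expectation_cong_distr[OF law[symmetric], of "\<lambda>v. min v (real n)"]) auto
    also have "\<dots> \<le> expectation (\<lambda>w. (W w * B n w + N w) + I w)"
    proof (rule integral_mono)
      show "integrable M (\<lambda>w. min (V' w) (real n))"
        by (rule integrable_bounded[of _ "real n"]) (use V'0 in auto)
      show "min (V' w) (real n) \<le> W w * B n w + N w + I w" for w
        using le[of w] N0[of w] by (auto simp: B_def I_def indicator_def min_le_iff_disj)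
    qed (use EWB N intI in auto)
    also have "\<dots> = expectation W * expectation (B n) + expectation N + expectation I"
      using EWB N intI by simp
    finally have "expectation (B n) * (1 - expectation W) \<le> expectation N" by (simp add: algebra_simps)
    then show ?thesis using lt by (simp add: pos_le_divide_eq)
  qed
  have "incseq (\<lambda>n. expectation (B n))"
    by (rule incseq_SucI, rule integral_mono[OF intB intB]) (auto simp: B_def indicator_def V0)
  then obtain x where x: "(\<lambda>n. expectation (B n)) \<longlonglongrightarrow> x"
    using incseq_convergent[of "\<lambda>n. expectation (B n)"] bound by blast
  show ?thesis
  proof (rule integrable_monotone_convergence[OF intB _ _ x])
    show "AE w in M. mono (\<lambda>n. B n w)"
      by (intro AE_I2) (auto simp: mono_def B_def indicator_def V0)
    show "AE w in M. (\<lambda>n. B n w) \<longlonglongrightarrow> V w"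
    proof (rule AE_I2)
      fix w
      have "\<forall>\<^sub>F n in sequentially. V w < real n"
        using filterlim_real_sequentially by (auto simp: filterlim_at_top_dense)
      then show "(\<lambda>n. B n w) \<longlonglongrightarrow> V w"
        by (intro tendsto_eventually, eventually_elim) (simp add: B_def)
    qed
  qed measurable
qed

text \<open>After division by the geometric mean \<open>g\<close> the weighted logarithms sum to 0.
  Then \<open>ln x \<le> x - 1\<close> gives the inequality, and its equality case
  \<open>x = 1\<close> gives the second claim.\<close>

lemma weighted_geom_mean:
  fixes u v \<theta> :: real
  assumes u: "u > 0" and v: "v > 0" and \<theta>: "0 < \<theta>" "\<theta> < 1"
  shows weighted_geom_mean_le: "u powr \<theta> * v powr (1 - \<theta>) \<le> \<theta> * u + (1 - \<theta>) * v"
    and weighted_geom_mean_eq: "u powr \<theta> * v powr (1 - \<theta>) = \<theta> * u + (1 - \<theta>) * v \<Longrightarrow> u = v"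
proof -
  define g where "g = u powr \<theta> * v powr (1 - \<theta>)"
  have g: "g > 0" using u v by (simp add: g_def)
  have lg: "ln g = \<theta> * ln u + (1 - \<theta>) * ln v" using u v by (simp add: g_def ln_mult ln_powr)
  have 0: "\<theta> * ln (u / g) + (1 - \<theta>) * ln (v / g) = 0"
    using u v g by (simp add: ln_div lg algebra_simps)
  have 1: "\<theta> * ln (u / g) \<le> \<theta> * (u / g - 1)" "(1 - \<theta>) * ln (v / g) \<le> (1 - \<theta>) * (v / g - 1)"
    using u v g \<theta> by (intro mult_left_mono ln_le_minus_one; simp)+
  have 2: "\<theta> * (u / g - 1) + (1 - \<theta>) * (v / g - 1) = (\<theta> * u + (1 - \<theta>) * v) / g - 1"
    using g by (simp add: field_simps)
  have "1 \<le> (\<theta> * u + (1 - \<theta>) * v) / g" using 0 1 2 by linarith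
  then show "u powr \<theta> * v powr (1 - \<theta>) \<le> \<theta> * u + (1 - \<theta>) * v"
    using g by (simp add: g_def pos_le_divide_eq)
  assume "u powr \<theta> * v powr (1 - \<theta>) = \<theta> * u + (1 - \<theta>) * v"
  then have "\<theta> * (u / g - 1) + (1 - \<theta>) * (v / g - 1) = 0" using 2 g by (simp add: g_def)
  then have "\<theta> * ln (u / g) = \<theta> * (u / g - 1)" "(1 - \<theta>) * ln (v / g) = (1 - \<theta>) * (v / g - 1)"
    using 0 1 by linarith+
  then have "ln (u / g) = u / g - 1" "ln (v / g) = v / g - 1" using \<theta> by auto
  then have "u / g = 1" "v / g = 1"
    using u v g by (simp_all only: ln_eq_minus_one divide_pos_pos)
  then show "u = v" using g by simp
qed

text \<open>The pointwise defect is nonnegative. If its expectation were 0, it would vanish almost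
  everywhere, and the equality case would force \<open>U = V\<close> almost everywhere.\<close>

lemma (in prob_space) expectation_geom_mean_less_1:
  fixes U V :: "'a \<Rightarrow> real"
  assumes U: "\<And>w. U w > 0" "integrable M U" "expectation U = 1"
    and V: "\<And>w. V w > 0" "integrable M V" "expectation V = 1"
    and \<theta>: "0 < \<theta>" "\<theta> < 1" and ne: "\<not> (AE w in M. U w = V w)"
  shows "integrable M (\<lambda>w. U w powr \<theta> * V w powr (1 - \<theta>))"
    and "expectation (\<lambda>w. U w powr \<theta> * V w powr (1 - \<theta>)) < 1"
proof -
  let ?g = "\<lambda>w. U w powr \<theta> * V w powr (1 - \<theta>)"
  have [measurable]: "U \<in> borel_measurable M" "V \<in> borel_measurable M" using U V by auto
  note le = weighted_geom_mean_le[OF U(1) V(1) \<theta>]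
  have intl: "integrable M (\<lambda>w. \<theta> * U w + (1 - \<theta>) * V w)" using U V by simp
  show i: "integrable M ?g"
    by (rule Bochner_Integration.integrable_bound[OF intl])
       (use le U V \<theta> in \<open>auto intro!: AE_I2 simp: abs_of_pos add_pos_pos abs_mult\<close>)
  have "expectation ?g \<le> 1"
    using integral_mono[OF i intl le] U V by simp
  moreover have "expectation ?g \<noteq> 1"
  proof
    assume "expectation ?g = 1"
    then have "expectation (\<lambda>w. (\<theta> * U w + (1 - \<theta>) * V w) - ?g w) = 0"
      using i intl U V by simp
    then have "AE w in M. (\<theta> * U w + (1 - \<theta>) * V w) - ?g w = 0"
      using le i intl by (subst (asm) integral_nonneg_eq_0_iff_AE) auto
    then have "AE w in M. U w = V w"
      by (rule AE_mp) (auto intro!: AE_I2 weighted_geom_mean_eq[OF U(1) V(1) \<theta>])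
    with ne show False by simp
  qed
  ultimately show "expectation ?g < 1" by simp
qed

text \<open>Once \<open>x\<close> is large compared with \<open>a\<close>, adding \<open>a\<close>
  costs only a factor close to 1, and bounded \<open>x\<close> go into \<open>C\<close>. Thus a
  multiplier with mean below 1 stays contracting in the presence of the additive term.\<close>

lemma powr_add_le_eps:
  fixes a p \<epsilon> :: real
  assumes a: "a > 0" and p: "p > 0" and e: "\<epsilon> > 0"
  shows "\<exists>C\<ge>0. \<forall>x\<ge>0. (a + x) powr p \<le> (1 + \<epsilon>) * x powr p + C"
proof -
  define \<delta> where "\<delta> = (1 + \<epsilon>) powr (1 / p) - 1"
  have "(1 + \<epsilon>) powr (1 / p) > 1" using p e by simp
  then have \<delta>: "\<delta> > 0" by (simp add: \<delta>_def)
  have \<delta>p: "(1 + \<delta>) powr p = 1 + \<epsilon>" using p e by (simp add: \<delta>_def powr_powr)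
  show ?thesis
  proof (intro exI[of _ "(a + a / \<delta>) powr p"] conjI allI impI)
    fix x :: real assume x: "x \<ge> 0"
    show "(a + x) powr p \<le> (1 + \<epsilon>) * x powr p + (a + a / \<delta>) powr p"
    proof (cases "x \<ge> a / \<delta>")
      case True
      then have "a + x \<le> (1 + \<delta>) * x" using \<delta> by (simp add: field_simps)
      then have "(a + x) powr p \<le> ((1 + \<delta>) * x) powr p" using a x p by (intro powr_mono2) auto
      also have "\<dots> = (1 + \<epsilon>) * x powr p" using \<delta> x by (simp add: powr_mult \<delta>p)
      finally show ?thesis by (simp add: add_increasing2)
    next
      case False
      then have "(a + x) powr p \<le> (a + a / \<delta>) powr p" using a x p by (intro powr_mono2) auto
      moreover have "0 \<le> (1 + \<epsilon>) * x powr p" using e by simp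
      ultimately show ?thesis by linarith
    qed
  qed simp
qed

text \<open>By the mean value theorem, adding \<open>a\<close> changes the power \<open>p\<close>
  only by the order of \<open>x powr (p - 1)\<close>. The increment is therefore integrable under a
  moment of order \<open>s < p\<close>, even where the moment of order \<open>p\<close> is
  infinite.\<close>

lemma powr_increment_le:
  fixes a p s :: real
  assumes a: "a > 0" and p: "p > 0" and s: "s > 0" "s > p - 1"
  shows "\<exists>C\<ge>0. \<forall>x\<ge>0. (a + x) powr p - x powr p \<le> C * (1 + x powr s)"
proof -
  define x0 where "x0 = max 1 a"
  define C where "C = max ((a + x0) powr p) (a * p * 2 powr s)"
  have C0: "C \<ge> 0" by (simp add: C_def le_max_iff_disj)
  have "(a + x) powr p - x powr p \<le> C * (1 + x powr s)" if x: "x \<ge> 0" for x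
  proof (cases "x \<ge> x0")
    case False
    then have "(a + x) powr p \<le> (a + x0) powr p" using a x p by (intro powr_mono2) auto
    also have "\<dots> \<le> C * 1" by (simp add: C_def)
    also have "\<dots> \<le> C * (1 + x powr s)" using C0 by (intro mult_left_mono) auto
    finally show ?thesis using powr_ge_zero[of x p] by linarith
  next
    case True
    then have x1: "x \<ge> 1" "x \<ge> a" by (auto simp: x0_def)
    have "\<exists>z. x < z \<and> z < a + x \<and> (a + x) powr p - x powr p = (a + x - x) * (p * z powr (p - 1))"
      using a x1 by (intro MVT2) (auto intro!: derivative_eq_intros)
    then obtain z where z: "x < z" "z < a + x" and eq: "(a + x) powr p - x powr p = a * (p * z powr (p - 1))"
      by auto
    have "z powr (p - 1) \<le> z powr s" using z x1 s by (intro powr_mono) auto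
    also have "\<dots> \<le> (2 * x) powr s" using z x1 s by (intro powr_mono2) auto
    also have "\<dots> = 2 powr s * x powr s" using x by (simp add: powr_mult)
    finally have "(a + x) powr p - x powr p \<le> a * (p * (2 powr s * x powr s))"
      unfolding eq using a p by (intro mult_left_mono) auto
    also have "\<dots> = (a * p * 2 powr s) * x powr s" by simp
    also have "\<dots> \<le> C * (1 + x powr s)"
      using C0 by (intro mult_mono) (simp_all, simp add: C_def)
    finally show ?thesis .
  qed
  with C0 show ?thesis by blast
qed

text \<open>Different exponents show up as different growth in \<open>z\<close>. This prevents the
  weights of two blocks from agreeing almost everywhere.\<close>

lemma quadratic_powr_dominates:
  fixes b c b' c' p q :: real
  assumes "b > 0" "c > 0" "b' > 0" "c' > 0" "q > 0" "p > q"
  shows "\<forall>\<^sub>F z in at_top. (b + c * z\<^sup>2) powr p > (b' + c' * z\<^sup>2) powr q"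
proof -
  have "((\<lambda>z. (b' + c' * z\<^sup>2) / (b + c * z\<^sup>2)) \<longlongrightarrow> c' / c) at_top"
    using assms by (real_asymp simp: field_simps)
  from tendsto_powr[OF this tendsto_const[of q]]
  have 1: "((\<lambda>z. ((b' + c' * z\<^sup>2) / (b + c * z\<^sup>2)) powr q) \<longlongrightarrow> (c' / c) powr q) at_top"
    using assms by simp
  have 2: "filterlim (\<lambda>z. (b + c * z\<^sup>2) powr (p - q)) at_top at_top"
  proof (rule filterlim_compose[of "\<lambda>y. y powr (p - q)"])
    show "filterlim (\<lambda>y. y powr (p - q)) at_top at_top" using assms by real_asymp
    show "filterlim (\<lambda>z. b + c * z\<^sup>2) at_top at_top" using assms by real_asymp
  qed
  have "\<forall>\<^sub>F z in at_top. ((b' + c' * z\<^sup>2) / (b + c * z\<^sup>2)) powr q < (c' / c) powr q + 1"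
    using 1 by (rule order_tendstoD) simp
  moreover have "\<forall>\<^sub>F z in at_top. (b + c * z\<^sup>2) powr (p - q) > (c' / c) powr q + 1"
    using 2 by (auto simp: filterlim_at_top_dense)
  ultimately show ?thesis
  proof eventually_elim
    fix z assume "((b' + c' * z\<^sup>2) / (b + c * z\<^sup>2)) powr q < (c' / c) powr q + 1"
      "(b + c * z\<^sup>2) powr (p - q) > (c' / c) powr q + 1"
    then have "((b' + c' * z\<^sup>2) / (b + c * z\<^sup>2)) powr q < (b + c * z\<^sup>2) powr (p - q)" by linarith
    moreover have "b + c * z\<^sup>2 > 0" "b' + c' * z\<^sup>2 > 0" using assms by (auto intro: add_pos_nonneg)
    ultimately show "(b + c * z\<^sup>2) powr p > (b' + c' * z\<^sup>2) powr q"
      by (simp add: powr_divide powr_diff divide_less_cancel)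
  qed
qed

text \<open>\<open>x\<close> times the indicator of \<open>f > x\<close> is dominated by
  \<open>f\<close> and is 0 as soon as \<open>x \<ge> f w\<close>.\<close>

lemma (in prob_space) integrable_imp_tail_small:
  fixes f :: "'a \<Rightarrow> real"
  assumes f: "integrable M f" and f0: "\<And>w. f w \<ge> 0"
  shows "((\<lambda>x. x * \<P>(w in M. f w > x)) \<longlongrightarrow> 0) at_top"
proof -
  have [measurable]: "f \<in> borel_measurable M" using f by simp
  have "((\<lambda>x. expectation (\<lambda>w. x * indicator {w\<in>space M. f w > x} w)) \<longlongrightarrow> expectation (\<lambda>w. 0)) at_top"
  proof (rule integral_dominated_convergence_at_top[where w=f])
    show "\<forall>\<^sub>F x in at_top. AE w in M. norm (x * indicator {w\<in>space M. f w > x} w) \<le> f w"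
      using eventually_gt_at_top[of 0] by eventually_elim (auto intro!: AE_I2 simp: indicator_def f0)
    show "AE w in M. ((\<lambda>x. x * indicator {w\<in>space M. f w > x} w) \<longlongrightarrow> 0) at_top"
    proof (rule AE_I2)
      fix w
      have "\<forall>\<^sub>F x in at_top. x * indicator {w\<in>space M. f w > x} w = 0"
        using eventually_ge_at_top[of "f w"] by eventually_elim auto
      then show "((\<lambda>x. x * indicator {w\<in>space M. f w > x} w) \<longlongrightarrow> 0) at_top"
        by (rule tendsto_eventually)
    qed
  qed (use f in auto)
  then show ?thesis by simp
qed

section \<open>Standard normal noise\<close>

lemma measure_distributed_std_normal_interval:
  assumes "distributed M lborel Z (\<lambda>x. ennreal (std_normal_density x))" and "prob_space M" and "\<delta> > 0"
  shows "measure M {w\<in>space M. \<bar>Z w - z\<bar> < \<delta>} > 0"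
proof -
  interpret prob_space M by fact
  have [measurable]: "Z \<in> borel_measurable M" using distributed_measurable[OF assms(1)] by simp
  let ?I = "{z - \<delta> <..< z + \<delta>}"
  have "emeasure M {w\<in>space M. \<bar>Z w - z\<bar> < \<delta>} = emeasure M (Z -` ?I \<inter> space M)"
    by (rule arg_cong[of _ _ "emeasure M"]) (auto simp: abs_less_iff)
  also have "\<dots> = (\<integral>\<^sup>+x. ennreal (std_normal_density x) * indicator ?I x \<partial>lborel)"
    by (rule distributed_emeasure[OF assms(1)]) simp
  finally have eq: "emeasure M {w\<in>space M. \<bar>Z w - z\<bar> < \<delta>} = (\<integral>\<^sup>+x. ennreal (std_normal_density x) * indicator ?I x \<partial>lborel)" .
  have "emeasure M {w\<in>space M. \<bar>Z w - z\<bar> < \<delta>} \<noteq> 0"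
  proof
    assume "emeasure M {w\<in>space M. \<bar>Z w - z\<bar> < \<delta>} = 0"
    then have "AE x in lborel. ennreal (std_normal_density x) * indicator ?I x = 0"
      unfolding eq by (subst (asm) nn_integral_0_iff_AE) auto
    then have "AE x in lborel. x \<notin> ?I"
    proof (rule AE_mp, intro AE_I2 impI)
      fix x assume "ennreal (std_normal_density x) * indicator ?I x = 0"
      moreover have "ennreal (std_normal_density x) \<noteq> 0" by (simp add: normal_density_pos ennreal_eq_0_iff not_le)
      ultimately show "x \<notin> ?I" by (auto simp: indicator_def split: if_splits)
    qed
    then have "emeasure lborel ?I = 0" by (subst (asm) AE_iff_measurable[of ?I]) auto
    then show False using assms(3) by simp
  qed
  then show ?thesis by (simp add: emeasure_eq_measure zero_less_measure_iff)
qed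

lemma integrable_power_std_normal:
  assumes "distributed M lborel Z (\<lambda>x. ennreal (std_normal_density x))"
  shows "integrable M (\<lambda>w. Z w ^ k)"
  using integrable_std_normal_moment[of k] distributed_integrable[OF assms, of "\<lambda>x. x ^ k"]
  by simp

lemma integrable_quadratic_powr_std_normal:
  assumes Z: "distributed M lborel Z (\<lambda>x. ennreal (std_normal_density x))" "prob_space M"
    and b: "b > 0" and c: "c > 0" and p: "p \<ge> 0"
  shows "integrable M (\<lambda>w. (b + c * (Z w)\<^sup>2) powr p)"
proof -
  interpret prob_space M by fact
  have [measurable]: "Z \<in> borel_measurable M" using distributed_measurable[OF Z(1)] by simp
  obtain n :: nat where n: "p \<le> of_nat n" using real_arch_simple by blast
  let ?g = "\<lambda>w. (b + c) powr p * (2 ^ n * (1 + Z w ^ (2 * n)))"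
  show ?thesis
  proof (rule Bochner_Integration.integrable_bound[of _ ?g])
    show "integrable M ?g" using integrable_power_std_normal[OF Z(1)] by simp
    show "AE w in M. norm ((b + c * (Z w)\<^sup>2) powr p) \<le> norm (?g w)"
    proof (rule AE_I2)
      fix w
      define y where "y = (Z w)\<^sup>2"
      have y: "y \<ge> 0" by (simp add: y_def)
      have "(b + c * y) powr p \<le> ((b + c) * (1 + y)) powr p"
        using b c y p by (intro powr_mono2) (auto simp: algebra_simps)
      also have "\<dots> = (b + c) powr p * (1 + y) powr p" using b c y by (simp add: powr_mult)
      also have "(1 + y) powr p \<le> (1 + y) powr of_nat n" using y n by (intro powr_mono) auto
      also have "(1 + y) powr of_nat n = (1 + y) ^ n" using y by (simp add: powr_realpow)
      also have "\<dots> \<le> (2 * max 1 y) ^ n" using y by (intro power_mono) auto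
      also have "\<dots> \<le> 2 ^ n * (1 + y ^ n)" using y by (auto simp: power_mult_distrib max_def)
      also have "y ^ n = Z w ^ (2 * n)" by (simp add: y_def power_mult)
      finally have "(b + c * y) powr p \<le> ?g w" by (simp add: mult_left_mono)
      then show "norm ((b + c * (Z w)\<^sup>2) powr p) \<le> norm (?g w)" by (simp add: y_def)
    qed
  qed measurable
qed

section \<open>The stationary volatility\<close>

lemma borel_measurable_vec_nth_raw[measurable (raw)]:
  fixes f :: "'a \<Rightarrow> real^'d::finite"
  assumes "f \<in> borel_measurable M" shows "(\<lambda>x. f x $ i) \<in> borel_measurable M"
  by (rule measurable_compose[OF assms], rule borel_measurable_continuous_onI) (intro continuous_intros)

lemma borel_measurable_vec_lambda:
  fixes f :: "'a \<Rightarrow> 'd::finite \<Rightarrow> real"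
  assumes "\<And>i. (\<lambda>x. f x i) \<in> borel_measurable M"
  shows "(\<lambda>x. \<chi> i. f x i) \<in> borel_measurable M"
  using assms by (subst borel_measurable_euclidean_space) (auto simp: Basis_vec_def inner_axis)

context prob_space
begin

text \<open>Unlike \<^const>\<open>indep_var\<close>, this allows two random variables of different types.\<close>

definition indep_pair where
  "indep_pair S X T Y \<longleftrightarrow> X \<in> measurable M S \<and> Y \<in> measurable M T \<and>
     distr M S X \<Otimes>\<^sub>M distr M T Y = distr M (S \<Otimes>\<^sub>M T) (\<lambda>w. (X w, Y w))"

lemma indep_pairD:
  assumes "indep_pair S X T Y"
  shows "X \<in> measurable M S" "Y \<in> measurable M T"
    "distr M S X \<Otimes>\<^sub>M distr M T Y = distr M (S \<Otimes>\<^sub>M T) (\<lambda>w. (X w, Y w))"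
  using assms by (auto simp: indep_pair_def)

lemma indep_pair_iff_indep_var: "indep_pair S X T Y \<longleftrightarrow> indep_var S X T Y"
  by (simp add: indep_pair_def indep_var_distribution_eq)

lemma indep_pair_compose:
  assumes ind: "indep_pair S X T Y" and f[measurable]: "f \<in> measurable S S'" and g[measurable]: "g \<in> measurable T T'"
  shows "indep_pair S' (\<lambda>w. f (X w)) T' (\<lambda>w. g (Y w))"
proof -
  note [measurable] = indep_pairD(1,2)[OF ind]
  have "prob_space (distr M T' (\<lambda>w. g (Y w)))" by (rule prob_space_distr) measurable
  then interpret Y: prob_space "distr M T' (\<lambda>w. g (Y w))" .
  have eq: "distr M S' (\<lambda>w. f (X w)) = distr (distr M S X) S' f" "distr M T' (\<lambda>w. g (Y w)) = distr (distr M T Y) T' g"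
    by (simp_all add: distr_distr comp_def)
  have "distr M S' (\<lambda>w. f (X w)) \<Otimes>\<^sub>M distr M T' (\<lambda>w. g (Y w)) =
      distr (distr M S X \<Otimes>\<^sub>M distr M T Y) (S' \<Otimes>\<^sub>M T') (\<lambda>(x, y). (f x, g y))"
    unfolding eq by (rule pair_measure_distr) (use Y.sigma_finite_measure_axioms in \<open>simp_all add: eq\<close>)
  also have "\<dots> = distr M (S' \<Otimes>\<^sub>M T') (\<lambda>w. (f (X w), g (Y w)))"
    unfolding indep_pairD(3)[OF ind] by (subst distr_distr) (auto simp: comp_def)
  finally show ?thesis unfolding indep_pair_def by simp
qed

lemma indep_pair_commute:
  assumes ind: "indep_pair S X T Y" shows "indep_pair T Y S X"
proof -
  note [measurable] = indep_pairD(1,2)[OF ind]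
  interpret X: prob_space "distr M S X" by (rule prob_space_distr) measurable
  interpret Y: prob_space "distr M T Y" by (rule prob_space_distr) measurable
  interpret P: pair_sigma_finite "distr M T Y" "distr M S X" ..
  have "distr M T Y \<Otimes>\<^sub>M distr M S X = distr (distr M S X \<Otimes>\<^sub>M distr M T Y) (distr M T Y \<Otimes>\<^sub>M distr M S X) (\<lambda>(x, y). (y, x))"
    by (rule P.distr_pair_swap)
  also have "\<dots> = distr (distr M S X \<Otimes>\<^sub>M distr M T Y) (T \<Otimes>\<^sub>M S) (\<lambda>(x, y). (y, x))"
    by (rule distr_cong) (auto intro!: sets_pair_measure_cong)
  also have "\<dots> = distr M (T \<Otimes>\<^sub>M S) (\<lambda>w. (Y w, X w))"
    unfolding indep_pairD(3)[OF ind] by (subst distr_distr) (auto simp: comp_def)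
  finally show ?thesis unfolding indep_pair_def by simp
qed

text \<open>The causal series represents \<open>X 0\<close> only almost everywhere, so independence
  has to be transferred along such an equality.\<close>

lemma indep_pair_cong_AE:
  assumes ind: "indep_pair S X T Y" and [measurable]: "X' \<in> measurable M S" and ae: "AE w in M. X w = X' w"
  shows "indep_pair S X' T Y"
proof -
  note [measurable] = indep_pairD(1,2)[OF ind]
  have "distr M S X = distr M S X'"
    by (rule distr_cong_AE) (use ae in auto)
  moreover have "distr M (S \<Otimes>\<^sub>M T) (\<lambda>w. (X w, Y w)) = distr M (S \<Otimes>\<^sub>M T) (\<lambda>w. (X' w, Y w))"
    by (rule distr_cong_AE) (use ae in auto)
  ultimately show ?thesis using indep_pairD(3)[OF ind] by (simp add: indep_pair_def)
qed

end

locale ccc_volatility = prob_space M for M :: "'w measure" +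
  fixes Z :: "int \<Rightarrow> 'w \<Rightarrow> real" and a b c \<alpha> :: "real^'d::finite" and X :: "int \<Rightarrow> 'w \<Rightarrow> real^'d"
  assumes Z_indep: "indep_vars (\<lambda>_. borel) Z UNIV"
    and Z_normal: "distributed M lborel (Z t) (\<lambda>x. ennreal (std_normal_density x))"
    and a_pos: "a $ i > 0" and b_pos: "b $ i > 0" and c_pos: "c $ i > 0" and \<alpha>_pos: "\<alpha> $ i > 0"
    and ln_neg: "expectation (\<lambda>w. ln (b $ i + c $ i * (Z 0 w)\<^sup>2)) < 0"
    and \<alpha>_moment: "expectation (\<lambda>w. (b $ i + c $ i * (Z 0 w)\<^sup>2) powr (\<alpha> $ i)) = 1"
    and X_measurable[measurable]: "X t \<in> borel_measurable M"
    and X_nonneg: "X t w $ i \<ge> 0"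
    and X_stationary: "distr M (\<Pi>\<^sub>M t\<in>UNIV. borel) (\<lambda>w t. X (t + h) w) = distr M (\<Pi>\<^sub>M t\<in>UNIV. borel) (\<lambda>w t. X t w)"
    and X_rec: "AE w in M. X t w $ i = a $ i + (b $ i + c $ i * (Z (t - 1) w)\<^sup>2) * X (t - 1) w $ i"
begin

lemma Z_measurable[measurable]: "Z t \<in> borel_measurable M"
  using distributed_measurable[OF Z_normal[of t]] by simp

lemma X_marginal: "distr M borel (X t) = distr M borel (X 0)"
proof -
  have [measurable]: "(\<lambda>w s. X (s + h) w) \<in> measurable M (\<Pi>\<^sub>M t\<in>UNIV. borel)" for h
    by (rule measurable_PiM_single') (auto simp: space_PiM)
  have eq: "distr (distr M (\<Pi>\<^sub>M t\<in>UNIV. borel) (\<lambda>w s. X (s + h) w)) borel (\<lambda>x. x 0) = distr M borel (X h)" for h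
    by (subst distr_distr) (auto simp: comp_def)
  from eq[of t] eq[of 0] show ?thesis using X_stationary[of t] X_stationary[of 0] by simp
qed

section \<open>Causal series and independence of the later noise\<close>

definition A where "A i w = b $ i + c $ i * (Z 0 w)\<^sup>2"

text \<open>The product of the multipliers of the \<open>k\<close> steps from time \<open>-k\<close>
  to time 0.\<close>

definition P where "P i k w = (\<Prod>j<k. b $ i + c $ i * (Z (- 1 - int j) w)\<^sup>2)"

lemma P_pos: "P i k w > 0"
  unfolding P_def by (intro prod_pos ballI add_pos_nonneg) (simp_all add: b_pos c_pos less_imp_le)

lemma P_measurable[measurable]: "P i k \<in> borel_measurable M"
  unfolding P_def by measurable

lemma X_rec_all: "AE w in M. \<forall>t i. X t w $ i = a $ i + (b $ i + c $ i * (Z (t - 1) w)\<^sup>2) * X (t - 1) w $ i"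
  using X_rec by (simp add: AE_all_countable)

lemma X_unrolled: "AE w in M. \<forall>n. X 0 w $ i = (\<Sum>k<n. a $ i * P i k w) + P i n w * X (- int n) w $ i"
  using X_rec_all
proof eventually_elim
  fix w assume rec: "\<forall>t i. X t w $ i = a $ i + (b $ i + c $ i * (Z (t - 1) w)\<^sup>2) * X (t - 1) w $ i"
  show "\<forall>n. X 0 w $ i = (\<Sum>k<n. a $ i * P i k w) + P i n w * X (- int n) w $ i"
  proof
    fix n show "X 0 w $ i = (\<Sum>k<n. a $ i * P i k w) + P i n w * X (- int n) w $ i"
    proof (induction n)
      case (Suc n)
      have e: "- int n - 1 = - int (Suc n)" "- 1 - int n = - int (Suc n)" by simp_all
      have "X (- int n) w $ i = a $ i + (b $ i + c $ i * (Z (- int (Suc n)) w)\<^sup>2) * X (- int (Suc n)) w $ i"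
        using rec[rule_format, of "- int n" i] by (simp only: e)
      moreover have "P i (Suc n) w = P i n w * (b $ i + c $ i * (Z (- int (Suc n)) w)\<^sup>2)"
        by (simp only: P_def prod.lessThan_Suc e(2))
      ultimately show ?case using Suc by (simp only: sum.lessThan_Suc) (simp add: algebra_simps)
    qed (simp add: P_def)
  qed
qed

text \<open>The partial sums are bounded by \<open>X 0\<close>, so the products \<^const>\<open>P\<close> tend to zero; the remainder
  vanishes because the laws of \<open>X (- n)\<close> are all equal, hence tight.\<close>

lemma X_causal: "AE w in M. X 0 w $ i = a $ i * (\<Sum>k. P i k w)"
proof -
  \<comment> \<open>Capping at 1 lets limits pass to expectations without any moment of
    \<open>X\<close>. \<open>?p\<close> is the capped remainder, and \<open>?k K\<close> bounds it
    wherever \<open>X (- int n)\<close> is at most \<open>K\<close>; \<open>n\<close> goes to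
    infinity before \<open>K\<close>.\<close>
  let ?p = "\<lambda>n w. min 1 (P i n w * X (- int n) w $ i)" and ?k = "\<lambda>K n w. min 1 (real K * P i n w)"
  define \<delta> where "\<delta> w = X 0 w $ i - (\<Sum>k. a $ i * P i k w)" for w
  have [measurable]: "\<delta> \<in> borel_measurable M" unfolding \<delta>_def by measurable
  have lim: "AE w in M. summable (\<lambda>k. P i k w) \<and> \<delta> w \<ge> 0 \<and> (\<lambda>n. P i n w) \<longlonglongrightarrow> 0 \<and> (\<lambda>n. P i n w * X (- int n) w $ i) \<longlonglongrightarrow> \<delta> w"
    using X_unrolled[of i]
  proof eventually_elim
    fix w assume un: "\<forall>n. X 0 w $ i = (\<Sum>k<n. a $ i * P i k w) + P i n w * X (- int n) w $ i"
    have nn: "0 \<le> P i n w * X (- int n) w $ i" for n using P_pos[of i n w] X_nonneg by simp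
    have bd: "(\<Sum>k<n. a $ i * P i k w) \<le> X 0 w $ i" for n using un nn[of n] by (metis le_add_same_cancel1)
    have su: "summable (\<lambda>k. a $ i * P i k w)"
      using bd P_pos a_pos by (intro summableI_nonneg_bounded[of _ "X 0 w $ i"]) (auto simp: less_imp_le)
    then have "(\<lambda>n. X 0 w $ i - (\<Sum>k<n. a $ i * P i k w)) \<longlonglongrightarrow> \<delta> w"
      unfolding \<delta>_def by (intro tendsto_intros summable_LIMSEQ)
    moreover have "X 0 w $ i - (\<Sum>k<n. a $ i * P i k w) = P i n w * X (- int n) w $ i" for n
      using un by (metis add_diff_cancel_left')
    ultimately have l: "(\<lambda>n. P i n w * X (- int n) w $ i) \<longlonglongrightarrow> \<delta> w" by simp
    moreover have "\<delta> w \<ge> 0" by (rule LIMSEQ_le_const[OF l]) (use nn in auto)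
    moreover have "(\<lambda>n. a $ i * P i n w) \<longlonglongrightarrow> 0" by (rule summable_LIMSEQ_zero[OF su])
    from tendsto_mult_left[OF this, of "1 / a $ i"] have "(\<lambda>n. P i n w) \<longlonglongrightarrow> 0"
      using a_pos[of i] by simp
    moreover have "summable (\<lambda>k. P i k w)"
      using summable_mult_D[OF su] a_pos[of i] by simp
    ultimately show "summable (\<lambda>k. P i k w) \<and> \<delta> w \<ge> 0 \<and> (\<lambda>n. P i n w) \<longlonglongrightarrow> 0 \<and> (\<lambda>n. P i n w * X (- int n) w $ i) \<longlonglongrightarrow> \<delta> w" by blast
  qed
  define E where "E = expectation (\<lambda>w. min 1 (max 0 (\<delta> w)))"
  have E_lim: "(\<lambda>n. expectation (?p n)) \<longlonglongrightarrow> E"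
    unfolding E_def
  proof (rule integral_dominated_convergence[where w="\<lambda>_. 1"])
    show "AE w in M. (\<lambda>n. ?p n w) \<longlonglongrightarrow> min 1 (max 0 (\<delta> w))"
      using lim by eventually_elim (auto simp: max_absorb2 intro!: tendsto_min)
  qed (auto simp: P_pos less_imp_le X_nonneg)
  have E_le: "E \<le> \<P>(w in M. X 0 w $ i > real K)" for K
  proof -
    have "(\<lambda>n. expectation (?k K n)) \<longlonglongrightarrow> expectation (\<lambda>w. 0)"
    proof (rule integral_dominated_convergence[where w="\<lambda>_. 1"])
      show "AE w in M. (\<lambda>n. ?k K n w) \<longlonglongrightarrow> 0"
        using lim
      proof eventually_elim
        fix w assume "summable (\<lambda>k. P i k w) \<and> \<delta> w \<ge> 0 \<and> (\<lambda>n. P i n w) \<longlonglongrightarrow> 0 \<and> (\<lambda>n. P i n w * X (- int n) w $ i) \<longlonglongrightarrow> \<delta> w"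
        then have "(\<lambda>n. ?k K n w) \<longlonglongrightarrow> min 1 (real K * 0)"
          by (intro tendsto_intros) auto
        then show "(\<lambda>n. ?k K n w) \<longlonglongrightarrow> 0" by simp
      qed
    qed (auto simp: P_pos less_imp_le)
    then have l: "(\<lambda>n. expectation (?k K n) + \<P>(w in M. X 0 w $ i > real K)) \<longlonglongrightarrow> 0 + \<P>(w in M. X 0 w $ i > real K)"
      by (intro tendsto_intros) simp
    have "E \<le> 0 + \<P>(w in M. X 0 w $ i > real K)"
    proof (rule LIMSEQ_le[OF E_lim l], intro exI allI impI)
      fix n
      have "\<P>(w in M. X (- int n) w $ i > real K) = measure (distr M borel (X (- int n))) {x. x $ i > real K}"
        by (subst measure_distr) (auto intro!: arg_cong[of _ _ prob])
      also have "\<dots> = \<P>(w in M. X 0 w $ i > real K)"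
        unfolding X_marginal[of "- int n"] by (subst measure_distr) (auto intro!: arg_cong[of _ _ prob])
      finally have peq: "\<P>(w in M. X (- int n) w $ i > real K) = \<P>(w in M. X 0 w $ i > real K)" .
      have i1: "integrable M (?k K n)"
        by (rule integrable_bounded[of _ 1]) (auto simp: P_pos less_imp_le)
      have "expectation (?p n) \<le>
        expectation (\<lambda>w. ?k K n w + indicator {w\<in>space M. X (- int n) w $ i > real K} w)"
      proof (rule integral_mono)
        show "integrable M (?p n)"
          by (rule integrable_bounded[of _ 1]) (auto simp: P_pos less_imp_le X_nonneg)
        fix w assume "w \<in> space M"
        show "?p n w \<le> ?k K n w + indicator {w\<in>space M. X (- int n) w $ i > real K} w"
        proof (cases "X (- int n) w $ i > real K")
          case True
          have "0 \<le> ?k K n w" using P_pos[of i n w] by simp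
          then show ?thesis using True \<open>w \<in> space M\<close> by simp
        next
          case False
          then have "P i n w * X (- int n) w $ i \<le> real K * P i n w"
            using P_pos[of i n w] by (subst mult.commute) (intro mult_right_mono, auto)
          then show ?thesis by (intro add_increasing2 min.mono) auto
        qed
      qed (auto intro!: i1 Bochner_Integration.integrable_add integrable_real_indicator simp: emeasure_eq_measure)
      also have "\<dots> = expectation (?k K n) + \<P>(w in M. X (- int n) w $ i > real K)"
        by (subst Bochner_Integration.integral_add) (auto intro!: i1 integrable_real_indicator simp: emeasure_eq_measure)
      finally show "expectation (?p n) \<le> expectation (?k K n) + \<P>(w in M. X 0 w $ i > real K)"
        by (simp add: peq)
    qed
    then show ?thesis by simp
  qed
  have "(\<lambda>K. \<P>(w in M. X 0 w $ i > real K)) \<longlonglongrightarrow> prob (\<Inter>K. {w\<in>space M. X 0 w $ i > real K})"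
    by (rule finite_Lim_measure_decseq) (auto simp: decseq_def)
  moreover have "(\<Inter>K. {w\<in>space M. X 0 w $ i > real K}) = {}"
  proof -
    have "\<exists>K. \<not> (X 0 w $ i > real K)" for w using real_arch_simple[of "X 0 w $ i"] by (auto simp: not_less)
    then show ?thesis by auto
  qed
  ultimately have "(\<lambda>K. \<P>(w in M. X 0 w $ i > real K)) \<longlonglongrightarrow> 0" by simp
  then have "E \<le> 0" by (rule LIMSEQ_le_const) (use E_le in auto)
  moreover have "E \<ge> 0" unfolding E_def by (intro Bochner_Integration.integral_nonneg) auto
  ultimately have "E = 0" by linarith
  then have "expectation (\<lambda>w. min 1 (max 0 (\<delta> w))) = 0" unfolding E_def .
  then have "AE w in M. min 1 (max 0 (\<delta> w)) = 0"
    by (subst (asm) integral_nonneg_eq_0_iff_AE) (auto intro!: integrable_bounded[of _ 1])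
  with lim show ?thesis
    by eventually_elim (auto simp: \<delta>_def suminf_mult min_def split: if_splits)
qed

text \<open>The noise from time 0 on: \<open>\<zeta> w k\<close> drives the step of the volatility
  from \<open>k\<close> to \<open>k + 1\<close>.\<close>

definition \<zeta> where "\<zeta> w k = Z (int k) w"

text \<open>By \<open>X_causal\<close>, \<open>X 0\<close> agrees almost everywhere with
  \<open>past\<close>, a measurable function of the noise at negative times, and restrictions of the
  noise to disjoint sets of times are independent.\<close>

lemma X0_indep_future: "indep_pair (\<Pi>\<^sub>M k\<in>UNIV. borel) \<zeta> borel (X 0)"
proof -
  define past where "past z = (\<chi> i. a $ i * (\<Sum>k. \<Prod>j<k. b $ i + c $ i * (z (- 1 - int j))\<^sup>2))" for z :: "int \<Rightarrow> real"
  have [measurable]: "(\<lambda>z. z (- 1 - int j)) \<in> borel_measurable (\<Pi>\<^sub>M k\<in>{..<0}. borel)" for j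
    by (rule measurable_component_singleton) simp
  have past: "past \<in> borel_measurable (\<Pi>\<^sub>M k\<in>{..<0}. borel)"
    unfolding past_def by (intro borel_measurable_vec_lambda) measurable
  have future: "(\<lambda>z k. z (int k)) \<in> measurable (\<Pi>\<^sub>M k\<in>{0..}. borel) (\<Pi>\<^sub>M k\<in>UNIV. (borel :: real measure))"
  proof (rule measurable_PiM_single')
    show "(\<lambda>z. z (int k)) \<in> measurable (\<Pi>\<^sub>M k\<in>{0..}. borel) (borel :: real measure)" for k
      by (rule measurable_component_singleton) simp
  qed simp
  have "indep_var (\<Pi>\<^sub>M k\<in>{..<0}. borel) (\<lambda>w. restrict (\<lambda>i. Z i w) {..<0}) (\<Pi>\<^sub>M k\<in>{0..}. borel) (\<lambda>w. restrict (\<lambda>i. Z i w) {0..})"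
    by (rule indep_var_restrict[OF Z_indep]) auto
  then have "indep_pair (\<Pi>\<^sub>M k\<in>{..<0}. borel) (\<lambda>w. restrict (\<lambda>i. Z i w) {..<0}) (\<Pi>\<^sub>M k\<in>{0..}. borel) (\<lambda>w. restrict (\<lambda>i. Z i w) {0..})"
    by (simp add: indep_pair_iff_indep_var)
  from indep_pair_compose[OF this past future]
  have "indep_pair borel (\<lambda>w. past (restrict (\<lambda>i. Z i w) {..<0})) (\<Pi>\<^sub>M k\<in>UNIV. borel) (\<lambda>w k. restrict (\<lambda>i. Z i w) {0..} (int k))" .
  moreover have "(\<lambda>w k. restrict (\<lambda>i. Z i w) {0..} (int k)) = \<zeta>"
    by (auto simp: fun_eq_iff \<zeta>_def)
  ultimately have ind: "indep_pair borel (\<lambda>w. past (restrict (\<lambda>i. Z i w) {..<0})) (\<Pi>\<^sub>M k\<in>UNIV. borel) \<zeta>" by simp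
  have "AE w in M. past (restrict (\<lambda>i. Z i w) {..<0}) = X 0 w"
  proof -
    have "AE w in M. \<forall>i. X 0 w $ i = a $ i * (\<Sum>k. P i k w)"
      using X_causal by (simp add: AE_all_countable)
    then show ?thesis by eventually_elim (auto simp: past_def P_def vec_eq_iff)
  qed
  from indep_pair_cong_AE[OF ind X_measurable this]
  have "indep_pair borel (X 0) (\<Pi>\<^sub>M k\<in>UNIV. borel) \<zeta>" .
  then show ?thesis by (rule indep_pair_commute)
qed

lemma indep_var_Z0_X0:
  assumes [measurable]: "f \<in> borel_measurable borel" "g \<in> borel_measurable borel"
  shows "indep_var borel (\<lambda>w. f (Z 0 w) :: real) borel (\<lambda>w. g (X 0 w) :: real)"
  using indep_pair_compose[OF X0_indep_future, of "\<lambda>z. f (z 0)" borel g borel]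
  by (simp add: \<zeta>_def indep_pair_iff_indep_var)

section \<open>Moments and support of the random multipliers\<close>

lemma A_measurable[measurable]: "A i \<in> borel_measurable M"
  unfolding A_def by measurable

lemma A_ge: "A i w \<ge> b $ i"
  unfolding A_def using c_pos[of i] by simp

lemma A_pos: "A i w > 0"
  using A_ge b_pos less_le_trans by blast

lemma A_powr_integrable: "p \<ge> 0 \<Longrightarrow> integrable M (\<lambda>w. A i w powr p)"
  unfolding A_def
  by (rule integrable_quadratic_powr_std_normal[OF Z_normal prob_space_axioms b_pos c_pos])

lemma A_powr_\<alpha>: "expectation (\<lambda>w. A i w powr \<alpha> $ i) = 1"
  using \<alpha>_moment[of i] by (simp add: A_def)

text \<open>Otherwise \<open>A i\<close> would be at least 1 everywhere, against the negative
  logarithmic moment. This is what places \<open>b $ i powr \<alpha> $ i\<close>, the lower end of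
  the range of the weight, below 1.\<close>

lemma b_less_1: "b $ i < 1"
proof (rule ccontr)
  assume "\<not> b $ i < 1"
  then have "ln (A i w) \<ge> 0" for w using A_ge[of i w] by simp
  then have "expectation (\<lambda>w. ln (A i w)) \<ge> 0" by (intro Bochner_Integration.integral_nonneg) auto
  then show False using ln_neg[of i] by (simp add: A_def)
qed

text \<open>The weight is a continuous function \<open>f\<close> of \<open>Z 0\<close> that takes
  the value \<open>y\<close> at \<open>z\<close>, and the normal law charges every neighbourhood of
  \<open>z\<close>.\<close>

lemma A_powr_supp:
  assumes y: "y > b $ i powr \<alpha> $ i" and \<eta>: "\<eta> > 0"
  shows "\<P>(w in M. \<bar>A i w powr \<alpha> $ i - y\<bar> < \<eta>) > 0"
proof -
  have w0: "y > 0" using y powr_ge_zero[of "b $ i" "\<alpha> $ i"] by linarith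
  define z where "z = sqrt ((y powr (1 / \<alpha> $ i) - b $ i) / c $ i)"
  define f where "f x = (b $ i + c $ i * x\<^sup>2) powr \<alpha> $ i" for x
  have "b $ i = (b $ i powr \<alpha> $ i) powr (1 / \<alpha> $ i)"
    using b_pos[of i] \<alpha>_pos[of i] by (simp add: powr_powr)
  also have "\<dots> < y powr (1 / \<alpha> $ i)"
    using y \<alpha>_pos[of i] b_pos[of i] by (intro powr_less_mono2) auto
  finally have "b $ i < y powr (1 / \<alpha> $ i)" .
  then have "z\<^sup>2 = (y powr (1 / \<alpha> $ i) - b $ i) / c $ i"
    unfolding z_def using c_pos[of i] by (intro real_sqrt_pow2) (auto intro!: divide_nonneg_pos)
  then have "b $ i + c $ i * z\<^sup>2 = y powr (1 / \<alpha> $ i)" using c_pos[of i] by simp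
  then have fz: "f z = y" using \<alpha>_pos[of i] w0 by (simp add: f_def powr_powr)
  have "b $ i + c $ i * z\<^sup>2 > 0" using b_pos[of i] c_pos[of i] by (intro add_pos_nonneg) auto
  then have "isCont f z" unfolding f_def by (intro continuous_intros) auto
  then obtain \<delta> where \<delta>: "\<delta> > 0" "\<And>x. dist x z < \<delta> \<Longrightarrow> dist (f x) (f z) < \<eta>"
    using \<eta> unfolding continuous_at_eps_delta by metis
  have "0 < \<P>(w in M. \<bar>Z 0 w - z\<bar> < \<delta>)"
    by (rule measure_distributed_std_normal_interval[OF Z_normal prob_space_axioms \<delta>(1)])
  also have "\<dots> \<le> \<P>(w in M. \<bar>A i w powr \<alpha> $ i - y\<bar> < \<eta>)"
    by (rule finite_measure_mono) (use \<delta>(2) in \<open>auto simp: f_def fz[symmetric] A_def dist_real_def\<close>)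
  finally show ?thesis .
qed

lemma A_powr_not_const: "\<not> (AE w in M. A i w powr \<alpha> $ i = 1)"
proof
  assume "AE w in M. A i w powr \<alpha> $ i = 1"
  then have "AE w in M. w \<notin> {w\<in>space M. \<bar>A i w powr \<alpha> $ i - 2\<bar> < 1}"
    by eventually_elim auto
  then have "\<P>(w in M. \<bar>A i w powr \<alpha> $ i - 2\<bar> < 1) = 0"
    by (subst prob_eq_0) auto
  moreover have "b $ i powr \<alpha> $ i < 1"
    using powr_less_mono2[OF \<alpha>_pos[of i] _ b_less_1[of i]] b_pos[of i] by simp
  ultimately show False using A_powr_supp[of i 2 1] by simp
qed

text \<open>A version of \<open>X 1\<close> that satisfies the recursion at every point and not just
  almost everywhere, as the pointwise hypotheses on \<open>V'\<close> in
  \<open>implicit_renewal\<close> and \<open>integrable_of_contraction\<close> require.\<close>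

definition nextX where "nextX w = (\<chi> i. a $ i + A i w * X 0 w $ i)"

lemma nextX_measurable[measurable]: "nextX \<in> borel_measurable M"
  unfolding nextX_def[abs_def] by (rule borel_measurable_vec_lambda) measurable

lemma nextX_AE: "AE w in M. nextX w = X 1 w"
proof -
  have "AE w in M. \<forall>i. X 1 w $ i = a $ i + A i w * X 0 w $ i"
    using X_rec[of 1] by (simp add: AE_all_countable A_def)
  then show ?thesis by eventually_elim (auto simp: nextX_def vec_eq_iff)
qed

lemma nextX_law:
  assumes [measurable]: "g \<in> measurable borel N"
  shows "distr M N (\<lambda>w. g (nextX w)) = distr M N (\<lambda>w. g (X 0 w))"
proof -
  have "distr M borel nextX = distr M borel (X 1)"
    by (rule distr_cong_AE) (use nextX_AE in auto)
  then have eq: "distr M borel nextX = distr M borel (X 0)" using X_marginal[of 1] by simp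
  have "distr M N (\<lambda>w. g (nextX w)) = distr (distr M borel nextX) N g"
    by (subst distr_distr) (auto simp: comp_def)
  also have "\<dots> = distr M N (\<lambda>w. g (X 0 w))"
    unfolding eq by (subst distr_distr) (auto simp: comp_def)
  finally show ?thesis .
qed

text \<open>Interpolation between \<open>A i powr \<alpha> $ i\<close>, of mean 1, and the constant
  1, with weight \<open>s / \<alpha> $ i\<close>; it is strict because the former is not
  constant.\<close>

lemma A_powr_moment_less_1:
  assumes "0 < s" "s < \<alpha> $ i" shows "expectation (\<lambda>w. A i w powr s) < 1"
  using expectation_geom_mean_less_1(2)[of "\<lambda>w. A i w powr \<alpha> $ i" "\<lambda>_. 1" "s / \<alpha> $ i"]
    assms \<alpha>_pos[of i] A_pos A_powr_integrable[of "\<alpha> $ i" i] A_powr_\<alpha> A_powr_not_const[of i] prob_space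
  by (simp add: powr_powr less_imp_neq[THEN not_sym])

lemma X_powr_integrable:
  assumes s: "0 < s" "s < \<alpha> $ i" shows "integrable M (\<lambda>w. (X 0 w $ i) powr s)"
proof -
  define \<rho> where "\<rho> = expectation (\<lambda>w. A i w powr s)"
  have \<rho>: "\<rho> < 1" unfolding \<rho>_def by (rule A_powr_moment_less_1[OF s])
  have \<rho>0: "\<rho> \<ge> 0" unfolding \<rho>_def by (intro Bochner_Integration.integral_nonneg) auto
  \<comment> \<open>Half of the room below 1 is spent on absorbing \<open>a\<close>:
    \<open>(1 + \<epsilon>) * \<rho>\<close> is at most \<open>(1 + \<rho>) / 2\<close>.\<close>
  define \<epsilon> where "\<epsilon> = (1 - \<rho>) / 2"
  have \<epsilon>: "\<epsilon> > 0" "(1 + \<epsilon>) * \<rho> < 1"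
  proof -
    show "\<epsilon> > 0" using \<rho> by (simp add: \<epsilon>_def)
    have "\<epsilon> * \<rho> \<le> \<epsilon>" using \<rho> \<rho>0 by (intro mult_left_le) (auto simp: \<epsilon>_def)
    then have "(1 + \<epsilon>) * \<rho> \<le> \<rho> + \<epsilon>" by (simp add: algebra_simps)
    also have "\<dots> < 1" using \<rho> by (simp add: \<epsilon>_def field_simps)
    finally show "(1 + \<epsilon>) * \<rho> < 1" .
  qed
  obtain C where C: "C \<ge> 0" "\<And>x. x \<ge> 0 \<Longrightarrow> (a $ i + x) powr s \<le> (1 + \<epsilon>) * x powr s + C"
    using powr_add_le_eps[OF a_pos[of i] s(1) \<epsilon>(1)] by blast
  show ?thesis
  proof (rule integrable_of_contraction[where W="\<lambda>w. (1 + \<epsilon>) * A i w powr s" and V'="\<lambda>w. (nextX w $ i) powr s" and N="\<lambda>_. C"])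
    show "indep_var borel (\<lambda>w. (1 + \<epsilon>) * A i w powr s) borel (\<lambda>w. X 0 w $ i powr s)"
      unfolding A_def
      by (rule indep_var_Z0_X0[of "\<lambda>z. (1 + \<epsilon>) * (b $ i + c $ i * z\<^sup>2) powr s" "\<lambda>x. (x $ i) powr s"]) measurable
    show "distr M borel (\<lambda>w. nextX w $ i powr s) = distr M borel (\<lambda>w. X 0 w $ i powr s)"
      by (rule nextX_law[of "\<lambda>x. (x $ i) powr s"]) measurable
    show "integrable M (\<lambda>w. (1 + \<epsilon>) * A i w powr s)" using A_powr_integrable[of s i] s by simp
    show "expectation (\<lambda>w. (1 + \<epsilon>) * A i w powr s) < 1" using \<epsilon> by (simp add: \<rho>_def)
    fix w
    have "nextX w $ i powr s \<le> (1 + \<epsilon>) * (A i w * X 0 w $ i) powr s + C"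
      unfolding nextX_def using A_pos[of i w] X_nonneg[of 0 w i] by (simp add: C)
    then show "nextX w $ i powr s \<le> (1 + \<epsilon>) * A i w powr s * X 0 w $ i powr s + C"
      using A_pos[of i w] X_nonneg[of 0 w i] by (simp add: powr_mult less_imp_le)
  qed (use \<epsilon> C in auto)
qed

lemma AX_powr_integrable:
  assumes "0 < s" "s < \<alpha> $ i"
  shows "integrable M (\<lambda>w. A i w powr s * X 0 w $ i powr s)"
proof (rule indep_var_integrable)
  show "indep_var borel (\<lambda>w. A i w powr s) borel (\<lambda>w. X 0 w $ i powr s)"
    unfolding A_def
    by (rule indep_var_Z0_X0[of "\<lambda>z. (b $ i + c $ i * z\<^sup>2) powr s" "\<lambda>x. (x $ i) powr s"]) measurable
qed (use assms A_powr_integrable X_powr_integrable in auto)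

text \<open>The geometric mean with weight 1/2 of two variables of mean 1. They differ for all large
  values of the noise, which have positive probability.\<close>

lemma A_powr_mixed:
  assumes ne: "\<alpha> $ j < \<alpha> $ i"
  shows "integrable M (\<lambda>w. A i w powr (\<alpha> $ i / 2) * A j w powr (\<alpha> $ j / 2))"
    and "expectation (\<lambda>w. A i w powr (\<alpha> $ i / 2) * A j w powr (\<alpha> $ j / 2)) < 1"
proof -
  have "\<not> (AE w in M. A i w powr \<alpha> $ i = A j w powr \<alpha> $ j)"
  proof
    assume ae: "AE w in M. A i w powr \<alpha> $ i = A j w powr \<alpha> $ j"
    have "\<forall>\<^sub>F z in at_top. (b $ i + c $ i * z\<^sup>2) powr \<alpha> $ i > (b $ j + c $ j * z\<^sup>2) powr \<alpha> $ j"
      by (intro quadratic_powr_dominates b_pos c_pos \<alpha>_pos ne)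
    then obtain z0 where z0: "\<And>z. z \<ge> z0 \<Longrightarrow> (b $ i + c $ i * z\<^sup>2) powr \<alpha> $ i > (b $ j + c $ j * z\<^sup>2) powr \<alpha> $ j"
      by (auto simp: eventually_at_top_linorder)
    have "\<P>(w in M. \<bar>Z 0 w - (z0 + 1)\<bar> < 1) = 0"
    proof (subst prob_eq_0)
      show "AE w in M. w \<notin> {w\<in>space M. \<bar>Z 0 w - (z0 + 1)\<bar> < 1}"
        using ae
      proof eventually_elim
        fix w assume "A i w powr \<alpha> $ i = A j w powr \<alpha> $ j"
        then have "\<not> Z 0 w \<ge> z0" using z0[of "Z 0 w"] by (auto simp: A_def)
        then show "w \<notin> {w\<in>space M. \<bar>Z 0 w - (z0 + 1)\<bar> < 1}" by auto
      qed
    qed measurable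
    then show False
      using measure_distributed_std_normal_interval[OF Z_normal prob_space_axioms, of 1 0 "z0 + 1"] by simp
  qed
  from expectation_geom_mean_less_1[OF _ A_powr_integrable A_powr_\<alpha> _ A_powr_integrable A_powr_\<alpha> _ _ this, of "1/2"]
  show "integrable M (\<lambda>w. A i w powr (\<alpha> $ i / 2) * A j w powr (\<alpha> $ j / 2))"
    and "expectation (\<lambda>w. A i w powr (\<alpha> $ i / 2) * A j w powr (\<alpha> $ j / 2)) < 1"
    using A_pos \<alpha>_pos by (simp_all add: powr_powr less_imp_le less_imp_neq[THEN not_sym])
qed

text \<open>The contraction argument for a product of two coordinates. Multiplying out leaves cross
  terms \<open>?N\<close> that involve one coordinate each, at half its tail exponent, so they are
  integrable.\<close>

lemma mixed_moment_integrable: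
  assumes ne: "\<alpha> $ j < \<alpha> $ i"
  shows "integrable M (\<lambda>w. (X 0 w $ i) powr (\<alpha> $ i / 2) * (X 0 w $ j) powr (\<alpha> $ j / 2))"
proof -
  define p where "p = \<alpha> $ i / 2"
  define q where "q = \<alpha> $ j / 2"
  have pq: "p > 0" "q > 0" "p < \<alpha> $ i" "q < \<alpha> $ j" using \<alpha>_pos by (simp_all add: p_def q_def)
  define \<rho> where "\<rho> = expectation (\<lambda>w. A i w powr p * A j w powr q)"
  have \<rho>: "\<rho> < 1" unfolding \<rho>_def p_def q_def by (rule A_powr_mixed[OF ne])
  have "((\<lambda>\<epsilon>. (1 + \<epsilon>)\<^sup>2 * \<rho>) \<longlongrightarrow> (1 + 0)\<^sup>2 * \<rho>) (at_right 0)" by (intro tendsto_intros)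
  then have "\<forall>\<^sub>F \<epsilon> in at_right 0. (1 + \<epsilon>)\<^sup>2 * \<rho> < 1 \<and> \<epsilon> > 0"
    using \<rho> by (intro eventually_conj order_tendstoD eventually_at_right_less) auto
  then obtain \<epsilon> where \<epsilon>: "\<epsilon> > 0" "(1 + \<epsilon>)\<^sup>2 * \<rho> < 1" by (auto dest!: eventually_happens)
  obtain C1 where C1: "C1 \<ge> 0" "\<And>x. x \<ge> 0 \<Longrightarrow> (a $ i + x) powr p \<le> (1 + \<epsilon>) * x powr p + C1"
    using powr_add_le_eps[OF a_pos[of i] pq(1) \<epsilon>(1)] by blast
  obtain C2 where C2: "C2 \<ge> 0" "\<And>x. x \<ge> 0 \<Longrightarrow> (a $ j + x) powr q \<le> (1 + \<epsilon>) * x powr q + C2"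
    using powr_add_le_eps[OF a_pos[of j] pq(2) \<epsilon>(1)] by blast
  define u where "u w = A i w powr p * X 0 w $ i powr p" for w
  define v where "v w = A j w powr q * X 0 w $ j powr q" for w
  have uv0: "u w \<ge> 0" "v w \<ge> 0" for w by (simp_all add: u_def v_def)
  have intuv: "integrable M u" "integrable M v" unfolding u_def v_def by (intro AX_powr_integrable pq)+
  let ?N = "\<lambda>w. (1 + \<epsilon>) * C2 * u w + (1 + \<epsilon>) * C1 * v w + C1 * C2"
  have "integrable M (\<lambda>w. (X 0 w $ i) powr p * (X 0 w $ j) powr q)"
  proof (rule integrable_of_contraction[where W="\<lambda>w. (1 + \<epsilon>)\<^sup>2 * (A i w powr p * A j w powr q)"
        and V'="\<lambda>w. (nextX w $ i) powr p * (nextX w $ j) powr q" and N="?N"])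
    show "indep_var borel (\<lambda>w. (1 + \<epsilon>)\<^sup>2 * (A i w powr p * A j w powr q)) borel (\<lambda>w. X 0 w $ i powr p * X 0 w $ j powr q)"
      unfolding A_def
      by (rule indep_var_Z0_X0[of "\<lambda>z. (1 + \<epsilon>)\<^sup>2 * ((b $ i + c $ i * z\<^sup>2) powr p * (b $ j + c $ j * z\<^sup>2) powr q)"
         "\<lambda>x. (x $ i) powr p * (x $ j) powr q"]) measurable
    show "distr M borel (\<lambda>w. nextX w $ i powr p * nextX w $ j powr q) = distr M borel (\<lambda>w. X 0 w $ i powr p * X 0 w $ j powr q)"
      by (rule nextX_law[of "\<lambda>x. (x $ i) powr p * (x $ j) powr q"]) measurable
    show "integrable M (\<lambda>w. (1 + \<epsilon>)\<^sup>2 * (A i w powr p * A j w powr q))"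
      using A_powr_mixed(1)[OF ne] by (simp add: p_def q_def)
    show "expectation (\<lambda>w. (1 + \<epsilon>)\<^sup>2 * (A i w powr p * A j w powr q)) < 1" using \<epsilon> by (simp add: \<rho>_def)
    show "integrable M ?N" using intuv by simp
    fix w
    show "?N w \<ge> 0" using uv0 C1 C2 \<epsilon> by simp
    have "nextX w $ i powr p \<le> (1 + \<epsilon>) * (A i w * X 0 w $ i) powr p + C1"
      unfolding nextX_def using A_pos[of i w] X_nonneg[of 0 w i] by (simp add: C1)
    then have 1: "nextX w $ i powr p \<le> (1 + \<epsilon>) * u w + C1"
      using A_pos[of i w] X_nonneg[of 0 w i] by (simp add: powr_mult less_imp_le u_def)
    have "nextX w $ j powr q \<le> (1 + \<epsilon>) * (A j w * X 0 w $ j) powr q + C2"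
      unfolding nextX_def using A_pos[of j w] X_nonneg[of 0 w j] by (simp add: C2)
    then have 2: "nextX w $ j powr q \<le> (1 + \<epsilon>) * v w + C2"
      using A_pos[of j w] X_nonneg[of 0 w j] by (simp add: powr_mult less_imp_le v_def)
    have "nextX w $ i powr p * nextX w $ j powr q \<le> ((1 + \<epsilon>) * u w + C1) * ((1 + \<epsilon>) * v w + C2)"
      by (intro mult_mono 1 2) (use uv0 C1 C2 \<epsilon> in auto)
    also have "\<dots> = (1 + \<epsilon>)\<^sup>2 * (A i w powr p * A j w powr q) * (X 0 w $ i powr p * X 0 w $ j powr q) + ?N w"
      by (simp add: u_def v_def power2_eq_square algebra_simps)
    finally show "nextX w $ i powr p * nextX w $ j powr q \<le> (1 + \<epsilon>)\<^sup>2 * (A i w powr p * A j w powr q) * (X 0 w $ i powr p * X 0 w $ j powr q) + ?N w" .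
  qed auto
  then show ?thesis by (simp add: p_def q_def)
qed

section \<open>Tails of single coordinates and of pairs\<close>

definition T where "T i w = (X 0 w $ i) powr (\<alpha> $ i)"

lemma T_measurable[measurable]: "T i \<in> borel_measurable M"
  unfolding T_def by measurable

lemma T_nonneg: "T i w \<ge> 0" by (simp add: T_def)

text \<open>If both variables exceed \<open>x\<close>, so does the product of their square roots.
  That product is the integrable mixed moment, whose tail is of smaller order than 1/x.\<close>

lemma asymptotic_independence:
  assumes "\<alpha> $ i \<noteq> \<alpha> $ j"
  shows "((\<lambda>x. x * \<P>(w in M. T i w > x \<and> T j w > x)) \<longlongrightarrow> 0) at_top"
proof -
  have *: "((\<lambda>x. x * \<P>(w in M. T i w > x \<and> T j w > x)) \<longlongrightarrow> 0) at_top"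
    if ne: "\<alpha> $ j < \<alpha> $ i" for i j
  proof (rule tendsto_sandwich[OF _ _ tendsto_const])
    let ?f = "\<lambda>w. (X 0 w $ i) powr (\<alpha> $ i / 2) * (X 0 w $ j) powr (\<alpha> $ j / 2)"
    show "((\<lambda>x. x * \<P>(w in M. ?f w > x)) \<longlongrightarrow> 0) at_top"
      by (rule integrable_imp_tail_small[OF mixed_moment_integrable[OF ne]]) simp
    show "\<forall>\<^sub>F x in at_top. 0 \<le> x * \<P>(w in M. T i w > x \<and> T j w > x)"
      using eventually_gt_at_top[of 0] by eventually_elim simp
    show "\<forall>\<^sub>F x in at_top. x * \<P>(w in M. T i w > x \<and> T j w > x) \<le> x * \<P>(w in M. ?f w > x)"
      using eventually_gt_at_top[of 0]
    proof eventually_elim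
      fix x :: real assume x: "x > 0"
      have "x < ?f w" if "T i w > x" "T j w > x" for w
      proof -
        have sq: "t powr (s / 2) = sqrt (t powr s)" for t s :: real
          using powr_powr[of t s "1/2"] by (simp add: powr_half_sqrt)
        have "x = sqrt x * sqrt x" using x by simp
        also have "\<dots> < sqrt (T i w) * sqrt (T j w)" using that x by (intro mult_strict_mono) auto
        finally show ?thesis by (simp add: T_def sq)
      qed
      then show "x * \<P>(w in M. T i w > x \<and> T j w > x) \<le> x * \<P>(w in M. ?f w > x)"
        using x by (intro mult_left_mono finite_measure_mono) auto
    qed
  qed
  consider "\<alpha> $ j < \<alpha> $ i" | "\<alpha> $ i < \<alpha> $ j" using assms by linarith
  then show ?thesis using *[of j i] *[of i j] by cases (simp_all add: conj_commute)
qed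

lemma coordinate_tail: "\<exists>\<kappa>>0. ((\<lambda>x. x * \<P>(w in M. T i w > x)) \<longlongrightarrow> \<kappa>) at_top"
proof -
  \<comment> \<open>A positive order in the window below \<open>\<alpha> $ i\<close> of length 1:
    small enough for the moment of \<open>X\<close> to be finite, large enough to dominate the
    increment caused by \<open>a\<close>.\<close>
  define s where "s = max (\<alpha> $ i / 2) (\<alpha> $ i - 1 / 2)"
  have s: "0 < s" "\<alpha> $ i - 1 < s" "s < \<alpha> $ i" using \<alpha>_pos[of i] by (auto simp: s_def)
  obtain C where C: "C \<ge> 0" "\<And>x. x \<ge> 0 \<Longrightarrow> (a $ i + x) powr \<alpha> $ i - x powr \<alpha> $ i \<le> C * (1 + x powr s)"
    using powr_increment_le[OF a_pos[of i] \<alpha>_pos[of i] s(1,2)] by blast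
  note intu = AX_powr_integrable[OF s(1,3)]
  \<comment> \<open>Dominates \<open>W * ln W\<close>: as \<open>A i\<close> lies above
    \<open>b $ i\<close> and above its own logarithm, \<open>\<bar>ln (A i w)\<bar>\<close> is at
    most \<open>\<bar>ln (b $ i)\<bar> + A i w\<close>.\<close>
  let ?d = "\<lambda>w. \<alpha> $ i * (\<bar>ln (b $ i)\<bar> * A i w powr \<alpha> $ i + A i w powr (\<alpha> $ i + 1))"
  let ?W = "\<lambda>w. A i w powr \<alpha> $ i" and ?V' = "\<lambda>w. nextX w $ i powr \<alpha> $ i"
  have WT: "?W w * T i w = (A i w * X 0 w $ i) powr \<alpha> $ i" for w
    using A_pos[of i w] X_nonneg[of 0 w i] by (simp add: T_def powr_mult less_imp_le)
  have AX: "A i w * X 0 w $ i \<ge> 0" for w using A_pos[of i w] X_nonneg[of 0 w i] by simp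
  have less: "?W w * T i w < ?V' w" for w
    unfolding WT nextX_def using AX[of w] a_pos[of i] \<alpha>_pos[of i] by (auto intro!: powr_less_mono2)
  let ?e = "\<lambda>w. C * (1 + A i w powr s * X 0 w $ i powr s)"
  have gap: "integrable M (\<lambda>w. ?V' w - ?W w * T i w)"
  proof (rule Bochner_Integration.integrable_bound[of _ "?e"])
    show "AE w in M. norm (?V' w - ?W w * T i w) \<le> norm (?e w)"
    proof (rule AE_I2)
      fix w
      have "?V' w - ?W w * T i w \<le> C * (1 + (A i w * X 0 w $ i) powr s)"
        unfolding WT nextX_def using C(2)[OF AX[of w]] by simp
      also have "\<dots> = ?e w"
        using A_pos[of i w] X_nonneg[of 0 w i] by (simp add: powr_mult less_imp_le)
      finally show "norm (?V' w - ?W w * T i w) \<le> norm (?e w)"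
        using less[of w] by simp
    qed
  qed (use intu in auto)
  interpret R: implicit_renewal M ?W "T i" ?V' "b $ i powr \<alpha> $ i"
  proof unfold_locales
    show "indep_var borel ?W borel (T i)"
      unfolding A_def T_def
      by (rule indep_var_Z0_X0[of "\<lambda>z. (b $ i + c $ i * z\<^sup>2) powr \<alpha> $ i" "\<lambda>x. (x $ i) powr \<alpha> $ i"]) measurable
    show "distr M borel ?V' = distr M borel (T i)"
      unfolding T_def by (rule nextX_law[of "\<lambda>x. (x $ i) powr \<alpha> $ i"]) measurable
    show "0 < expectation (\<lambda>w. ?V' w - ?W w * T i w)"
    proof -
      have "expectation (\<lambda>w. ?V' w - ?W w * T i w) \<ge> 0"
        by (intro Bochner_Integration.integral_nonneg) (use less in \<open>simp add: less_imp_le\<close>)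
      moreover have "expectation (\<lambda>w. ?V' w - ?W w * T i w) \<noteq> 0"
      proof
        assume "expectation (\<lambda>w. ?V' w - ?W w * T i w) = 0"
        then have "AE w in M. ?V' w - ?W w * T i w = 0"
          using gap less by (subst (asm) integral_nonneg_eq_0_iff_AE) (auto simp: less_imp_le)
        then have "AE w in M. False" by eventually_elim (use less in \<open>metis eq_iff_diff_eq_0 less_irrefl\<close>)
        then show False by simp
      qed
      ultimately show ?thesis by linarith
    qed
    show "integrable M (\<lambda>w. ?W w * ln (?W w))"
    proof (rule Bochner_Integration.integrable_bound[of _ "?d"])
      show "integrable M ?d"
        using A_powr_integrable[of "\<alpha> $ i" i] A_powr_integrable[of "\<alpha> $ i + 1" i] \<alpha>_pos[of i] by simp
      show "AE w in M. norm (?W w * ln (?W w)) \<le> norm (?d w)"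
      proof (rule AE_I2)
        fix w
        have "ln (b $ i) \<le> ln (A i w)" using A_ge[of i w] b_pos[of i] A_pos[of i w] by simp
        moreover have "ln (A i w) \<le> A i w" using ln_le_minus_one[OF A_pos[of i w]] by simp
        ultimately have "\<bar>ln (A i w)\<bar> \<le> \<bar>ln (b $ i)\<bar> + A i w" using A_pos[of i w] by linarith
        then have "A i w powr \<alpha> $ i * (\<alpha> $ i * \<bar>ln (A i w)\<bar>) \<le> A i w powr \<alpha> $ i * (\<alpha> $ i * (\<bar>ln (b $ i)\<bar> + A i w))"
          using \<alpha>_pos[of i] by (intro mult_left_mono) auto
        also have "\<dots> = ?d w"
          using A_pos[of i w] by (simp add: powr_add algebra_simps)
        finally show "norm (?W w * ln (?W w)) \<le> norm (?d w)"
          using A_pos[of i w] \<alpha>_pos[of i] by (simp add: ln_powr abs_mult)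
      qed
    qed measurable
    show "0 < b $ i powr \<alpha> $ i" "b $ i powr \<alpha> $ i < 1"
      using powr_less_mono2[OF \<alpha>_pos[of i] _ b_less_1[of i]] b_pos[of i] by simp_all
    show "0 < \<P>(w in M. \<bar>?W w - y\<bar> < \<eta>)" if "b $ i powr \<alpha> $ i < y" "0 < \<eta>" for y \<eta>
      using that by (rule A_powr_supp)
  qed (use gap less A_pos[of i] A_powr_integrable[of "\<alpha> $ i" i] A_powr_\<alpha>[of i] \<alpha>_pos[of i] in \<open>auto simp: T_nonneg less_imp_le less_imp_neq[THEN not_sym]\<close>)
  show ?thesis by (rule R.tail_asymptotics)
qed

end

section \<open>Exceedances of the norm\<close>

locale ccc_blocks = ccc_volatility M Z a b c \<alpha> X
  for M :: "'w measure" and Z and a b c \<alpha> :: "real^'d::finite" and X +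
  fixes r :: nat and I :: "nat \<Rightarrow> 'd set"
  assumes partition: "block_partition r I"
    and same_block: "(b $ i = b $ j \<and> c $ i = c $ j) \<longleftrightarrow> (\<exists>l\<in>{1..r}. i \<in> I l \<and> j \<in> I l)"
    and different_blocks: "\<lbrakk>l \<in> {1..r}; m \<in> {1..r}; l \<noteq> m; i \<in> I l; j \<in> I m\<rbrakk> \<Longrightarrow> \<alpha> $ i \<noteq> \<alpha> $ j"
begin

lemma block_nonempty: "l \<in> {1..r} \<Longrightarrow> I l \<noteq> {}"
  and block_cover: "\<exists>l\<in>{1..r}. i \<in> I l"
  using partition by (auto simp: block_partition_def)

text \<open>Indices of a block share the multiplier, and the multiplier determines the exponent:
  below the exponent all its moments are strictly less than 1.\<close>

lemma block_\<alpha>: "\<lbrakk>l \<in> {1..r}; i \<in> I l; j \<in> I l\<rbrakk> \<Longrightarrow> \<alpha> $ i = \<alpha> $ j"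
proof -
  assume l: "l \<in> {1..r}" and ij: "i \<in> I l" "j \<in> I l"
  have A_eq: "A i = A j" using same_block[of i j] l ij by (auto simp: A_def fun_eq_iff)
  have "\<not> \<alpha> $ i < \<alpha> $ j" using A_powr_moment_less_1[of "\<alpha> $ i" j] A_powr_\<alpha>[of i] \<alpha>_pos[of i] by (auto simp: A_eq)
  moreover have "\<not> \<alpha> $ j < \<alpha> $ i" using A_powr_moment_less_1[of "\<alpha> $ j" i] A_powr_\<alpha>[of j] \<alpha>_pos[of j] by (auto simp: A_eq)
  ultimately show ?thesis by linarith
qed

text \<open>An index where \<open>a\<close> is largest in the block. There \<open>q\<close> has the
  entry 1, and there \<open>T\<close> attains its maximum over the block on aligned points.\<close>

definition rep where "rep l = (SOME i. i \<in> I l \<and> a $ i = Max ((\<lambda>j. a $ j) ` I l))"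

lemma rep: assumes "l \<in> {1..r}" shows "rep l \<in> I l" "a $ rep l = Max ((\<lambda>j. a $ j) ` I l)"
proof -
  have "Max ((\<lambda>j. a $ j) ` I l) \<in> (\<lambda>j. a $ j) ` I l"
    using block_nonempty[OF assms] by (intro Max_in) auto
  then have "\<exists>i. i \<in> I l \<and> a $ i = Max ((\<lambda>j. a $ j) ` I l)" by auto
  from someI_ex[OF this] show "rep l \<in> I l" "a $ rep l = Max ((\<lambda>j. a $ j) ` I l)"
    by (auto simp: rep_def)
qed

definition q where "q l = q_vec a (I l)"

lemma q_nth: "l \<in> {1..r} \<Longrightarrow> q l $ i = (if i \<in> I l then a $ i / a $ rep l else 0)"
  by (simp add: q_def q_vec_def rep)

lemma a_le_rep: "\<lbrakk>l \<in> {1..r}; i \<in> I l\<rbrakk> \<Longrightarrow> a $ i \<le> a $ rep l"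
  by (simp add: rep)

definition peak where "peak l = T (rep l)"

lemma peak_measurable[measurable]: "peak l \<in> borel_measurable M" by (simp add: peak_def)

definition radius where "radius w = alpha_norm \<alpha> (X 0 w)"

lemma alpha_norm_measurable: "alpha_norm \<alpha> \<in> borel_measurable borel"
  unfolding alpha_norm_def[abs_def] by measurable

lemma radius_measurable[measurable]: "radius \<in> borel_measurable M"
  unfolding radius_def[abs_def] by (rule measurable_compose[OF X_measurable alpha_norm_measurable])

lemma radius_eq_Max_T: "radius w = Max (range (\<lambda>i. T i w))"
  by (simp add: radius_def alpha_norm_def T_def X_nonneg)

definition aligned where "aligned w \<longleftrightarrow> (\<forall>l\<in>{1..r}. \<forall>i\<in>I l. X 0 w $ i = a $ i / a $ rep l * X 0 w $ rep l)"

text \<open>Equal \<open>b\<close> and \<open>c\<close> give equal products \<open>P\<close>, so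
  within a block the causal series differ only by the factor \<open>a\<close>.\<close>

lemma aligned_AE: "AE w in M. aligned w"
proof -
  have "AE w in M. \<forall>i. X 0 w $ i = a $ i * (\<Sum>k. P i k w)"
    using X_causal by (simp add: AE_all_countable)
  then show ?thesis
  proof eventually_elim
    fix w assume *: "\<forall>i. X 0 w $ i = a $ i * (\<Sum>k. P i k w)"
    show "aligned w" unfolding aligned_def
    proof (intro ballI)
      fix l i assume l: "l \<in> {1..r}" "i \<in> I l"
      have "b $ i = b $ rep l \<and> c $ i = c $ rep l" using same_block rep(1)[OF l(1)] l by blast
      then have "P i k w = P (rep l) k w" for k by (simp add: P_def)
      then show "X 0 w $ i = a $ i / a $ rep l * X 0 w $ rep l"
        using *[rule_format, of i] *[rule_format, of "rep l"] a_pos[of "rep l"] by simp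
    qed
  qed
qed

lemma T_le_peak: assumes "aligned w" "l \<in> {1..r}" "i \<in> I l" shows "T i w \<le> peak l w"
proof -
  have "X 0 w $ i = a $ i / a $ rep l * X 0 w $ rep l" using assms by (auto simp: aligned_def)
  also have "\<dots> \<le> 1 * X 0 w $ rep l"
    using a_le_rep[OF assms(2,3)] a_pos[of "rep l"] X_nonneg by (intro mult_right_mono) auto
  finally have "X 0 w $ i \<le> X 0 w $ rep l" by simp
  then show ?thesis unfolding T_def peak_def
    using block_\<alpha>[OF assms(2,3) rep(1)[OF assms(2)]] \<alpha>_pos[of i] X_nonneg by (auto intro!: powr_mono2)
qed

lemma peak_le_radius: "peak l w \<le> radius w"
  unfolding radius_eq_Max_T peak_def by (intro Max_ge) auto

lemma radius_attained: assumes "aligned w" obtains l where "l \<in> {1..r}" "radius w = peak l w"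
proof -
  have "radius w \<in> range (\<lambda>i. T i w)" unfolding radius_eq_Max_T by (intro Max_in) auto
  then obtain i where i: "radius w = T i w" by auto
  obtain l where l: "l \<in> {1..r}" "i \<in> I l" using block_cover by blast
  show ?thesis using that[OF l(1)] i T_le_peak[OF assms l] peak_le_radius[of l w] by linarith
qed

section \<open>The scaled vector at an exceedance\<close>

definition \<theta> where "\<theta> w = vscale \<alpha> (radius w) (X 0 w)"
definition \<mu> where "\<mu> w = (\<chi> i. radius w powr (- 1 / \<alpha> $ i))"

text \<open>In block \<open>l\<close> alignment makes the scaled vector equal to \<open>q l\<close>
  exactly. Elsewhere a coordinate is at most \<open>(\<delta> * K) powr (1 / \<alpha> $ i)\<close>,
  and scaling divides it by at least \<open>K powr (1 / \<alpha> $ i)\<close>.\<close>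

lemma \<theta>_near_q:
  assumes g: "aligned w" and l: "l \<in> {1..r}" and K: "K > 0" and \<delta>: "0 < \<delta>" "\<delta> < 1"
    and Tl: "peak l w > K" and others: "\<And>m. m \<in> {1..r} \<Longrightarrow> m \<noteq> l \<Longrightarrow> peak m w \<le> \<delta> * K"
  shows "radius w = peak l w" and "\<bar>\<theta> w $ i - q l $ i\<bar> \<le> \<delta> powr (1 / \<alpha> $ i)" and "\<bar>\<mu> w $ i\<bar> \<le> K powr (- 1 / \<alpha> $ i)"
proof -
  obtain m where m: "m \<in> {1..r}" "radius w = peak m w" by (rule radius_attained[OF g])
  have "\<delta> * K < K" using K \<delta> by simp
  then have "m = l" using others[OF m(1)] m peak_le_radius[of l w] Tl by force
  then show N: "radius w = peak l w" using m by simp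
  have NK: "radius w > K" using N Tl by simp
  then have NKp: "radius w powr (- 1 / \<alpha> $ i) \<le> K powr (- 1 / \<alpha> $ i)"
    using K \<alpha>_pos[of i] by (intro powr_mono2') auto
  then show "\<bar>\<mu> w $ i\<bar> \<le> K powr (- 1 / \<alpha> $ i)" by (simp add: \<mu>_def)
  show "\<bar>\<theta> w $ i - q l $ i\<bar> \<le> \<delta> powr (1 / \<alpha> $ i)"
  proof (cases "i \<in> I l")
    case True
    let ?x = "X 0 w $ rep l"
    have \<alpha>: "\<alpha> $ i = \<alpha> $ rep l" using block_\<alpha>[OF l True rep(1)[OF l]] .
    have "?x powr \<alpha> $ rep l > 0" using Tl K unfolding peak_def T_def by linarith
    then have x: "?x > 0" using X_nonneg[of 0 w "rep l"] by (cases "?x = 0") auto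
    have "radius w powr (- 1 / \<alpha> $ i) = 1 / ?x"
      using x \<alpha>_pos[of "rep l"] by (simp add: N peak_def T_def \<alpha> powr_powr powr_minus_divide)
    moreover have "X 0 w $ i = a $ i / a $ rep l * ?x" using g l True by (auto simp: aligned_def)
    ultimately have "\<theta> w $ i = q l $ i" using x True by (simp add: \<theta>_def vscale_def q_nth[OF l])
    then show ?thesis by simp
  next
    case False
    obtain m where m: "m \<in> {1..r}" "i \<in> I m" using block_cover by blast
    then have "m \<noteq> l" using False by auto
    have "T i w \<le> \<delta> * K" using T_le_peak[OF g m] others[OF m(1) \<open>m \<noteq> l\<close>] by linarith
    then have "(T i w) powr (1 / \<alpha> $ i) \<le> (\<delta> * K) powr (1 / \<alpha> $ i)"
      using \<alpha>_pos[of i] T_nonneg by (intro powr_mono2) auto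
    moreover have "(T i w) powr (1 / \<alpha> $ i) = X 0 w $ i"
      using \<alpha>_pos[of i] X_nonneg[of 0 w i] by (simp add: T_def powr_powr)
    ultimately have "X 0 w $ i \<le> \<delta> powr (1 / \<alpha> $ i) * K powr (1 / \<alpha> $ i)"
      using \<delta> K by (simp add: powr_mult)
    then have "radius w powr (- 1 / \<alpha> $ i) * X 0 w $ i \<le> K powr (- 1 / \<alpha> $ i) * (\<delta> powr (1 / \<alpha> $ i) * K powr (1 / \<alpha> $ i))"
      using NKp X_nonneg by (intro mult_mono) auto
    also have "\<dots> = \<delta> powr (1 / \<alpha> $ i)"
      using K by (simp add: powr_add[symmetric] mult.left_commute)
    finally show ?thesis using False X_nonneg[of 0 w i] by (simp add: \<theta>_def vscale_def q_nth[OF l] abs_mult)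
  qed
qed

definition \<kappa> where "\<kappa> l = (SOME k. k > 0 \<and> ((\<lambda>x. x * \<P>(w in M. peak l w > x)) \<longlongrightarrow> k) at_top)"

lemma \<kappa>: "\<kappa> l > 0" "((\<lambda>x. x * \<P>(w in M. peak l w > x)) \<longlongrightarrow> \<kappa> l) at_top"
  using someI_ex[OF coordinate_tail[of "rep l"]] by (auto simp: \<kappa>_def peak_def)

lemma joint_exceedance:
  assumes "l \<in> {1..r}" "m \<in> {1..r}" "l \<noteq> m" "\<delta> > 0"
  shows "((\<lambda>x. x * \<P>(w in M. peak l w > \<delta> * x \<and> peak m w > \<delta> * x)) \<longlongrightarrow> 0) at_top"
proof -
  have "\<alpha> $ rep l \<noteq> \<alpha> $ rep m" using different_blocks assms rep by blast
  from asymptotic_independence[OF this]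
  have "((\<lambda>x. x * \<P>(w in M. peak l w > x \<and> peak m w > x)) \<longlongrightarrow> 0) at_top" by (simp add: peak_def)
  moreover have "filterlim (\<lambda>x. \<delta> * x) at_top at_top"
    using assms(4) by (intro filterlim_tendsto_pos_mult_at_top[OF tendsto_const _ filterlim_ident])
  ultimately have "((\<lambda>x. (\<delta> * x) * \<P>(w in M. peak l w > \<delta> * x \<and> peak m w > \<delta> * x)) \<longlongrightarrow> 0) at_top"
    by (rule filterlim_compose)
  from tendsto_mult_left[OF this, of "1 / \<delta>"] assms(4) show ?thesis by simp
qed

text \<open>The integrand is compared with the sum over \<open>l\<close> of
  \<open>h (q l, 0)\<close> times the indicator of \<open>peak l > x\<close>. Unless two peaks
  exceed \<open>\<delta> * x\<close>, at most one indicator is nonzero and, at an exceedance, the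
  argument of \<open>h\<close> is near the corresponding \<open>(q l, 0)\<close>. Two such peaks
  occur with probability of smaller order than 1/x.\<close>

lemma exceedance_limit:
  fixes h :: "(real^'d) \<times> (real^'d) \<Rightarrow> real"
  assumes meas: "(\<lambda>w. h (\<theta> w, \<mu> w)) \<in> borel_measurable M"
    and B: "\<And>p. \<bar>h p\<bar> \<le> B" and cont: "\<And>l. l \<in> {1..r} \<Longrightarrow> isCont h (q l, 0)"
  shows "((\<lambda>x. x * expectation (\<lambda>w. indicator {w. radius w > x} w * h (\<theta> w, \<mu> w))) \<longlongrightarrow> (\<Sum>l\<in>{1..r}. \<kappa> l * h (q l, 0))) at_top"
proof -
  note [measurable] = meas
  let ?R = "{1..r}"
  have B0: "B \<ge> 0" using B[of undefined] by linarith
  define E where "E x = expectation (\<lambda>w. indicator {w. radius w > x} w * h (\<theta> w, \<mu> w))" for x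
  define S where "S x = (\<Sum>l\<in>?R. x * \<P>(w in M. peak l w > x) * h (q l, 0))" for x
  have S: "(S \<longlongrightarrow> (\<Sum>l\<in>?R. \<kappa> l * h (q l, 0))) at_top"
    unfolding S_def by (intro tendsto_intros \<kappa>)
  have diff: "((\<lambda>x. x * E x - S x) \<longlongrightarrow> 0) at_top"
  proof (rule tendstoI)
    fix e :: real assume e: "e > 0"
    \<comment> \<open>The exceedances carry the limiting mass given by the sum of the
      \<open>\<kappa> l\<close>, so this choice keeps their error below \<open>e / 2\<close>; the
      added 1 secures a positive denominator.\<close>
    define \<epsilon> where "\<epsilon> = e / 2 / ((\<Sum>l\<in>?R. \<kappa> l) + 1)"
    have ks: "(\<Sum>l\<in>?R. \<kappa> l) \<ge> 0" using \<kappa>(1) by (intro sum_nonneg) (auto simp: less_imp_le)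
    have \<epsilon>: "\<epsilon> > 0" using e ks by (simp add: \<epsilon>_def)
    have "\<forall>l\<in>?R. \<exists>\<eta>>0. \<forall>p. dist p (q l, 0) < \<eta> \<longrightarrow> dist (h p) (h (q l, 0)) < \<epsilon>"
      using cont \<epsilon> unfolding continuous_at_eps_delta by blast
    then obtain \<eta>f where \<eta>f: "\<And>l. l \<in> ?R \<Longrightarrow> \<eta>f l > 0" "\<And>l p. l \<in> ?R \<Longrightarrow> dist p (q l, 0) < \<eta>f l \<Longrightarrow> dist (h p) (h (q l, 0)) < \<epsilon>"
      by metis
    define \<eta> where "\<eta> = Min (insert 1 (\<eta>f ` ?R))"
    have \<eta>: "\<eta> > 0" "\<And>l. l \<in> ?R \<Longrightarrow> \<eta> \<le> \<eta>f l"
    proof -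
      show "\<eta> > 0" using \<eta>f(1) by (auto simp: \<eta>_def)
      show "\<eta> \<le> \<eta>f l" if "l \<in> ?R" for l unfolding \<eta>_def by (rule Min_le) (use that in auto)
    qed
    have "((\<lambda>\<delta>::real. \<Sum>i\<in>UNIV. \<delta> powr (1 / \<alpha> $ i)) \<longlongrightarrow> (\<Sum>i\<in>(UNIV::'d set). 0 powr (1 / \<alpha> $ i))) (at_right 0)"
      by (intro tendsto_intros tendsto_powr') (auto simp: \<alpha>_pos eventually_at_filter intro!: always_eventually)
    then have "\<forall>\<^sub>F \<delta> in at_right 0. (\<Sum>i\<in>UNIV. \<delta> powr (1 / \<alpha> $ i)) < \<eta> / 2 \<and> 0 < \<delta> \<and> \<delta> < (1::real)"
      using \<eta> by (intro eventually_conj order_tendstoD eventually_at_right_less eventually_at_rightI[of 0 1]) auto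
    then obtain \<delta> where \<delta>: "(\<Sum>i\<in>UNIV. \<delta> powr (1 / \<alpha> $ i)) < \<eta> / 2" "0 < \<delta>" "\<delta> < 1"
      by (auto dest!: eventually_happens)
    have "((\<lambda>x::real. \<Sum>i\<in>UNIV. x powr (- 1 / \<alpha> $ i)) \<longlongrightarrow> (\<Sum>i\<in>(UNIV::'d set). 0)) at_top"
      by (intro tendsto_intros tendsto_neg_powr filterlim_ident) (simp add: \<alpha>_pos)
    then have evK: "\<forall>\<^sub>F x in at_top. (\<Sum>i\<in>UNIV. x powr (- 1 / \<alpha> $ i)) < \<eta> / 2"
      using \<eta> by (intro order_tendstoD) auto
    define Pr where "Pr = {(l,m). l \<in> ?R \<and> m \<in> ?R \<and> l \<noteq> m}"
    define bad where "bad x = (\<Sum>(l,m)\<in>Pr. x * \<P>(w in M. peak l w > \<delta> * x \<and> peak m w > \<delta> * x))" for x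
    have finPr: "finite Pr" unfolding Pr_def
      by (rule finite_subset[of _ "?R \<times> ?R"]) auto
    have "(bad \<longlongrightarrow> (\<Sum>(l,m)\<in>Pr. 0)) at_top"
      unfolding bad_def by (rule tendsto_sum) (auto simp: Pr_def intro!: joint_exceedance \<delta>(2))
    then have bad: "(bad \<longlongrightarrow> 0) at_top" by simp
    have "((\<lambda>x. \<epsilon> * (\<Sum>l\<in>?R. x * \<P>(w in M. peak l w > x)) + (B + r * B) * bad x) \<longlongrightarrow> \<epsilon> * (\<Sum>l\<in>?R. \<kappa> l) + (B + r * B) * 0) at_top"
      by (intro tendsto_intros bad \<kappa>)
    moreover have "\<epsilon> * (\<Sum>l\<in>?R. \<kappa> l) < e"
      using e ks by (simp add: \<epsilon>_def field_simps add_pos_nonneg)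
    ultimately have "\<forall>\<^sub>F x in at_top. \<epsilon> * (\<Sum>l\<in>?R. x * \<P>(w in M. peak l w > x)) + (B + r * B) * bad x < e"
      by (intro order_tendstoD) auto
    then show "\<forall>\<^sub>F x in at_top. dist (x * E x - S x) 0 < e"
      using evK eventually_gt_at_top[of 0]
    proof eventually_elim
      fix x :: real assume x1: "\<epsilon> * (\<Sum>l\<in>?R. x * \<P>(w in M. peak l w > x)) + (B + r * B) * bad x < e"
        and xK: "(\<Sum>i\<in>UNIV. x powr (- 1 / \<alpha> $ i)) < \<eta> / 2" and x: "0 < x"
      let ?H = "\<lambda>w. indicator {w. radius w > x} w * h (\<theta> w, \<mu> w)"
      define ex where "ex l w = (indicator {w\<in>space M. peak l w > x} w :: real)" for l w
      define jx where "jx p w = (indicator {w\<in>space M. peak (fst p) w > \<delta> * x \<and> peak (snd p) w > \<delta> * x} w :: real)" for p w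
      let ?L = "\<lambda>w. \<Sum>l\<in>?R. ex l w * h (q l, 0)"
      \<comment> \<open>Where two peaks are large, only the trivial bounds remain: \<open>B\<close>
        for \<open>?H\<close> and \<open>r * B\<close> for \<open>?L\<close>.\<close>
      let ?U = "\<lambda>w. \<epsilon> * (\<Sum>l\<in>?R. ex l w) + (B + r * B) * (\<Sum>p\<in>Pr. jx p w)"
      have int_ex: "integrable M (ex l)" for l unfolding ex_def by (intro integrable_real_indicator) (auto simp: emeasure_eq_measure)
      have int_jx: "integrable M (jx p)" for p unfolding jx_def by (intro integrable_real_indicator) (auto simp: emeasure_eq_measure)
      have E_ex: "expectation (ex l) = \<P>(w in M. peak l w > x)" for l unfolding ex_def[abs_def] by simp
      have E_jx: "expectation (jx p) = \<P>(w in M. peak (fst p) w > \<delta> * x \<and> peak (snd p) w > \<delta> * x)" for p unfolding jx_def[abs_def] by simp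
      have int_E: "integrable M ?H"
      proof (rule integrable_bounded[of _ B])
        have "(\<lambda>w. (if radius w > x then 1 else 0) * h (\<theta> w, \<mu> w)) \<in> borel_measurable M" by measurable
        then show "?H \<in> borel_measurable M"
          by (simp add: indicator_def if_distrib cong: if_cong)
        show "\<bar>?H w\<bar> \<le> B" for w
          using B B0 by (simp add: indicator_def)
      qed
      have pw: "AE w in M. \<bar>?H w - ?L w\<bar> \<le> ?U w"
        using aligned_AE AE_space
      proof eventually_elim
        fix w assume g: "aligned w" and w: "w \<in> space M"
        have ex0: "ex l w \<ge> 0" "ex l w \<le> 1" for l by (auto simp: ex_def)
        have jx0: "jx p w \<ge> 0" for p by (simp add: jx_def)
        have sex0: "\<epsilon> * (\<Sum>l\<in>?R. ex l w) \<ge> 0" using \<epsilon> ex0 by (simp add: sum_nonneg)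
        show "\<bar>?H w - ?L w\<bar> \<le> ?U w"
        proof (cases "\<exists>p\<in>Pr. jx p w = 1")
          case True
          then obtain p where p: "p \<in> Pr" "jx p w = 1" by auto
          have "1 \<le> (\<Sum>p\<in>Pr. jx p w)"
            using member_le_sum[OF p(1), of "\<lambda>p. jx p w"] p(2) jx0 finPr by simp
          then have "(B + r * B) * 1 \<le> (B + r * B) * (\<Sum>p\<in>Pr. jx p w)" using B0 by (intro mult_left_mono) auto
          moreover have "\<bar>\<Sum>l\<in>?R. ex l w * h (q l, 0)\<bar> \<le> (\<Sum>l\<in>?R. B)"
            using B ex0 by (intro order_trans[OF sum_abs] sum_mono) (auto simp: abs_mult intro: order_trans[OF mult_left_le_one_le])
          moreover have "\<bar>?H w\<bar> \<le> B" using B B0 by (simp add: indicator_def)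
          ultimately show ?thesis using sex0 by simp
        next
          case False
          have sj: "(\<Sum>p\<in>Pr. jx p w) = 0"
            using False by (intro sum.neutral) (auto simp: jx_def indicator_def)
          show ?thesis
          proof (cases "\<exists>l\<in>?R. peak l w > x")
            case no: False
            obtain l where "l \<in> ?R" "radius w = peak l w" by (rule radius_attained[OF g])
            then have "\<not> radius w > x" using no by auto
            moreover have "ex l w = 0" if "l \<in> ?R" for l using no that by (simp add: ex_def)
            ultimately show ?thesis by (simp add: sj)
          next
            case True
            then obtain l where l: "l \<in> ?R" "peak l w > x" by auto
            have dx: "\<delta> * x < x" using \<delta> x by simp
            have oth: "peak m w \<le> \<delta> * x" if m: "m \<in> ?R" "m \<noteq> l" for m
            proof (rule ccontr)
              assume "\<not> ?thesis"
              then have "jx (l, m) w = 1" using w l dx by (simp add: jx_def)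
              moreover have "(l, m) \<in> Pr" using l m by (simp add: Pr_def)
              ultimately show False using False by blast
            qed
            note near = \<theta>_near_q[OF g l(1) x \<delta>(2,3) l(2) oth]
            have exm: "ex m w = (if m = l then 1 else 0)" if "m \<in> ?R" for m
              using oth[OF that] l dx w by (auto simp: ex_def)
            have s1: "(\<Sum>m\<in>?R. ex m w * g' m) = g' l" for g'
            proof -
              have "(\<Sum>m\<in>?R. ex m w * g' m) = (\<Sum>m\<in>?R. if m = l then g' m else 0)"
                by (rule sum.cong) (auto simp: exm)
              then show ?thesis using l(1) by simp
            qed
            have "norm (\<theta> w - q l) \<le> (\<Sum>i\<in>UNIV. \<bar>(\<theta> w - q l) $ i\<bar>)" by (rule norm_le_l1_cart)
            also have "\<dots> \<le> (\<Sum>i\<in>UNIV. \<delta> powr (1 / \<alpha> $ i))" by (rule sum_mono) (use near(2) in simp)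
            finally have n1: "norm (\<theta> w - q l) < \<eta> / 2" using \<delta>(1) by linarith
            have "norm (\<mu> w) \<le> (\<Sum>i\<in>UNIV. \<bar>\<mu> w $ i\<bar>)" by (rule norm_le_l1_cart)
            also have "\<dots> \<le> (\<Sum>i\<in>UNIV. x powr (- 1 / \<alpha> $ i))" by (rule sum_mono) (use near(3) in simp)
            finally have n2: "norm (\<mu> w) < \<eta> / 2" using xK by linarith
            have "dist (\<theta> w, \<mu> w) (q l, 0) \<le> norm (\<theta> w - q l) + norm (\<mu> w)"
              using norm_Pair_le[of "\<theta> w - q l" "\<mu> w"] by (simp add: dist_norm)
            also have "\<dots> < \<eta>f l" using n1 n2 \<eta>(2)[OF l(1)] by linarith
            finally have "dist (h (\<theta> w, \<mu> w)) (h (q l, 0)) < \<epsilon>" by (rule \<eta>f(2)[OF l(1)])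
            then show ?thesis
              using s1[of "\<lambda>m. h (q m, 0)"] s1[of "\<lambda>_. 1"] near(1) l(2) by (simp add: sj dist_real_def)
          qed
        qed
      qed
      have int_S: "integrable M ?L" using int_ex by simp
      have int_U: "integrable M ?U" using int_ex int_jx by simp
      have "S x = x * expectation ?L"
        using int_ex by (simp add: S_def E_ex sum_distrib_left mult.assoc)
      then have "x * E x - S x = x * expectation (\<lambda>w. ?H w - ?L w)"
        using int_E int_S by (simp add: E_def right_diff_distrib)
      also have "\<bar>\<dots>\<bar> \<le> x * expectation ?U"
      proof -
        have "\<bar>expectation (\<lambda>w. ?H w - ?L w)\<bar>
           \<le> expectation (\<lambda>w. \<bar>?H w - ?L w\<bar>)"
          by (rule integral_abs_bound)
        also have "\<dots> \<le> expectation ?U"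
          by (rule integral_mono_AE[OF _ int_U pw]) (use int_E int_S in auto)
        finally show ?thesis using x by (simp add: abs_mult)
      qed
      also have "\<dots> = \<epsilon> * (\<Sum>l\<in>?R. x * \<P>(w in M. peak l w > x)) + (B + r * B) * bad x"
      proof -
        define Jp where "Jp p = \<P>(w in M. peak (fst p) w > \<delta> * x \<and> peak (snd p) w > \<delta> * x)" for p
        have "bad x = x * (\<Sum>p\<in>Pr. Jp p)"
          unfolding bad_def by (simp add: split_beta Jp_def sum_distrib_left)
        moreover have "expectation ?U =
           \<epsilon> * (\<Sum>l\<in>?R. \<P>(w in M. peak l w > x)) + (B + r * B) * (\<Sum>p\<in>Pr. Jp p)"
          using int_ex int_jx by (simp add: E_ex E_jx Jp_def)
        ultimately show ?thesis by (simp add: sum_distrib_left[symmetric] distrib_left mult_ac)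
      qed
      finally show "dist (x * E x - S x) 0 < e" using x1 by (simp add: dist_real_def)
    qed
  qed
  from tendsto_add[OF diff S] show ?thesis by (simp add: E_def)
qed

end

section \<open>Convergence of the scaled path\<close>

text \<open>The path of the volatility after scaling: \<open>\<theta>\<close> is the scaled initial value, and \<open>\<mu>\<close> are the
  scaling factors themselves, which tend to zero. The noise is indexed so that \<open>z s\<close> drives the step
  from \<open>s\<close> to \<open>s + 1\<close>, one less than in \<^const>\<open>tail_recursion\<close>.\<close>

primrec affine_path :: "real^'d::finite \<Rightarrow> real^'d \<Rightarrow> real^'d \<Rightarrow> real^'d \<Rightarrow> real^'d \<Rightarrow> (nat \<Rightarrow> real) \<Rightarrow> nat \<Rightarrow> real^'d" where
  "affine_path a b c \<theta> \<mu> z 0 = \<theta>"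
| "affine_path a b c \<theta> \<mu> z (Suc s) = (\<chi> i. (b $ i + c $ i * (z s)\<^sup>2) * affine_path a b c \<theta> \<mu> z s $ i + \<mu> $ i * a $ i)"

lemma Diag_mult_vec: "Diag v *v x = (\<chi> i. v $ i * x $ i)"
proof -
  have "(\<Sum>j\<in>UNIV. (if i = j then v $ i else 0) * x $ j) = v $ i * x $ i" for i
  proof -
    have "(\<Sum>j\<in>UNIV. (if i = j then v $ i else 0) * x $ j) = (\<Sum>j\<in>UNIV. if i = j then v $ i * x $ j else 0)"
      by (rule sum.cong) auto
    then show ?thesis by simp
  qed
  then show ?thesis by (simp add: Diag_def matrix_vector_mult_def vec_eq_iff)
qed

lemma tail_recursion_eq_affine_path:
  "tail_recursion b c \<theta> z s = affine_path a b c \<theta> 0 (\<lambda>k. z (Suc k)) s"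
  by (induction s) (auto simp: Diag_mult_vec vec_eq_iff)

lemma continuous_on_affine_path:
  "continuous_on UNIV (\<lambda>p. affine_path a b c (fst p) (snd p) z s)"
proof (induction s)
  case (Suc s)
  then show ?case by (auto intro!: continuous_intros)
qed (auto intro!: continuous_intros)

lemma measurable_affine_path:
  assumes [measurable]: "\<theta> \<in> borel_measurable N" "\<mu> \<in> borel_measurable N" and z[measurable]: "\<And>k. (\<lambda>x. z x k) \<in> borel_measurable N"
  shows "(\<lambda>x. affine_path a b c (\<theta> x) (\<mu> x) (z x) s) \<in> borel_measurable N"
proof (induction s)
  case (Suc s)
  note [measurable] = Suc
  show ?case unfolding affine_path.simps by (rule borel_measurable_vec_lambda) measurable
qed simp

text \<open>\<open>f\<close> is continuous on extensional functions only. Composition with the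
  restriction map extends it to all functions, where the product and Borel sigma-algebras coincide.
  The extensional functions embed measurably, since coordinates beyond \<open>t\<close> are
  constantly \<open>undefined\<close>.\<close>

lemma continuous_imp_measurable_PiM:
  fixes f :: "(nat \<Rightarrow> 'a::second_countable_topology) \<Rightarrow> real"
  assumes f: "continuous_on (space (\<Pi>\<^sub>M s\<in>{..t}. (borel :: 'a measure))) f"
  shows "f \<in> borel_measurable (\<Pi>\<^sub>M s\<in>{..t}. borel)"
proof -
  let ?S = "space (\<Pi>\<^sub>M s\<in>{..t}. (borel :: 'a measure))"
  have S: "?S = (\<Pi>\<^sub>E s\<in>{..t}. UNIV)" by (simp add: space_PiM)
  have r: "continuous_on UNIV (\<lambda>y::nat \<Rightarrow> 'a. restrict y {..t})"
  proof (rule continuous_on_coordinatewise_then_product)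
    fix i show "continuous_on UNIV (\<lambda>y::nat \<Rightarrow> 'a. restrict y {..t} i)"
      by (cases "i \<le> t") (auto intro!: continuous_intros)
  qed
  have "continuous_on UNIV (\<lambda>y. f (restrict y {..t}))"
    by (rule continuous_on_compose2[OF f r]) (simp add: S image_subset_iff PiE_iff)
  then have "(\<lambda>y. f (restrict y {..t})) \<in> borel_measurable borel"
    by (rule borel_measurable_continuous_onI)
  then have g: "(\<lambda>y. f (restrict y {..t})) \<in> borel_measurable (\<Pi>\<^sub>M s\<in>UNIV. borel)"
    by (simp cong: measurable_cong_sets add: sets_PiM_equal_borel)
  have e: "(\<lambda>y. y) \<in> measurable (\<Pi>\<^sub>M s\<in>{..t}. borel) (\<Pi>\<^sub>M s\<in>UNIV. (borel :: 'a measure))"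
  proof (rule measurable_PiM_single')
    fix i :: nat
    show "(\<lambda>y. y i) \<in> measurable (\<Pi>\<^sub>M s\<in>{..t}. borel) (borel :: 'a measure)"
    proof (cases "i \<le> t")
      case True then show ?thesis by (intro measurable_component_singleton) simp
    next
      case False
      have undef: "y i = undefined" if "y \<in> ?S" for y
        using PiE_arb[OF that[unfolded S], of i] False by simp
      have "(\<lambda>y. y i) \<in> measurable (\<Pi>\<^sub>M s\<in>{..t}. borel) (borel :: 'a measure) \<longleftrightarrow>
          (\<lambda>_. undefined) \<in> measurable (\<Pi>\<^sub>M s\<in>{..t}. (borel :: 'a measure)) (borel :: 'a measure)"
        by (rule measurable_cong) (rule undef)
      then show ?thesis by (rule iffD2) (rule measurable_const, simp)
    qed
  qed (simp add: space_PiM)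
  have "(\<lambda>y. f (restrict y {..t})) \<in> borel_measurable (\<Pi>\<^sub>M s\<in>{..t}. borel)"
    by (rule measurable_compose[OF e g])
  moreover have "f (restrict y {..t}) = f y" if "y \<in> ?S" for y
    using that by (auto simp: S PiE_restrict)
  ultimately show ?thesis by (simp cong: measurable_cong)
qed

section \<open>Conditioning, and measures determined by their integrals\<close>

lemma (in prob_space) integral_uniform_measure:
  fixes f :: "'a \<Rightarrow> real"
  assumes A[measurable]: "A \<in> events" and pos: "prob A > 0" and f[measurable]: "f \<in> borel_measurable M"
  shows "(\<integral>w. f w \<partial>uniform_measure M A) = expectation (\<lambda>w. indicator A w * f w) / prob A"
proof -
  have "uniform_measure M A = density M (\<lambda>w. ennreal (indicator A w / prob A))"
    unfolding uniform_measure_def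
    by (rule arg_cong[of _ _ "density M"]) (use pos in \<open>auto simp: fun_eq_iff emeasure_eq_measure indicator_def divide_ennreal[symmetric]\<close>)
  then have "(\<integral>w. f w \<partial>uniform_measure M A) = expectation (\<lambda>w. (indicator A w / prob A) *\<^sub>R f w)"
    using integral_density[of f M "\<lambda>w. indicator A w / prob A"] by simp
  then show ?thesis by simp
qed

text \<open>The indicator of an open set is the limit of \<open>min 1\<close> of \<open>n\<close>
  times the distance to the complement, and open sets form an intersection-stable generator. The
  whole space is treated apart because \<open>infdist\<close> to the empty set is 0.\<close>

lemma measure_eqI_bounded_continuous:
  fixes M N :: "'a::metric_space measure"
  assumes M: "finite_measure M" "sets M = sets borel" and N: "finite_measure N" "sets N = sets borel"
    and eq: "\<And>g :: 'a \<Rightarrow> real. continuous_on UNIV g \<Longrightarrow> bounded (range g) \<Longrightarrow> (\<integral>x. g x \<partial>M) = (\<integral>x. g x \<partial>N)"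
  shows "M = N"
proof -
  interpret M: finite_measure M by fact
  interpret N: finite_measure N by fact
  have meas[measurable]: "g \<in> borel_measurable M" "g \<in> borel_measurable N" if "g \<in> borel_measurable borel" for g :: "'a \<Rightarrow> real"
    using that M N by (simp_all cong: measurable_cong_sets)
  have open_eq: "emeasure M U = emeasure N U" if U: "open U" for U
  proof (cases "U = UNIV")
    case True
    have "measure M (space M) = measure N (space N)"
      using eq[of "\<lambda>_. 1"] by simp
    moreover have "space M = UNIV" "space N = UNIV" using M N sets_eq_imp_space_eq by (metis space_borel)+
    ultimately show ?thesis using True by (simp add: M.emeasure_eq_measure N.emeasure_eq_measure)
  next
    case False
    then have ne: "- U \<noteq> {}" by auto
    have cl: "closed (- U)" using U by auto
    define g where "g n x = min 1 (real n * infdist x (- U))" for n x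
    have g_cont: "continuous_on UNIV (g n)" for n
      unfolding g_def by (intro continuous_intros)
    have g_bd: "\<bar>g n x\<bar> \<le> 1" for n x by (simp add: g_def infdist_nonneg)
    have g_lim: "(\<lambda>n. g n x) \<longlonglongrightarrow> indicator U x" for x
    proof (cases "x \<in> U")
      case True
      then have pos: "infdist x (- U) > 0"
        using in_closed_iff_infdist_zero[OF cl ne, of x] infdist_nonneg[of x "- U"] by auto
      obtain n0 :: nat where n0: "1 / infdist x (- U) \<le> n0" using real_arch_simple by blast
      have "\<forall>\<^sub>F n in sequentially. g n x = indicator U x"
        using eventually_ge_at_top[of n0]
      proof eventually_elim
        fix n assume "n0 \<le> n"
        then have "1 / infdist x (- U) \<le> real n" using n0 by linarith
        then show "g n x = indicator U x" using pos True by (simp add: g_def field_simps)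
      qed
      then show ?thesis by (rule tendsto_eventually)
    next
      case False
      then have "infdist x (- U) = 0" by simp
      then show ?thesis using False by (simp add: g_def)
    qed
    have Ub: "U \<in> sets borel" using U by simp
    have lim: "(\<lambda>n. \<integral>x. g n x \<partial>Q) \<longlonglongrightarrow> measure Q U" if Q: "finite_measure Q" "sets Q = sets borel" for Q
    proof -
      interpret Q: finite_measure Q by fact
      have "(\<lambda>n. \<integral>x. g n x \<partial>Q) \<longlonglongrightarrow> (\<integral>x. indicator U x \<partial>Q)"
      proof (rule integral_dominated_convergence[where w="\<lambda>_. 1"])
        show "g n \<in> borel_measurable Q" for n
          unfolding measurable_cong_sets[OF Q(2) refl] by (rule borel_measurable_continuous_onI[OF g_cont])
        show "(indicator U :: 'a \<Rightarrow> real) \<in> borel_measurable Q" using Q Ub by simp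
        show "AE x in Q. (\<lambda>n. g n x) \<longlonglongrightarrow> indicator U x" using g_lim by (intro AE_I2)
        show "AE x in Q. norm (g n x) \<le> 1" for n using g_bd by (intro AE_I2) simp
      qed simp
      then show ?thesis using Q Ub sets.sets_into_space[of U Q] by (simp add: Int_absorb2)
    qed
    have "(\<integral>x. g n x \<partial>M) = (\<integral>x. g n x \<partial>N)" for n
      by (rule eq[OF g_cont]) (use g_bd in \<open>auto simp: bounded_iff intro!: exI[of _ 1]\<close>)
    then have "measure M U = measure N U"
      using lim[OF M] lim[OF N] LIMSEQ_unique by simp
    then show ?thesis by (simp add: M.emeasure_eq_measure N.emeasure_eq_measure)
  qed
  show ?thesis
  proof (rule measure_eqI_generator_eq[where E="Collect open" and \<Omega>=UNIV and A="\<lambda>_. UNIV"])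
    show "Int_stable (Collect (open :: 'a set \<Rightarrow> bool))" by (auto simp: Int_stable_def)
    show "sets M = sigma_sets UNIV (Collect open)" "sets N = sigma_sets UNIV (Collect open)"
      using M N by (simp_all add: borel_def)
  qed (use open_eq M.emeasure_finite in auto)
qed

text \<open>In the product topology a path is the limit of its truncations \<open>tr t\<close>, set
  to 0 after time \<open>t\<close>; a function of \<open>tr t\<close> sees only the restriction to
  \<open>{..t}\<close>.\<close>

lemma measure_eqI_finite_marginals:
  fixes \<nu> \<nu>' :: "(nat \<Rightarrow> 'a::{metric_space,second_countable_topology,zero}) measure"
  assumes \<nu>: "prob_space \<nu>" "sets \<nu> = sets (\<Pi>\<^sub>M t\<in>UNIV. borel)"
    and \<nu>': "prob_space \<nu>'" "sets \<nu>' = sets (\<Pi>\<^sub>M t\<in>UNIV. borel)"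
    and eq: "\<And>t (f :: (nat \<Rightarrow> 'a) \<Rightarrow> real). continuous_on UNIV f \<Longrightarrow> bounded (range f) \<Longrightarrow>
        (\<integral>\<theta>. f (restrict \<theta> {..t}) \<partial>\<nu>) = (\<integral>\<theta>. f (restrict \<theta> {..t}) \<partial>\<nu>')"
  shows "\<nu> = \<nu>'"
proof (rule measure_eqI_bounded_continuous)
  show s: "sets \<nu> = sets borel" "sets \<nu>' = sets borel"
    using \<nu> \<nu>' by (simp_all add: sets_PiM_equal_borel)
  show "finite_measure \<nu>" "finite_measure \<nu>'" using \<nu> \<nu>' by (auto simp: prob_space_def)
  fix g :: "(nat \<Rightarrow> 'a) \<Rightarrow> real" assume g: "continuous_on UNIV g" and bd: "bounded (range g)"
  obtain B where B: "\<And>x. \<bar>g x\<bar> \<le> B" using bd by (auto simp: bounded_iff)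
  define tr where "tr t y = (\<lambda>k. if k \<le> t then y k else 0)" for t and y :: "nat \<Rightarrow> 'a"
  have tr_cont: "continuous_on UNIV (tr t)" for t
  proof (rule continuous_on_coordinatewise_then_product)
    fix i show "continuous_on UNIV (\<lambda>y. tr t y i)" by (cases "i \<le> t") (auto simp: tr_def intro!: continuous_intros)
  qed
  have gt_cont: "continuous_on UNIV (\<lambda>y. g (tr t y))" for t
    by (rule continuous_on_compose2[OF g tr_cont]) auto
  have tr_lim: "(\<lambda>t. tr t y) \<longlonglongrightarrow> y" for y
  proof -
    have "limitin (product_topology (\<lambda>_. euclidean) UNIV) (\<lambda>t. tr t y) y sequentially"
      unfolding limitin_componentwise
    proof (intro conjI ballI)
      fix i
      have "\<forall>\<^sub>F t in sequentially. tr t y i = y i"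
        using eventually_ge_at_top[of i] by eventually_elim (simp add: tr_def)
      then show "limitin euclidean (\<lambda>t. tr t y i) (y i) sequentially"
        by (simp add: tendsto_eventually)
    qed auto
    then show ?thesis by (simp add: euclidean_product_topology)
  qed
  have lim: "(\<lambda>t. \<integral>y. g (tr t y) \<partial>Q) \<longlonglongrightarrow> (\<integral>y. g y \<partial>Q)" if Q: "prob_space Q" "sets Q = sets borel" for Q
  proof (rule integral_dominated_convergence[where w="\<lambda>_. B"])
    interpret Q: prob_space Q by fact
    show "integrable Q (\<lambda>_. B)" by simp
    show "g \<in> borel_measurable Q" "(\<lambda>y. g (tr t y)) \<in> borel_measurable Q" for t
      unfolding measurable_cong_sets[OF Q(2) refl]
      by (rule borel_measurable_continuous_onI, fact)+
    show "AE y in Q. (\<lambda>t. g (tr t y)) \<longlonglongrightarrow> g y"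
    proof (rule AE_I2)
      fix y
      have "isCont g y" using g by (simp add: continuous_on_eq_continuous_at)
      from isCont_tendsto_compose[OF this tr_lim[of y]] show "(\<lambda>t. g (tr t y)) \<longlonglongrightarrow> g y" .
    qed
  qed (use B in auto)
  have "(\<integral>y. g (tr t y) \<partial>\<nu>) = (\<integral>y. g (tr t y) \<partial>\<nu>')" for t
  proof -
    have "bounded (range (\<lambda>y. g (tr t y)))" using B by (auto simp: bounded_iff)
    from eq[OF gt_cont this, of t] have "(\<integral>\<theta>. g (tr t (restrict \<theta> {..t})) \<partial>\<nu>) = (\<integral>\<theta>. g (tr t (restrict \<theta> {..t})) \<partial>\<nu>')" .
    moreover have "tr t (restrict y {..t}) = tr t y" for y by (auto simp: tr_def fun_eq_iff)
    ultimately show ?thesis by simp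
  qed
  then show "(\<integral>x. g x \<partial>\<nu>) = (\<integral>x. g x \<partial>\<nu>')"
    using lim[OF \<nu>(1) s(1)] lim[OF \<nu>'(1) s(2)] LIMSEQ_unique by simp
qed

lemma prob_space_std_normal: "prob_space std_normal"
  unfolding std_normal_def by (rule prob_space_normal_density) simp

lemma sets_std_normal[measurable_cong]: "sets std_normal = sets borel"
  by (simp add: std_normal_def)

text \<open>Reconciles the two indexings of the noise: the tail recursion first reads
  \<open>z 1\<close>, the affine path first reads \<open>z 0\<close>.\<close>

lemma std_normal_sequence_shift:
  "distr (\<Pi>\<^sub>M k\<in>UNIV. std_normal) (\<Pi>\<^sub>M k\<in>UNIV. std_normal) (\<lambda>z k. z (Suc k)) = (\<Pi>\<^sub>M k\<in>(UNIV::nat set). std_normal)"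
  using distr_PiM_reindex[of UNIV "\<lambda>_::nat. std_normal" Suc UNIV] prob_space_std_normal by (simp add: restrict_def)

context ccc_volatility
begin

lemma \<zeta>_law: "distr M (\<Pi>\<^sub>M k\<in>UNIV. borel) \<zeta> = (\<Pi>\<^sub>M k\<in>UNIV. std_normal)"
proof -
  have dZ: "distr M borel (Z t) = std_normal" for t
  proof -
    have "distr M borel (Z t) = distr M lborel (Z t)" by (rule distr_cong) auto
    also have "\<dots> = std_normal" using Z_normal[of t] by (simp add: distributed_def std_normal_def)
    finally show ?thesis .
  qed
  have Zm: "(\<lambda>w t. Z t w) \<in> measurable M (\<Pi>\<^sub>M t\<in>UNIV. borel)"
    by (rule measurable_PiM_single') auto
  have "distr M (\<Pi>\<^sub>M t\<in>UNIV. borel) (\<lambda>w. \<lambda>t\<in>UNIV. Z t w) = (\<Pi>\<^sub>M t\<in>UNIV. distr M borel (Z t))"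
    using Z_indep by (subst (asm) indep_vars_iff_distr_eq_PiM) auto
  then have law: "distr M (\<Pi>\<^sub>M t\<in>UNIV. borel) (\<lambda>w t. Z t w) = (\<Pi>\<^sub>M t\<in>UNIV. std_normal)" by (simp add: dZ restrict_def)
  have r: "(\<lambda>z k. z (int k)) \<in> measurable (\<Pi>\<^sub>M t\<in>UNIV. borel) (\<Pi>\<^sub>M k\<in>UNIV. (borel :: real measure))"
    by (rule measurable_PiM_single') (auto simp: space_PiM)
  have "distr M (\<Pi>\<^sub>M k\<in>UNIV. borel) \<zeta> = distr (distr M (\<Pi>\<^sub>M t\<in>UNIV. borel) (\<lambda>w t. Z t w)) (\<Pi>\<^sub>M k\<in>UNIV. borel) (\<lambda>z k. z (int k))"
    by (subst distr_distr[OF r Zm]) (simp add: comp_def \<zeta>_def[abs_def])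
  also have "\<dots> = distr (\<Pi>\<^sub>M t\<in>UNIV. std_normal) (\<Pi>\<^sub>M k\<in>UNIV. std_normal) (\<lambda>z k. z (int k))"
    unfolding law by (rule distr_cong) (auto intro!: sets_PiM_cong simp: sets_std_normal)
  also have "\<dots> = (\<Pi>\<^sub>M k\<in>UNIV. std_normal)"
    using distr_PiM_reindex[of UNIV "\<lambda>_::int. std_normal" int UNIV] prob_space_std_normal by (simp add: restrict_def)
  finally show ?thesis .
qed

end

context ccc_blocks
begin

section \<open>Paths given a large initial norm\<close>

abbreviation paths where "paths t \<equiv> (\<Pi>\<^sub>M s\<in>{..t::nat}. (borel :: (real^'d) measure))"

abbreviation apath where "apath t p z \<equiv> restrict (affine_path a b c (fst p) (snd p) z) {..t}"

abbreviation exceedance_law where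
  "exceedance_law t x \<equiv> distr (uniform_measure M {w\<in>space M. alpha_norm \<alpha> (X 0 w) > x}) (paths t)
     (\<lambda>w. \<lambda>s\<in>{..t}. vscale \<alpha> (alpha_norm \<alpha> (X 0 w)) (X (int s) w))"

lemma \<zeta>_measurable: "\<zeta> \<in> measurable M (\<Pi>\<^sub>M k\<in>UNIV. borel)"
  using indep_pairD(1)[OF X0_indep_future] .

lemma scaled_path: "AE w in M. \<forall>s. vscale \<alpha> (radius w) (X (int s) w) = affine_path a b c (\<theta> w) (\<mu> w) (\<zeta> w) s"
  using X_rec_all
proof eventually_elim
  fix w assume rec: "\<forall>t i. X t w $ i = a $ i + (b $ i + c $ i * (Z (t - 1) w)\<^sup>2) * X (t - 1) w $ i"
  show "\<forall>s. vscale \<alpha> (radius w) (X (int s) w) = affine_path a b c (\<theta> w) (\<mu> w) (\<zeta> w) s"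
  proof
    fix s show "vscale \<alpha> (radius w) (X (int s) w) = affine_path a b c (\<theta> w) (\<mu> w) (\<zeta> w) s"
    proof (induction s)
      case (Suc s)
      have "X (int (Suc s)) w $ i = a $ i + (b $ i + c $ i * (\<zeta> w s)\<^sup>2) * X (int s) w $ i" for i
        using rec[rule_format, of "int (Suc s)" i] by (simp add: \<zeta>_def)
      note step = this
      have IH: "affine_path a b c (\<theta> w) (\<mu> w) (\<zeta> w) s $ i = radius w powr (- 1 / \<alpha> $ i) * X (int s) w $ i" for i
        by (simp only: Suc[symmetric]) (simp add: vscale_def)
      have "radius w powr (- 1 / \<alpha> $ i) = \<mu> w $ i" for i by (simp add: \<mu>_def)
      then show ?case
        by (simp only: vec_eq_iff vscale_def affine_path.simps vec_lambda_beta IH step) (simp add: algebra_simps)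
    qed (simp add: \<theta>_def)
  qed
qed

text \<open>The noise is averaged out while the initial data \<open>p\<close>, a scaled vector with
  its scaling factors, stay frozen. This is the function \<open>h\<close> to which
  \<open>exceedance_limit\<close> is applied.\<close>

definition path_mean :: "nat \<Rightarrow> ((nat \<Rightarrow> real^'d) \<Rightarrow> real) \<Rightarrow> (real^'d) \<times> (real^'d) \<Rightarrow> real" where
  "path_mean t f p = expectation (\<lambda>w. f (apath t p (\<zeta> w)))"

abbreviation \<kappa>_sum where "\<kappa>_sum \<equiv> (\<Sum>l\<in>{1..r}. \<kappa> l)"

text \<open>The limiting probability, given that the norm is large, that block \<open>l\<close> is
  the large one.\<close>

definition wt where "wt l = \<kappa> l / \<kappa>_sum"

lemma sum_\<kappa>_pos: "\<kappa>_sum > 0"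
proof -
  obtain l where "l \<in> {1..r}" using block_cover by blast
  then show ?thesis using \<kappa>(1) by (intro sum_pos) auto
qed

lemma wt_pos: "wt l > 0"
  unfolding wt_def using \<kappa>(1) sum_\<kappa>_pos by (intro divide_pos_pos)

lemma sum_wt: "(\<Sum>l\<in>{1..r}. wt l) = 1"
  unfolding wt_def sum_divide_distrib[symmetric] using sum_\<kappa>_pos by simp

lemma radius_tail: "((\<lambda>x. x * \<P>(w in M. radius w > x)) \<longlongrightarrow> \<kappa>_sum) at_top"
proof -
  have "((\<lambda>x. x * expectation (\<lambda>w. indicator {w. radius w > x} w * 1)) \<longlongrightarrow> (\<Sum>l\<in>{1..r}. \<kappa> l * 1)) at_top"
    by (rule exceedance_limit[of "\<lambda>_. 1" 1]) auto
  moreover have "expectation (\<lambda>w. indicator {w. radius w > x} w * 1) = \<P>(w in M. radius w > x)" for x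
  proof -
    have "expectation (\<lambda>w. indicator {w. radius w > x} w * (1 :: real)) = expectation (indicator {w\<in>space M. radius w > x})"
      by (rule Bochner_Integration.integral_cong) (auto simp: indicator_def)
    then show ?thesis by simp
  qed
  ultimately show ?thesis by simp
qed

lemma radius_exceeds: "\<forall>\<^sub>F x in at_top. \<P>(w in M. radius w > x) > 0"
  using order_tendstoD(1)[OF radius_tail sum_\<kappa>_pos] eventually_gt_at_top[of 0]
  by eventually_elim (simp add: zero_less_mult_iff)

lemma measurable_apath:
  assumes "\<theta>' \<in> borel_measurable N" "\<mu>' \<in> borel_measurable N" "\<And>k. (\<lambda>x. z x k) \<in> borel_measurable N"
  shows "(\<lambda>x. restrict (affine_path a b c (\<theta>' x) (\<mu>' x) (z x)) {..t}) \<in> measurable N (paths t)"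
  by (rule measurable_restrict) (rule measurable_affine_path[OF assms])

text \<open>For frozen noise the path depends continuously on the initial data; bounded
  \<open>f\<close> allows dominated convergence along sequences.\<close>

lemma isCont_path_mean:
  assumes f: "continuous_on (space (paths t)) f"
    and B: "\<And>y. y \<in> space (paths t) \<Longrightarrow> \<bar>f y\<bar> \<le> B"
  shows "isCont (path_mean t f) p"
  unfolding continuous_at_sequentially comp_def path_mean_def
proof (intro allI impI)
  fix x assume x: "x \<longlonglongrightarrow> p"
  let ?S = "space (paths t)"
  have S: "?S = (\<Pi>\<^sub>E s\<in>{..t}. UNIV)" by (simp add: space_PiM)
  have inS: "restrict y {..t} \<in> ?S" for y by (simp add: S PiE_iff)
  have meas: "(\<lambda>w. f (apath t p (\<zeta> w))) \<in> borel_measurable M" for p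
    by (rule measurable_compose[OF measurable_apath continuous_imp_measurable_PiM[OF f]])
       (simp_all add: \<zeta>_def)
  show "(\<lambda>n. expectation (\<lambda>w. f (apath t (x n) (\<zeta> w)))) \<longlonglongrightarrow>
    expectation (\<lambda>w. f (apath t p (\<zeta> w)))"
  proof (rule integral_dominated_convergence[where w="\<lambda>_. B"])
    show "AE w in M. (\<lambda>n. f (apath t (x n) (\<zeta> w))) \<longlonglongrightarrow>
       f (apath t p (\<zeta> w))"
    proof (rule AE_I2)
      fix w
      have "continuous_on UNIV (\<lambda>p. apath t p (\<zeta> w))"
      proof (rule continuous_on_coordinatewise_then_product)
        fix i show "continuous_on UNIV (\<lambda>p. apath t p (\<zeta> w) i)"
          by (cases "i \<le> t") (auto intro!: continuous_on_affine_path)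
      qed
      then have "continuous_on UNIV (\<lambda>p. f (apath t p (\<zeta> w)))"
        by (rule continuous_on_compose2[OF f]) (use inS in auto)
      then have "isCont (\<lambda>p. f (apath t p (\<zeta> w))) p"
        by (rule continuous_on_interior) simp
      from isCont_tendsto_compose[OF this x] show "(\<lambda>n. f (apath t (x n) (\<zeta> w))) \<longlonglongrightarrow>
         f (apath t p (\<zeta> w))" .
    qed
    show "AE w in M. norm (f (apath t (x n) (\<zeta> w))) \<le> B" for n
      by (intro AE_I2, simp only: real_norm_def, rule B, rule inS)
  qed (simp_all only: meas, simp)
qed

abbreviation path_limit where "path_limit t f \<equiv> (\<Sum>l\<in>{1..r}. wt l * path_mean t f (q l, 0))"

text \<open>The conditional integral is a quotient. Independence of \<open>X 0\<close> and
  \<open>\<zeta>\<close> turns its numerator into an expectation of \<open>path_mean\<close>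
  (\<open>iter\<close>); after multiplication by \<open>x\<close>, \<open>exceedance_limit\<close>
  and \<open>radius_tail\<close> supply the limits of numerator and denominator.\<close>

lemma conditional_path_limit:
  assumes f: "continuous_on (space (paths t)) f"
    and bd: "bounded (f ` space (paths t))"
  shows "((\<lambda>x. \<integral>y. f y \<partial>exceedance_law t x)
      \<longlongrightarrow> path_limit t f) at_top"
proof -
  let ?S = "space (paths t)"
  let ?PM = "\<Pi>\<^sub>M k\<in>(UNIV::nat set). (borel :: real measure)"
  have S: "?S = (\<Pi>\<^sub>E s\<in>{..t}. UNIV)" by (simp add: space_PiM)
  have inS: "restrict y {..t} \<in> ?S" for y by (simp add: S PiE_iff)
  obtain B where B: "\<And>y. y \<in> ?S \<Longrightarrow> \<bar>f y\<bar> \<le> B" using bd by (auto simp: bounded_iff)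
  have Bh: "\<bar>path_mean t f p\<bar> \<le> B" for p
    unfolding path_mean_def by (intro abs_expectation_le B inS)
  have f_meas: "f \<in> borel_measurable (paths t)"
    by (rule continuous_imp_measurable_PiM[OF f])
  \<comment> \<open>\<open>th\<close> and \<open>mu\<close> express \<open>\<theta>\<close> and
    \<open>\<mu>\<close> through \<open>X 0\<close> alone, so that the scaled path becomes a
    function of the independent pair \<open>X 0\<close> and \<open>\<zeta>\<close>.\<close>
  define th where "th x = vscale \<alpha> (alpha_norm \<alpha> x) x" for x
  define mu where "mu x = (\<chi> i. alpha_norm \<alpha> x powr (- 1 / \<alpha> $ i))" for x :: "real^'d"
  note [measurable] = alpha_norm_measurable
  have [measurable]: "th \<in> borel_measurable borel" "mu \<in> borel_measurable borel"
    unfolding th_def vscale_def mu_def by (rule borel_measurable_vec_lambda, measurable)+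
  have th_eq: "\<theta> w = th (X 0 w)" and mu_eq: "\<mu> w = mu (X 0 w)" for w
    by (simp_all add: \<theta>_def th_def \<mu>_def mu_def radius_def)
  have [measurable]: "\<theta> \<in> borel_measurable M" "\<mu> \<in> borel_measurable M"
    by (simp_all add: th_eq[abs_def] mu_eq[abs_def])
  have h_cont: "isCont (path_mean t f) p" for p by (rule isCont_path_mean[OF f B])
  have h_meas: "path_mean t f \<in> borel_measurable borel"
    by (intro borel_measurable_continuous_onI continuous_at_imp_continuous_on ballI h_cont)
  have h_meas': "(\<lambda>w. path_mean t f (\<theta> w, \<mu> w)) \<in> borel_measurable M"
    by (rule measurable_compose[OF _ h_meas]) measurable
  define pth where "pth w = restrict (\<lambda>s. vscale \<alpha> (alpha_norm \<alpha> (X 0 w)) (X (int s) w)) {..t}" for w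
  have pth_meas: "pth \<in> measurable M (paths t)"
    unfolding pth_def by (rule measurable_restrict) (unfold vscale_def, rule borel_measurable_vec_lambda, measurable)
  have fp_meas: "(\<lambda>w. f (pth w)) \<in> borel_measurable M"
    by (rule measurable_compose[OF pth_meas f_meas])
  have iter: "expectation (\<lambda>w. indicator {w\<in>space M. radius w > x} w * f (pth w)) =
    expectation (\<lambda>w. indicator {w. radius w > x} w * path_mean t f (\<theta> w, \<mu> w))" for x
  proof -
    define G where "G = (\<lambda>(y, z). (if alpha_norm \<alpha> y > x then 1 else 0) * f (restrict (affine_path a b c (th y) (mu y) z) {..t}))"
    have "(\<lambda>p. restrict (affine_path a b c (th (fst p)) (mu (fst p)) (snd p)) {..t}) \<in> measurable (borel \<Otimes>\<^sub>M ?PM) (paths t)"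
    proof (rule measurable_apath)
      show "(\<lambda>p. snd p k) \<in> borel_measurable (borel \<Otimes>\<^sub>M ?PM)" for k
        by (rule measurable_compose[OF measurable_snd measurable_component_singleton]) simp
    qed measurable
    from measurable_compose[OF this f_meas]
    have [measurable]: "(\<lambda>p. f (restrict (affine_path a b c (th (fst p)) (mu (fst p)) (snd p)) {..t})) \<in> borel_measurable (borel \<Otimes>\<^sub>M ?PM)" .
    have G_meas: "G \<in> borel_measurable (borel \<Otimes>\<^sub>M ?PM)"
      unfolding G_def split_beta by measurable
    have G_bd: "\<bar>G (y, z)\<bar> \<le> B" for y z
      using B[OF inS, of "affine_path a b c (th y) (mu y) z"] by (auto simp: G_def abs_mult)
    have "expectation (\<lambda>w. indicator {w\<in>space M. radius w > x} w * f (pth w)) = expectation (\<lambda>w. G (X 0 w, \<zeta> w))"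
    proof (rule integral_cong_AE)
      have "(\<lambda>w. indicator {w\<in>space M. radius w > x} w) \<in> borel_measurable M" by measurable
      then show "(\<lambda>w. indicator {w\<in>space M. radius w > x} w * f (pth w)) \<in> borel_measurable M"
        using fp_meas by (rule borel_measurable_times)
      show "(\<lambda>w. G (X 0 w, \<zeta> w)) \<in> borel_measurable M"
        by (rule measurable_compose[OF measurable_Pair[OF X_measurable \<zeta>_measurable] G_meas])
      show "AE w in M. indicator {w\<in>space M. radius w > x} w * f (pth w) = G (X 0 w, \<zeta> w)"
        using scaled_path AE_space
      proof eventually_elim
        fix w assume 1: "\<forall>s. vscale \<alpha> (radius w) (X (int s) w) = affine_path a b c (\<theta> w) (\<mu> w) (\<zeta> w) s" and 2: "w \<in> space M"
        have "pth w = restrict (affine_path a b c (th (X 0 w)) (mu (X 0 w)) (\<zeta> w)) {..t}"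
          using 1 by (auto simp: pth_def radius_def th_eq[symmetric] mu_eq[symmetric] fun_eq_iff)
        then show "indicator {w\<in>space M. radius w > x} w * f (pth w) = G (X 0 w, \<zeta> w)"
          using 2 by (simp add: G_def radius_def)
      qed
    qed
    also have "\<dots> = expectation (\<lambda>w. expectation (\<lambda>w'. G (X 0 w, \<zeta> w')))"
      using indep_pairD[OF indep_pair_commute[OF X0_indep_future]] G_meas G_bd
      by (intro expectation_iterated)
    also have "\<dots> = expectation (\<lambda>w. indicator {w. radius w > x} w * path_mean t f (\<theta> w, \<mu> w))"
      by (rule Bochner_Integration.integral_cong) (auto simp: G_def path_mean_def radius_def th_eq mu_eq)
    finally show ?thesis .
  qed
  have lim: "((\<lambda>x. (x * expectation (\<lambda>w. indicator {w. radius w > x} w * path_mean t f (\<theta> w, \<mu> w))) / (x * \<P>(w in M. radius w > x)))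
     \<longlongrightarrow> (\<Sum>l\<in>{1..r}. \<kappa> l * path_mean t f (q l, 0)) / \<kappa>_sum) at_top"
    using sum_\<kappa>_pos by (intro tendsto_divide exceedance_limit[OF h_meas' Bh h_cont] radius_tail) simp
  have lim_eq: "(\<Sum>l\<in>{1..r}. \<kappa> l * path_mean t f (q l, 0)) / \<kappa>_sum = path_limit t f"
    by (simp add: wt_def sum_divide_distrib)
  show ?thesis
  proof (rule Lim_transform_eventually[OF lim[unfolded lim_eq]])
    show "\<forall>\<^sub>F x in at_top. (x * expectation (\<lambda>w. indicator {w. radius w > x} w * path_mean t f (\<theta> w, \<mu> w))) / (x * \<P>(w in M. radius w > x)) =
       (\<integral>y. f y \<partial>exceedance_law t x)"
      using radius_exceeds eventually_gt_at_top[of 0]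
    proof eventually_elim
      fix x :: real assume pos: "\<P>(w in M. radius w > x) > 0" and x: "x > 0"
      let ?U = "uniform_measure M {w\<in>space M. radius w > x}"
      have ev: "{w\<in>space M. radius w > x} \<in> events" by measurable
      have "(\<integral>y. f y \<partial>distr ?U (paths t) pth) = (\<integral>w. f (pth w) \<partial>?U)"
        by (rule integral_distr[OF _ f_meas]) (use pth_meas in \<open>simp add: measurable_cong_sets[OF sets_uniform_measure refl]\<close>)
      also have "\<dots> = expectation (\<lambda>w. indicator {w\<in>space M. radius w > x} w * f (pth w)) / \<P>(w in M. radius w > x)"
        by (rule integral_uniform_measure[OF ev pos fp_meas])
      finally show "(x * expectation (\<lambda>w. indicator {w. radius w > x} w * path_mean t f (\<theta> w, \<mu> w))) / (x * \<P>(w in M. radius w > x)) =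
       (\<integral>y. f y \<partial>exceedance_law t x)"
        using x unfolding iter by (simp add: pth_def[abs_def] radius_def)
    qed
  qed
qed

section \<open>The limit law and its support\<close>

definition spectral_measure where
  "spectral_measure = distr (point_measure {1..r} (\<lambda>l. ennreal (wt l))) borel q"

lemma sets_spectral_measure[measurable_cong]: "sets spectral_measure = sets borel"
  by (simp add: spectral_measure_def)

lemma emeasure_spectral_measure:
  "U \<in> sets borel \<Longrightarrow> emeasure spectral_measure U = (\<Sum>l\<in>{l\<in>{1..r}. q l \<in> U}. ennreal (wt l))"
  unfolding spectral_measure_def
  by (subst emeasure_distr) (auto simp: space_point_measure vimage_def Int_def conj_commute intro!: emeasure_point_measure_finite[THEN trans] sum.cong)

lemma prob_space_spectral_measure: "prob_space spectral_measure"
proof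
  have "emeasure spectral_measure UNIV = (\<Sum>l\<in>{1..r}. ennreal (wt l))"
    by (subst emeasure_spectral_measure) (auto intro!: sum.cong)
  also have "\<dots> = ennreal (\<Sum>l\<in>{1..r}. wt l)" using wt_pos by (intro sum_ennreal) (simp add: less_imp_le)
  finally show "emeasure spectral_measure (space spectral_measure) = 1"
    by (simp only: sum_wt sets_eq_imp_space_eq[OF sets_spectral_measure] space_borel) simp
qed

lemma integral_spectral_measure:
  fixes g :: "real^'d \<Rightarrow> real"
  assumes "g \<in> borel_measurable borel"
  shows "(\<integral>\<theta>. g \<theta> \<partial>spectral_measure) = (\<Sum>l\<in>{1..r}. wt l * g (q l))"
proof -
  have "(\<integral>\<theta>. g \<theta> \<partial>spectral_measure) = (\<integral>l. g (q l) \<partial>point_measure {1..r} (\<lambda>l. ennreal (wt l)))"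
    unfolding spectral_measure_def by (rule integral_distr[OF _ assms]) simp
  also have "\<dots> = (\<Sum>l\<in>{1..r}. wt l * g (q l))"
    using wt_pos by (subst lebesgue_integral_point_measure_finite) (auto simp: less_imp_le)
  finally show ?thesis .
qed

lemma support_spectral_measure: "measure_support spectral_measure = (\<Union>l\<in>{1..r}. {q l})"
proof (intro set_eqI iffI)
  fix x assume x: "x \<in> measure_support spectral_measure"
  show "x \<in> (\<Union>l\<in>{1..r}. {q l})"
  proof (rule ccontr)
    assume nx: "x \<notin> (\<Union>l\<in>{1..r}. {q l})"
    have op: "open (- (q ` {1..r}))" by (intro open_Compl finite_imp_closed) auto
    then have "emeasure spectral_measure (- (q ` {1..r})) > 0"
      using x nx by (auto simp: measure_support_def)
    moreover have "emeasure spectral_measure (- (q ` {1..r})) = 0"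
      using op by (subst emeasure_spectral_measure) auto
    ultimately show False by simp
  qed
next
  fix x assume "x \<in> (\<Union>l\<in>{1..r}. {q l})"
  then obtain l where l: "l \<in> {1..r}" "x = q l" by auto
  show "x \<in> measure_support spectral_measure"
    unfolding measure_support_def
  proof (intro CollectI allI impI)
    fix U assume U: "open U" "x \<in> U"
    have "0 < ennreal (wt l)" using wt_pos by simp
    also have "\<dots> \<le> (\<Sum>l\<in>{l\<in>{1..r}. q l \<in> U}. ennreal (wt l))"
      by (rule member_le_sum) (use l U in auto)
    also have "\<dots> = emeasure spectral_measure U" using U by (subst emeasure_spectral_measure) auto
    finally show "emeasure spectral_measure U > 0" .
  qed
qed

abbreviation noise where "noise \<equiv> (\<Pi>\<^sub>M k\<in>(UNIV::nat set). std_normal)"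

lemma prob_space_noise: "prob_space noise"
  by (rule prob_space_PiM) (rule prob_space_std_normal)

lemma measurable_noise_coordinate: "(\<lambda>z. z k) \<in> borel_measurable noise"
  using measurable_component_singleton[of k UNIV "\<lambda>_. std_normal"]
  by (simp add: measurable_cong_sets[OF refl sets_std_normal])

lemma measurable_tail_recursion:
  "(\<lambda>p. tail_recursion b c (fst p) (snd p) s) \<in> borel_measurable (spectral_measure \<Otimes>\<^sub>M noise)"
  unfolding tail_recursion_eq_affine_path[of b c _ _ _ a]
proof (rule measurable_affine_path)
  show "(\<lambda>p. snd p (Suc k)) \<in> borel_measurable (spectral_measure \<Otimes>\<^sub>M noise)" for k
    by (rule measurable_compose[OF measurable_snd measurable_noise_coordinate])
  have "fst \<in> measurable (spectral_measure \<Otimes>\<^sub>M noise) spectral_measure" by (rule measurable_fst)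
  then show "fst \<in> borel_measurable (spectral_measure \<Otimes>\<^sub>M noise)"
    by (simp add: measurable_cong_sets[OF refl sets_spectral_measure])
qed simp

definition tail_law where "tail_law = tail_recursion_law b c spectral_measure"

lemma measurable_tail_recursion_path:
  "(\<lambda>(\<theta>, z). tail_recursion b c \<theta> z) \<in> measurable (spectral_measure \<Otimes>\<^sub>M noise) (\<Pi>\<^sub>M t\<in>UNIV. borel)"
  unfolding split_beta by (rule measurable_PiM_single') (auto intro: measurable_tail_recursion)

lemma sets_tail_law: "sets tail_law = sets (\<Pi>\<^sub>M t\<in>UNIV. borel)"
  by (simp add: tail_law_def tail_recursion_law_def)

lemma prob_space_pair: "prob_space (spectral_measure \<Otimes>\<^sub>M noise)"
proof -
  interpret A: prob_space spectral_measure by (rule prob_space_spectral_measure)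
  interpret B: prob_space noise by (rule prob_space_noise)
  interpret pair_prob_space spectral_measure noise ..
  show ?thesis by unfold_locales
qed

lemma prob_space_tail_law: "prob_space tail_law"
  unfolding tail_law_def tail_recursion_law_def
  by (rule prob_space.prob_space_distr[OF prob_space_pair measurable_tail_recursion_path])

lemma marginal_tail_law: "distr tail_law borel (\<lambda>\<theta>. \<theta> 0) = spectral_measure"
proof -
  interpret A: prob_space spectral_measure by (rule prob_space_spectral_measure)
  interpret B: prob_space noise by (rule prob_space_noise)
  have "distr tail_law borel (\<lambda>\<theta>. \<theta> 0) = distr (spectral_measure \<Otimes>\<^sub>M noise) borel ((\<lambda>\<theta>. \<theta> 0) \<circ> (\<lambda>(\<theta>, z). tail_recursion b c \<theta> z))"
    unfolding tail_law_def tail_recursion_law_def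
    by (rule distr_distr[OF _ measurable_tail_recursion_path]) (rule measurable_component_singleton, simp)
  also have "\<dots> = distr (spectral_measure \<Otimes>\<^sub>M noise) spectral_measure fst"
    by (rule distr_cong) (auto simp: sets_spectral_measure)
  also have "\<dots> = spectral_measure" by (rule B.distr_pair_fst)
  finally show ?thesis .
qed

text \<open>The recursion reads the shifted noise, whose law is that of the unshifted noise and thus
  of \<open>\<zeta>\<close>; the vanishing scaling factors appear as the second component 0.\<close>

lemma noise_integral_tail_recursion:
  assumes f: "continuous_on (space (paths t)) f"
  shows "(\<integral>z. f (restrict (tail_recursion b c x0 z) {..t}) \<partial>noise) = path_mean t f (x0, 0)"
proof -
  define F where "F z = f (restrict (affine_path a b c x0 0 z) {..t})" for z
  have F_meas: "F \<in> borel_measurable Q" if "\<And>k. (\<lambda>z. z k) \<in> borel_measurable Q" for Q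
    unfolding F_def
    by (rule measurable_compose[OF measurable_apath continuous_imp_measurable_PiM[OF f]])
       (use that in auto)
  have sh: "(\<lambda>z k. z (Suc k)) \<in> measurable noise noise"
    by (rule measurable_PiM_single') (auto intro!: measurable_component_singleton simp: space_PiM)
  have "restrict (tail_recursion b c x0 z) {..t} = restrict (affine_path a b c x0 0 (\<lambda>k. z (Suc k))) {..t}" for z
    by (auto simp: restrict_def tail_recursion_eq_affine_path[of b c x0 z _ a])
  then have "(\<integral>z. f (restrict (tail_recursion b c x0 z) {..t}) \<partial>noise) = (\<integral>z. F (\<lambda>k. z (Suc k)) \<partial>noise)"
    by (simp add: F_def)
  also have "\<dots> = (\<integral>z. F z \<partial>distr noise noise (\<lambda>z k. z (Suc k)))"
    by (rule integral_distr[OF sh F_meas, symmetric]) (rule measurable_noise_coordinate)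
  also have "\<dots> = (\<integral>z. F z \<partial>noise)" by (simp only: std_normal_sequence_shift)
  also have "\<dots> = (\<integral>z. F z \<partial>distr M (\<Pi>\<^sub>M k\<in>UNIV. borel) \<zeta>)" by (simp only: \<zeta>_law)
  also have "\<dots> = expectation (\<lambda>w. F (\<zeta> w))"
    by (rule integral_distr[OF \<zeta>_measurable F_meas]) (rule measurable_component_singleton, simp)
  finally show ?thesis by (simp add: path_mean_def F_def)
qed

lemma measurable_restrict_path: "(\<lambda>\<theta>. restrict \<theta> {..t}) \<in> measurable (\<Pi>\<^sub>M s\<in>UNIV. borel) (paths t)"
  by (rule measurable_restrict_subset) simp

lemma tail_law_integral:
  assumes f: "continuous_on (space (paths t)) f"
    and bd: "bounded (f ` space (paths t))"
  shows "(\<integral>y. f y \<partial>distr tail_law (paths t) (\<lambda>\<theta>. restrict \<theta> {..t})) = path_limit t f"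
proof -
  interpret A: prob_space spectral_measure by (rule prob_space_spectral_measure)
  interpret B: prob_space noise by (rule prob_space_noise)
  interpret P: pair_prob_space spectral_measure noise ..
  let ?S = "space (paths t)"
  have inS: "restrict y {..t} \<in> ?S" for y by (simp add: space_PiM PiE_iff)
  obtain B where B: "\<And>y. y \<in> ?S \<Longrightarrow> \<bar>f y\<bar> \<le> B" using bd by (auto simp: bounded_iff)
  have f_meas: "f \<in> borel_measurable (paths t)"
    by (rule continuous_imp_measurable_PiM[OF f])
  have fr: "(\<lambda>\<theta>. f (restrict \<theta> {..t})) \<in> borel_measurable (\<Pi>\<^sub>M s\<in>UNIV. borel)"
    by (rule measurable_compose[OF measurable_restrict_path f_meas])
  have m: "(\<lambda>(\<theta>, z). f (restrict (tail_recursion b c \<theta> z) {..t})) \<in> borel_measurable (spectral_measure \<Otimes>\<^sub>M noise)"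
    using measurable_compose[OF measurable_tail_recursion_path fr] by (simp add: split_beta)
  have "(\<integral>y. f y \<partial>distr tail_law (paths t) (\<lambda>\<theta>. restrict \<theta> {..t})) = (\<integral>\<theta>. f (restrict \<theta> {..t}) \<partial>tail_law)"
    by (rule integral_distr[OF _ f_meas]) (simp add: measurable_cong_sets[OF sets_tail_law refl] measurable_restrict_path)
  also have "\<dots> = (\<integral>p. f (restrict ((\<lambda>(\<theta>, z). tail_recursion b c \<theta> z) p) {..t}) \<partial>(spectral_measure \<Otimes>\<^sub>M noise))"
    unfolding tail_law_def tail_recursion_law_def by (rule integral_distr[OF measurable_tail_recursion_path fr])
  also have "\<dots> = (\<integral>p. (\<lambda>(\<theta>, z). f (restrict (tail_recursion b c \<theta> z) {..t})) p \<partial>(spectral_measure \<Otimes>\<^sub>M noise))"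
    by (simp add: split_beta)
  also have "\<dots> = (\<integral>\<theta>. (\<integral>z. f (restrict (tail_recursion b c \<theta> z) {..t}) \<partial>noise) \<partial>spectral_measure)"
    by (rule P.integral_fst'[symmetric, THEN trans]) (use m B inS in \<open>auto intro!: P.integrable_bounded[of _ B] simp: split_beta\<close>)
  also have "\<dots> = (\<integral>\<theta>. path_mean t f (\<theta>, 0) \<partial>spectral_measure)"
    by (simp add: noise_integral_tail_recursion[OF f])
  also have "\<dots> = path_limit t f"
  proof (rule integral_spectral_measure)
    have "continuous_on UNIV (path_mean t f)" by (intro continuous_at_imp_continuous_on ballI isCont_path_mean[OF f B])
    then have "continuous_on UNIV (\<lambda>\<theta>. path_mean t f (\<theta>, 0))"
      by (rule continuous_on_compose2) (auto intro!: continuous_intros)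
    then show "(\<lambda>\<theta>. path_mean t f (\<theta>, 0)) \<in> borel_measurable borel" by (rule borel_measurable_continuous_onI)
  qed
  finally show ?thesis .
qed

lemma spectral_tail_law_tail_law: "spectral_tail_law M X \<alpha> tail_law"
  unfolding spectral_tail_law_def converges_weakly_def space_distr
proof (intro conjI allI impI prob_space_tail_law sets_tail_law)
  fix t and f :: "(nat \<Rightarrow> real^'d) \<Rightarrow> real"
  assume f: "continuous_on (space (paths t)) f"
    and bd: "bounded (f ` space (paths t))"
  show "((\<lambda>x. \<integral>y. f y \<partial>exceedance_law t x)
      \<longlongrightarrow> (\<integral>y. f y \<partial>distr tail_law (paths t) (\<lambda>\<theta>. restrict \<theta> {..t}))) at_top"
    unfolding tail_law_integral[OF f bd] by (rule conditional_path_limit[OF f bd])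
qed

text \<open>For every \<open>t\<close> both laws are weak limits of the same conditional laws, so
  they agree on bounded continuous functions of the path up to \<open>t\<close>.\<close>

lemma spectral_tail_law_unique:
  assumes "spectral_tail_law M X \<alpha> \<nu>" shows "\<nu> = tail_law"
proof (rule measure_eqI_finite_marginals)
  note props = assms[unfolded spectral_tail_law_def]
  show "prob_space \<nu>" by (rule conjunct1[OF props])
  show s: "sets \<nu> = sets (\<Pi>\<^sub>M t\<in>UNIV. borel)" by (rule conjunct1[OF conjunct2[OF props]])
  show "sets tail_law = sets (\<Pi>\<^sub>M t\<in>UNIV. borel)" by (rule sets_tail_law)
  show "prob_space tail_law" by (rule prob_space_tail_law)
  fix t and f :: "(nat \<Rightarrow> real^'d) \<Rightarrow> real"
  assume "continuous_on UNIV f" "bounded (range f)"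
  then have f: "continuous_on (space (paths t)) f"
    and bd: "bounded (f ` space (paths t))"
    by (auto intro: continuous_on_subset bounded_subset)
  have f_meas: "f \<in> borel_measurable (paths t)"
    by (rule continuous_imp_measurable_PiM[OF f])
  have eq: "(\<integral>y. f y \<partial>distr Q (paths t) (\<lambda>\<theta>. restrict \<theta> {..t})) = (\<integral>\<theta>. f (restrict \<theta> {..t}) \<partial>Q)"
    if "sets Q = sets (\<Pi>\<^sub>M t\<in>UNIV. borel)" for Q
    by (rule integral_distr[OF _ f_meas]) (simp add: measurable_cong_sets[OF that refl] measurable_restrict_path)
  have lim: "((\<lambda>x. \<integral>y. f y \<partial>exceedance_law t x)
      \<longlongrightarrow> (\<integral>y. f y \<partial>distr Q (paths t) (\<lambda>\<theta>. restrict \<theta> {..t}))) at_top"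
    if "spectral_tail_law M X \<alpha> Q" for Q
  proof -
    have "converges_weakly
        (\<lambda>x. exceedance_law t x)
        (distr Q (paths t) (\<lambda>\<theta>. restrict \<theta> {..t})) at_top"
      by (rule spec[OF conjunct2[OF conjunct2[OF that[unfolded spectral_tail_law_def]]]])
    then show ?thesis using f bd unfolding converges_weakly_def space_distr by blast
  qed
  have "(\<integral>y. f y \<partial>distr \<nu> (paths t) (\<lambda>\<theta>. restrict \<theta> {..t})) = (\<integral>y. f y \<partial>distr tail_law (paths t) (\<lambda>\<theta>. restrict \<theta> {..t}))"
    by (rule tendsto_unique[OF _ lim[OF assms] lim[OF spectral_tail_law_tail_law]]) simp
  then show "(\<integral>\<theta>. f (restrict \<theta> {..t}) \<partial>\<nu>) = (\<integral>\<theta>. f (restrict \<theta> {..t}) \<partial>tail_law)"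
    by (simp only: eq[OF s] eq[OF sets_tail_law])
qed

section \<open>Marginal tails and regular variation of the norm\<close>

lemma coordinate_tail_asymp:
  "\<exists>k>0. (\<lambda>x. \<P>(w in M. \<bar>X 0 w $ i\<bar> > x)) \<sim>[at_top] (\<lambda>x. k * x powr (- \<alpha> $ i))"
proof -
  obtain k where k: "k > 0" and lim: "((\<lambda>x. x * \<P>(w in M. T i w > x)) \<longlongrightarrow> k) at_top"
    using coordinate_tail[of i] by blast
  have "filterlim (\<lambda>x::real. x powr \<alpha> $ i) at_top at_top"
    using \<alpha>_pos[of i] by real_asymp
  from filterlim_compose[OF lim this]
  have "((\<lambda>x. x powr \<alpha> $ i * \<P>(w in M. T i w > x powr \<alpha> $ i) / k) \<longlongrightarrow> k / k) at_top"
    using k by (intro tendsto_divide) auto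
  moreover have "\<forall>\<^sub>F x in at_top. x powr \<alpha> $ i * \<P>(w in M. T i w > x powr \<alpha> $ i) / k =
      \<P>(w in M. \<bar>X 0 w $ i\<bar> > x) / (k * x powr (- \<alpha> $ i))"
    using eventually_gt_at_top[of 0]
  proof eventually_elim
    fix x :: real assume x: "x > 0"
    have "T i w > x powr \<alpha> $ i \<longleftrightarrow> \<bar>X 0 w $ i\<bar> > x" for w
      unfolding T_def using powr_less_mono2[OF \<alpha>_pos[of i], of x "X 0 w $ i"] powr_mono2[of "\<alpha> $ i" "X 0 w $ i" x] \<alpha>_pos[of i] x X_nonneg[of 0 w i]
      by (auto simp: not_le[symmetric])
    then show "x powr \<alpha> $ i * \<P>(w in M. T i w > x powr \<alpha> $ i) / k =
      \<P>(w in M. \<bar>X 0 w $ i\<bar> > x) / (k * x powr (- \<alpha> $ i))"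
      using x by (simp add: powr_minus field_simps)
  qed
  ultimately have "((\<lambda>x. \<P>(w in M. \<bar>X 0 w $ i\<bar> > x) / (k * x powr (- \<alpha> $ i))) \<longlongrightarrow> k / k) at_top"
    by (rule Lim_transform_eventually)
  then have "(\<lambda>x. \<P>(w in M. \<bar>X 0 w $ i\<bar> > x)) \<sim>[at_top] (\<lambda>x. k * x powr (- \<alpha> $ i))"
    using k by (intro asymp_equivI') simp
  then show ?thesis using k by blast
qed

text \<open>The tail of \<open>radius\<close> is asymptotic to \<open>\<kappa>_sum / x\<close>, so
  the index is 1.\<close>

lemma radius_regularly_varying: "regularly_varying_rv M (\<lambda>w. alpha_norm \<alpha> (X 0 w))"
  unfolding regularly_varying_rv_def
proof (intro conjI exI[of _ 1] allI impI)
  show "(\<lambda>w. alpha_norm \<alpha> (X 0 w)) \<in> borel_measurable M" using radius_measurable by (simp add: radius_def[abs_def])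
  fix u :: real assume u: "u > 0"
  have "filterlim (\<lambda>x. u * x) at_top at_top"
    using u by (intro filterlim_tendsto_pos_mult_at_top[OF tendsto_const _ filterlim_ident])
  from filterlim_compose[OF radius_tail this]
  have "((\<lambda>x. (1 / u) * ((u * x * \<P>(w in M. radius w > u * x)) / (x * \<P>(w in M. radius w > x)))) \<longlongrightarrow>
     (1 / u) * (\<kappa>_sum / \<kappa>_sum)) at_top"
    using sum_\<kappa>_pos by (intro tendsto_intros radius_tail) auto
  moreover have "\<forall>\<^sub>F x in at_top. (1 / u) * ((u * x * \<P>(w in M. radius w > u * x)) / (x * \<P>(w in M. radius w > x))) =
     \<P>(w in M. radius w > u * x) / \<P>(w in M. radius w > x)"
    using eventually_gt_at_top[of 0] by eventually_elim (use u in simp)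
  ultimately have "((\<lambda>x. \<P>(w in M. radius w > u * x) / \<P>(w in M. radius w > x)) \<longlongrightarrow>
     (1 / u) * (\<kappa>_sum / \<kappa>_sum)) at_top"
    by (rule Lim_transform_eventually)
  then show "((\<lambda>x. \<P>(w in M. alpha_norm \<alpha> (X 0 w) > u * x) / \<P>(w in M. alpha_norm \<alpha> (X 0 w) > x)) \<longlongrightarrow> u powr - 1) at_top"
    using sum_\<kappa>_pos u by (simp add: radius_def powr_minus_divide)
qed simp

theorem VSRV_X: "VSRV M X \<alpha>"
  unfolding VSRV_def strictly_stationary_def
  using X_stationary coordinate_tail_asymp radius_regularly_varying spectral_tail_law_tail_law by auto

end

theorem corollary6p3:
  fixes M :: "'w measure" and Z :: "int \<Rightarrow> 'w \<Rightarrow> real"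
    and a b c \<alpha> :: "real^'d::{finite,linorder}"
    and R \<sigma> X :: "int \<Rightarrow> 'w \<Rightarrow> real^'d::{finite,linorder}"
    and r :: nat and I :: "nat \<Rightarrow> 'd set"
  assumes "prob_space M"
    and "prob_space.indep_vars M (\<lambda>_. borel) Z UNIV"
    and "\<And>t. distributed M lborel (Z t) (\<lambda>x. ennreal (std_normal_density x))"
    and "\<And>i. a $ i > 0" and "\<And>i. b $ i > 0" and "\<And>i. c $ i > 0"
    and "\<And>i. (\<integral>\<omega>. ln (b $ i + c $ i * (Z 0 \<omega>)\<^sup>2) \<partial>M) < 0"
    and "\<And>i. \<alpha> $ i > 0"
    and "\<And>i. (\<integral>\<omega>. (b $ i + c $ i * (Z 0 \<omega>)\<^sup>2) powr (\<alpha> $ i) \<partial>M) = 1"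
    and "\<And>i j. i \<le> j \<Longrightarrow> \<alpha> $ j \<le> \<alpha> $ i"
    and "block_partition r I"
    and "\<And>i j. (b $ i = b $ j \<and> c $ i = c $ j) \<longleftrightarrow> (\<exists>l\<in>{1..r}. i \<in> I l \<and> j \<in> I l)"
    and "\<And>i j l m. l \<in> {1..r} \<Longrightarrow> m \<in> {1..r} \<Longrightarrow> l \<noteq> m \<Longrightarrow> i \<in> I l \<Longrightarrow> j \<in> I m \<Longrightarrow> \<alpha> $ i \<noteq> \<alpha> $ j"
    and "\<And>i j. \<alpha> $ i > \<alpha> $ j \<Longrightarrow> c $ j / c $ i \<ge> b $ j / b $ i"
    and "stationary_ccc_garch M Z a b c R \<sigma>"
    and "X = (\<lambda>t \<omega>. \<chi> i. (\<sigma> t \<omega> $ i)\<^sup>2)"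
  shows "VSRV M X \<alpha> \<and>
    (\<forall>\<nu>. spectral_tail_law M X \<alpha> \<nu> \<longrightarrow>
       measure_support (distr \<nu> borel (\<lambda>\<theta>. \<theta> 0)) = (\<Union>l\<in>{1..r}. {q_vec a (I l)}) \<and>
       \<nu> = tail_recursion_law b c (distr \<nu> borel (\<lambda>\<theta>. \<theta> 0)))"
proof -
  interpret prob_space M by fact
  have stat: "strictly_stationary M (\<lambda>t \<omega>. (R t \<omega>, \<sigma> t \<omega>))" and garch: "ccc_garch M Z a b c R \<sigma>"
    using assms(15) by (simp_all add: stationary_ccc_garch_def)
  have pair_meas: "(\<lambda>\<omega>. (R t \<omega>, \<sigma> t \<omega>)) \<in> borel_measurable M" for t
    using stat by (simp add: strictly_stationary_def)
  \<comment> \<open>Stationarity is given for the pair of \<open>R\<close> and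
    \<open>\<sigma>\<close>. \<open>X\<close> is the image of this pair under one measurable map
    applied at every time, and so inherits it.\<close>
  define sq where "sq y = (\<chi> i. (snd y $ i)\<^sup>2)" for y :: "(real^'d::{finite,linorder}) \<times> (real^'d::{finite,linorder})"
  have sq: "sq \<in> borel_measurable borel"
    unfolding sq_def
    by (rule borel_measurable_continuous_onI, intro continuous_on_vec_lambda) (intro continuous_intros)
  have X_eq: "X t \<omega> = sq (R t \<omega>, \<sigma> t \<omega>)" for t \<omega>
    by (simp add: assms(16) sq_def)
  have X_meas: "X t \<in> borel_measurable M" for t
    unfolding X_eq[abs_def] by (rule measurable_compose[OF pair_meas sq])
  have X_stat: "distr M (\<Pi>\<^sub>M t\<in>UNIV. borel) (\<lambda>\<omega> t. X (t + h) \<omega>) = distr M (\<Pi>\<^sub>M t\<in>UNIV. borel) (\<lambda>\<omega> t. X t \<omega>)" for h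
  proof -
    have m: "(\<lambda>\<omega> t. (R (t + h) \<omega>, \<sigma> (t + h) \<omega>)) \<in> measurable M (\<Pi>\<^sub>M t\<in>UNIV. borel)" for h
      by (rule measurable_PiM_single') (auto intro: pair_meas)
    have s: "(\<lambda>y t. sq (y t)) \<in> measurable (\<Pi>\<^sub>M t\<in>UNIV. borel) (\<Pi>\<^sub>M t\<in>(UNIV :: int set). borel)"
    proof (rule measurable_PiM_single')
      show "(\<lambda>y. sq (y t)) \<in> borel_measurable (\<Pi>\<^sub>M t\<in>UNIV. borel)" for t :: int
        by (rule measurable_compose[OF _ sq]) (rule measurable_component_singleton, simp)
    qed simp
    have eq: "distr M (\<Pi>\<^sub>M t\<in>UNIV. borel) (\<lambda>\<omega> t. X (t + h) \<omega>) =
      distr (distr M (\<Pi>\<^sub>M t\<in>UNIV. borel) (\<lambda>\<omega> t. (R (t + h) \<omega>, \<sigma> (t + h) \<omega>))) (\<Pi>\<^sub>M t\<in>UNIV. borel) (\<lambda>y t. sq (y t))" for h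
      unfolding distr_distr[OF s m] by (simp only: comp_def X_eq)
    have "distr M (\<Pi>\<^sub>M t\<in>UNIV. borel) (\<lambda>\<omega> t. (R (t + h) \<omega>, \<sigma> (t + h) \<omega>)) =
      distr M (\<Pi>\<^sub>M t\<in>UNIV. borel) (\<lambda>\<omega> t. (R t \<omega>, \<sigma> t \<omega>))"
      using stat by (simp add: strictly_stationary_def)
    then show ?thesis using eq[of h] eq[of 0] by simp
  qed
  \<comment> \<open>All coordinates share the innovation, so the square of \<open>R\<close> is
    \<open>Z\<close> squared times the volatility, and the GARCH equation becomes affine in
    \<open>X\<close>.\<close>
  have X_rec: "AE \<omega> in M. X t \<omega> $ i = a $ i + (b $ i + c $ i * (Z (t - 1) \<omega>)\<^sup>2) * X (t - 1) \<omega> $ i" for t i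
  proof -
    have "AE \<omega> in M. R (t - 1) \<omega> = Diag (\<sigma> (t - 1) \<omega>) *v (\<chi> i. Z (t - 1) \<omega>)"
      and "AE \<omega> in M. (\<sigma> t \<omega> $ i)\<^sup>2 = a $ i + b $ i * (\<sigma> (t - 1) \<omega> $ i)\<^sup>2 + c $ i * (R (t - 1) \<omega> $ i)\<^sup>2"
      using garch by (auto simp: ccc_garch_def)
    then show ?thesis
      by eventually_elim (simp add: assms(16) Diag_mult_vec power_mult_distrib algebra_simps)
  qed
  interpret ccc_blocks M Z a b c \<alpha> X r I
  proof unfold_locales
    show "0 \<le> X t \<omega> $ i" for t \<omega> i by (simp add: assms(16))
    show "\<alpha> $ i \<noteq> \<alpha> $ j" if "l \<in> {1..r}" "m \<in> {1..r}" "l \<noteq> m" "i \<in> I l" "j \<in> I m" for l m i j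
      using that by (rule assms(13))
  qed (fact X_meas X_stat X_rec assms)+
  have "spectral_tail_law M X \<alpha> \<nu> \<Longrightarrow>
       measure_support (distr \<nu> borel (\<lambda>\<theta>. \<theta> 0)) = (\<Union>l\<in>{1..r}. {q_vec a (I l)}) \<and>
       \<nu> = tail_recursion_law b c (distr \<nu> borel (\<lambda>\<theta>. \<theta> 0))" for \<nu>
    using spectral_tail_law_unique[of \<nu>] marginal_tail_law support_spectral_measure
    by (simp add: q_def tail_law_def)
  then show ?thesis using VSRV_X by blast
qed

end
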